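(* The following decision problem is $\Pi_2$-complete: given a simple signature, an effect theory $\mathcal{T}$ over it, and a closed simple handler of type $F\,0$ over it (i.e. a template $x:\alpha\mid z:\beta\vdash T_{\mathsf{op}}$ for each operation symbol $\mathsf{op}:\alpha\to\beta$), decide whether the handler is correct, i.e. whether the carrier $|F\emptyset|$ of the free model of $\mathcal{T}$ over the empty set, equipped with the operations $\mathsf{op}_H(a,\kappa) = [\![T_{\mathsf{op}}]\!]_{F\emptyset}(a,\kappa)$ for $a\in[\![\alpha]\!]$, $\kappa\in|F\emptyset|^{[\![\beta]\!]}$, forms a model of $\mathcal{T}$.
   Context: A simple signature is a finite set of operation symbols $\mathsf{op}:\alpha\to\beta$, where the types are built from $\alpha,\beta ::= 1 \mid \alpha\times\beta \mid \sum_{\ell\in L}\alpha_\ell$ ($L$ finite sets of labels), with no base types and no function symbols; so every type denotes a finite set $[\![\alpha]\!]$. Signature values $V$ are built from variables, $\langle\rangle$, pairs $\langle V,W\rangle$ and injections $\ell(V)$. Templates over a value context $\Gamma$ and template context $Z=z_1:\alpha_1,\dots,z_n:\alpha_n$ are $T ::= z(V)\mid \mathsf{match}\ V\ \mathsf{with}\ \langle x,y\rangle\mapsto T\mid \mathsf{match}\ V\ \mathsf{with}\ \{\ell(x_\ell)\mapsto T_\ell\}_{\ell\in L}\mid\mathsf{op}_V(x:\beta.\,T)$ with evident typing ($z(V)$ needs $z:\alpha\in Z$, $V:\alpha$; $\mathsf{op}_V(x:\beta.T)$ needs $\mathsf{op}:\alpha\to\beta$, $V:\alpha$, and $T$ well-formed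 with $x:\beta$ added). An effect theory is a finite set of equations $\Gamma\mid Z\vdash T_1=T_2$. Given a set $|\mathcal{M}|$ with maps $\mathsf{op}_{\mathcal{M}}:[\![\alpha]\!]\times|\mathcal{M}|^{[\![\beta]\!]}\to|\mathcal{M}|$, a template denotes $[\![T]\!]_{\mathcal{M}}:[\![\Gamma]\!]\times\prod_j|\mathcal{M}|^{[\![\alpha_j]\!]}\to|\mathcal{M}|$: $z_j(V)\mapsto b_j([\![V]\!](a))$, matches select the branch, $\mathsf{op}_V(x.T)\mapsto\mathsf{op}_{\mathcal{M}}([\![V]\!](a),x\mapsto[\![T]\!]_{\mathcal{M}}(\langle a,x\rangle,b))$. A model of $\mathcal{T}$ is such a structure satisfying $[\![T_1]\!]=[\![T_2]\!]$ for all equations of $\mathcal{T}$; homomorphisms preserve the operations. $F\emptyset$ denotes the free (equivalently, initial) model of $\mathcal{T}$, and $[\![T_{\mathsf{op}}]\!]_{F\emptyset}$ is evaluated using the original operations of $F\emptyset$. *)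

theory Defs
  imports Main "HOL-Library.Nat_Bijection"
begin

datatype recf = Zero | Succ | Proj nat | Comp recf "recf list" | Prim recf recf | Mn recf

inductive reval :: "recf \<Rightarrow> nat list \<Rightarrow> nat \<Rightarrow> bool" where
  r_zero: "reval Zero xs 0"
| r_succ: "reval Succ xs (Suc (case xs of [] \<Rightarrow> 0 | x # _ \<Rightarrow> x))"
| r_proj: "reval (Proj i) xs (if i < length xs then xs ! i else 0)"
| r_comp: "length ys = length gs \<Longrightarrow> (\<forall>j<length gs. reval (gs ! j) xs (ys ! j))
           \<Longrightarrow> reval f ys z \<Longrightarrow> reval (Comp f gs) xs z"
| r_prim0: "reval f xs y \<Longrightarrow> reval (Prim f g) (0 # xs) y"
| r_primS: "reval (Prim f g) (n # xs) r \<Longrightarrow> reval g (n # r # xs) y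
           \<Longrightarrow> reval (Prim f g) (Suc n # xs) y"
| r_mn: "reval f (n # xs) 0 \<Longrightarrow> (\<forall>m<n. \<exists>v. reval f (m # xs) v \<and> v \<noteq> 0)
           \<Longrightarrow> reval (Mn f) xs n"

definition computable1 :: "(nat \<Rightarrow> nat) \<Rightarrow> bool" where
  "computable1 f \<longleftrightarrow> (\<exists>r. \<forall>x. reval r [x] (f x))"

definition decidable3 :: "(nat \<Rightarrow> nat \<Rightarrow> nat \<Rightarrow> bool) \<Rightarrow> bool" where
  "decidable3 R \<longleftrightarrow> (\<exists>r. \<forall>x y z. reval r [x, y, z] (if R x y z then 1 else 0))"

definition Pi2 :: "nat set \<Rightarrow> bool" where
  "Pi2 A \<longleftrightarrow> (\<exists>R. decidable3 R \<and> (\<forall>x. x \<in> A \<longleftrightarrow> (\<forall>y. \<exists>z. R x y z)))"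

definition many_one_reducible :: "nat set \<Rightarrow> nat set \<Rightarrow> bool" where
  "many_one_reducible B A \<longleftrightarrow> (\<exists>f. computable1 f \<and> (\<forall>x. x \<in> B \<longleftrightarrow> f x \<in> A))"

definition Pi2_complete :: "nat set \<Rightarrow> bool" where
  "Pi2_complete A \<longleftrightarrow> Pi2 A \<and> (\<forall>B. Pi2 B \<longrightarrow> many_one_reducible B A)"

text \<open>Types: labels of a sum type are the positions 0..n-1 of the list.\<close>
datatype ty = One | Prod ty ty | Sum "ty list"

text \<open>Values; value variables are de Bruijn indices into the value context.\<close>
datatype val = VVar nat | VUnit | VPair val val | VInj nat val

text \<open>Templates; template variables z_j are indices into the template context.\<close>
datatype tmpl =
    TZ nat val
  | MatchPair val tmpl
  | MatchSum val "tmpl list"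
  | TOp nat val tmpl

text \<open>A signature: operation symbol i has arity (fst (sig!i)) and coarity (snd (sig!i)).\<close>
type_synonym signature = "(ty \<times> ty) list"
text \<open>An equation Gamma | Z |- T1 = T2.\<close>
type_synonym equation = "ty list \<times> ty list \<times> tmpl \<times> tmpl"

inductive typeV :: "ty list \<Rightarrow> val \<Rightarrow> ty \<Rightarrow> bool" where
  "n < length \<Gamma> \<Longrightarrow> typeV \<Gamma> (VVar n) (\<Gamma> ! n)"
| "typeV \<Gamma> VUnit One"
| "typeV \<Gamma> v a \<Longrightarrow> typeV \<Gamma> w b \<Longrightarrow> typeV \<Gamma> (VPair v w) (Prod a b)"
| "l < length as \<Longrightarrow> typeV \<Gamma> v (as ! l) \<Longrightarrow> typeV \<Gamma> (VInj l v) (Sum as)"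

inductive wfT :: "signature \<Rightarrow> ty list \<Rightarrow> ty list \<Rightarrow> tmpl \<Rightarrow> bool" where
  "j < length Z \<Longrightarrow> typeV \<Gamma> v (Z ! j) \<Longrightarrow> wfT sig \<Gamma> Z (TZ j v)"
| "typeV \<Gamma> v (Prod a b) \<Longrightarrow> wfT sig (a # b # \<Gamma>) Z T \<Longrightarrow> wfT sig \<Gamma> Z (MatchPair v T)"
| "typeV \<Gamma> v (Sum as) \<Longrightarrow> length Ts = length as
   \<Longrightarrow> (\<forall>l<length Ts. wfT sig ((as ! l) # \<Gamma>) Z (Ts ! l)) \<Longrightarrow> wfT sig \<Gamma> Z (MatchSum v Ts)"
| "i < length sig \<Longrightarrow> typeV \<Gamma> v (fst (sig ! i))
   \<Longrightarrow> wfT sig ((snd (sig ! i)) # \<Gamma>) Z T \<Longrightarrow> wfT sig \<Gamma> Z (TOp i v T)"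

definition wf_theory :: "signature \<Rightarrow> equation list \<Rightarrow> bool" where
  "wf_theory sig eqs \<longleftrightarrow>
     (\<forall>(\<Gamma>, Z, T1, T2) \<in> set eqs. wfT sig \<Gamma> Z T1 \<and> wfT sig \<Gamma> Z T2)"

definition wf_handler :: "signature \<Rightarrow> tmpl list \<Rightarrow> bool" where
  "wf_handler sig H \<longleftrightarrow> length H = length sig \<and>
     (\<forall>i<length sig. wfT sig [fst (sig ! i)] [snd (sig ! i)] (H ! i))"

datatype elem = EUnit | EPair elem elem | EInj nat elem

inductive inT :: "elem \<Rightarrow> ty \<Rightarrow> bool" where
  "inT EUnit One"
| "inT x a \<Longrightarrow> inT y b \<Longrightarrow> inT (EPair x y) (Prod a b)"
| "l < length as \<Longrightarrow> inT x (as ! l) \<Longrightarrow> inT (EInj l x) (Sum as)"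

primrec evalV :: "elem list \<Rightarrow> val \<Rightarrow> elem" where
  "evalV env (VVar n) = env ! n"
| "evalV env VUnit = EUnit"
| "evalV env (VPair v w) = EPair (evalV env v) (evalV env w)"
| "evalV env (VInj l v) = EInj l (evalV env v)"

fun evalT :: "(nat \<Rightarrow> elem \<Rightarrow> (elem \<Rightarrow> 'm) \<Rightarrow> 'm) \<Rightarrow> elem list \<Rightarrow> (nat \<Rightarrow> elem \<Rightarrow> 'm)
              \<Rightarrow> tmpl \<Rightarrow> 'm" where
  "evalT ops env b (TZ j v) = b j (evalV env v)"
| "evalT ops env b (MatchPair v T) =
     (case evalV env v of EPair x y \<Rightarrow> evalT ops (x # y # env) b T | _ \<Rightarrow> undefined)"
| "evalT ops env b (MatchSum v Ts) =
     (case evalV env v of EInj l x \<Rightarrow> (map (\<lambda>T. evalT ops (x # env) b T) Ts) ! l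
        | _ \<Rightarrow> undefined)"
| "evalT ops env b (TOp i v T) = ops i (evalV env v) (\<lambda>x. evalT ops (x # env) b T)"

definition is_model :: "signature \<Rightarrow> equation list \<Rightarrow> 'm set
                         \<Rightarrow> (nat \<Rightarrow> elem \<Rightarrow> (elem \<Rightarrow> 'm) \<Rightarrow> 'm) \<Rightarrow> bool" where
  "is_model sig eqs M ops \<longleftrightarrow>
     (\<forall>i<length sig. \<forall>a \<kappa>. inT a (fst (sig ! i)) \<longrightarrow>
         (\<forall>x. inT x (snd (sig ! i)) \<longrightarrow> \<kappa> x \<in> M) \<longrightarrow> ops i a \<kappa> \<in> M) \<and>
     (\<forall>(\<Gamma>, Z, T1, T2) \<in> set eqs. \<forall>env b.
         list_all2 inT env \<Gamma> \<longrightarrow>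
         (\<forall>j<length Z. \<forall>x. inT x (Z ! j) \<longrightarrow> b j x \<in> M) \<longrightarrow>
         evalT ops env b T1 = evalT ops env b T2)"

datatype tree = Dummy | Node nat elem "elem \<Rightarrow> tree"
text \<open>Dummy is only needed to make the datatype nonempty; it is never well-formed.\<close>

inductive wft :: "signature \<Rightarrow> tree \<Rightarrow> bool" for sig where
  "i < length sig \<Longrightarrow> inT a (fst (sig ! i)) \<Longrightarrow> (\<forall>x. inT x (snd (sig ! i)) \<longrightarrow> wft sig (k x))
   \<Longrightarrow> wft sig (Node i a k)"

inductive teq :: "signature \<Rightarrow> equation list \<Rightarrow> tree \<Rightarrow> tree \<Rightarrow> bool" for sig eqs where
  teq_refl: "wft sig t \<Longrightarrow> teq sig eqs t t"
| teq_sym: "teq sig eqs s t \<Longrightarrow> teq sig eqs t s"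
| teq_trans: "teq sig eqs s t \<Longrightarrow> teq sig eqs t u \<Longrightarrow> teq sig eqs s u"
| teq_cong: "i < length sig \<Longrightarrow> inT a (fst (sig ! i))
     \<Longrightarrow> (\<forall>x. inT x (snd (sig ! i)) \<longrightarrow> teq sig eqs (k x) (k' x))
     \<Longrightarrow> teq sig eqs (Node i a k) (Node i a k')"
| teq_ax: "(\<Gamma>, Z, T1, T2) \<in> set eqs \<Longrightarrow> list_all2 inT env \<Gamma>
     \<Longrightarrow> (\<forall>j<length Z. \<forall>x. inT x (Z ! j) \<longrightarrow> wft sig (b j x))
     \<Longrightarrow> teq sig eqs (evalT Node env b T1) (evalT Node env b T2)"

definition free_carrier :: "signature \<Rightarrow> equation list \<Rightarrow> tree set set" where
  "free_carrier sig eqs = {{s. teq sig eqs t s} | t. wft sig t}"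

definition free_ops :: "signature \<Rightarrow> equation list \<Rightarrow> nat \<Rightarrow> elem \<Rightarrow> (elem \<Rightarrow> tree set) \<Rightarrow> tree set" where
  "free_ops sig eqs i a \<kappa> = {s. teq sig eqs (Node i a (\<lambda>x. SOME t. t \<in> \<kappa> x)) s}"

definition handler_ops :: "signature \<Rightarrow> equation list \<Rightarrow> tmpl list
                           \<Rightarrow> nat \<Rightarrow> elem \<Rightarrow> (elem \<Rightarrow> tree set) \<Rightarrow> tree set" where
  "handler_ops sig eqs H i a \<kappa> = evalT (free_ops sig eqs) [a] (\<lambda>_. \<kappa>) (H ! i)"

definition handler_correct :: "signature \<Rightarrow> equation list \<Rightarrow> tmpl list \<Rightarrow> bool" where
  "handler_correct sig eqs H \<longleftrightarrow>
     is_model sig eqs (free_carrier sig eqs) (handler_ops sig eqs H)"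

fun enc_ty :: "ty \<Rightarrow> nat" where
  "enc_ty One = prod_encode (0, 0)"
| "enc_ty (Prod a b) = prod_encode (1, prod_encode (enc_ty a, enc_ty b))"
| "enc_ty (Sum as) = prod_encode (2, list_encode (map enc_ty as))"

primrec enc_val :: "val \<Rightarrow> nat" where
  "enc_val (VVar n) = prod_encode (0, n)"
| "enc_val VUnit = prod_encode (1, 0)"
| "enc_val (VPair v w) = prod_encode (2, prod_encode (enc_val v, enc_val w))"
| "enc_val (VInj l v) = prod_encode (3, prod_encode (l, enc_val v))"

fun enc_tmpl :: "tmpl \<Rightarrow> nat" where
  "enc_tmpl (TZ j v) = prod_encode (0, prod_encode (j, enc_val v))"
| "enc_tmpl (MatchPair v T) = prod_encode (1, prod_encode (enc_val v, enc_tmpl T))"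
| "enc_tmpl (MatchSum v Ts) = prod_encode (2, prod_encode (enc_val v, list_encode (map enc_tmpl Ts)))"
| "enc_tmpl (TOp i v T) = prod_encode (3, prod_encode (i, prod_encode (enc_val v, enc_tmpl T)))"

definition enc_sig :: "signature \<Rightarrow> nat" where
  "enc_sig sig = list_encode (map (\<lambda>(a, b). prod_encode (enc_ty a, enc_ty b)) sig)"

definition enc_eq :: "equation \<Rightarrow> nat" where
  "enc_eq e = (case e of (\<Gamma>, Z, T1, T2) \<Rightarrow>
     list_encode [list_encode (map enc_ty \<Gamma>), list_encode (map enc_ty Z), enc_tmpl T1, enc_tmpl T2])"

definition enc_instance :: "signature \<Rightarrow> equation list \<Rightarrow> tmpl list \<Rightarrow> nat" where
  "enc_instance sig eqs H =
     prod_encode (enc_sig sig, prod_encode (list_encode (map enc_eq eqs), list_encode (map enc_tmpl H)))"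

definition CORRECT_HANDLER :: "nat set" where
  "CORRECT_HANDLER = {enc_instance sig eqs H | sig eqs H.
      wf_theory sig eqs \<and> wf_handler sig H \<and> handler_correct sig eqs H}"

end

theory Submission
  imports Defs
begin

text \<open>
  Membership. By substituting representatives, correctness says that for all instances
  (equation, value environment, closed trees for the template variables) the two sides, evaluated
  with the handler as operations, are provably equal. Closed trees have finite codes, and
  well-formedness, evaluation and provable equality are all given by finitary inductive rules on codes.
  The least fixed point of an effective finitary operator is recursively enumerable, so the condition
  has the form "for all y: if C(x, y) then D(x, y)" with C and D recursively enumerable, which is Pi2.

  Hardness. One fixed equational theory contains a deterministic machine that interprets recursive
  functions: a configuration is a term and every transition is an equation. It contains an operation
  P with the equation P(v) = Acc, and the handler is the identity except that it maps P(v) to the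
  configuration searching for a z with R(x, Rd(v), z). Here Rd turns every closed term provably into
  a numeral, so the handler is correct iff for all y the search succeeds. That an unsuccessful search
  is not provably equal to Acc is seen in a model where configurations denote their outcome.
\<close>

section \<open>Computable functions\<close>

text \<open>The continuation of a tree is a function on all of \<open>elem\<close>, ill-typed
  elements included, and representatives of classes are picked by \<open>SOME\<close>. Codes
  therefore cannot match trees one to one, and everything about codes is stated up to provable
  equality. Each predicate on codes takes a single number, so that it is literally an
  \<open>lfp\<close> to which one theorem on enumeration operators applies. Evaluation becomes a
  relation, since only enumerability matters. In the hardness part all terms share one carrier, so
  the equation for P must survive for every closed \<open>v\<close>, configurations included; this
  is the obstacle that \<open>Rd\<close> removes. Continuation-passing style is used because
  equations apply in every context: the machine rules mention configurations only at the root, so a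
  configuration nested inside another one can be replaced by its outcome without disturbing any
  rule. Determinism at the root then yields the separating model directly, with no confluence
  argument.\<close>

definition cmp :: "nat \<Rightarrow> (nat list \<Rightarrow> nat) \<Rightarrow> bool" where
  "cmp k F \<longleftrightarrow> (\<exists>r. \<forall>xs. length xs = k \<longrightarrow> reval r xs (F xs))"

lemma cmp_proj: "i < k \<Longrightarrow> cmp k (\<lambda>xs. xs ! i)"
  unfolding cmp_def using r_proj[of i] by (intro exI[of _ "Proj i"]) (metis (mono_tags))

lemma cmp_comp:
  assumes "cmp (length Gs) F" "\<And>G. G \<in> set Gs \<Longrightarrow> cmp k G"
  shows "cmp k (\<lambda>xs. F (map (\<lambda>G. G xs) Gs))"
proof -
  obtain rf where rf: "\<And>xs. length xs = length Gs \<Longrightarrow> reval rf xs (F xs)"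
    using assms(1) by (auto simp: cmp_def)
  obtain rg where rg: "\<And>G xs. G \<in> set Gs \<Longrightarrow> length xs = k \<Longrightarrow> reval (rg G) xs (G xs)"
    using assms(2) unfolding cmp_def by metis
  have "reval (Comp rf (map rg Gs)) xs (F (map (\<lambda>G. G xs) Gs))" if "length xs = k" for xs
    by (rule r_comp[where ys = "map (\<lambda>G. G xs) Gs"]) (auto intro!: rf rg that)
  then show ?thesis unfolding cmp_def by blast
qed

lemma cmp_comp1: "cmp 1 (\<lambda>ys. f (ys ! 0)) \<Longrightarrow> cmp k a \<Longrightarrow> cmp k (\<lambda>xs. f (a xs))"
  using cmp_comp[of "[a]" "\<lambda>ys. f (ys ! 0)" k] by simp

lemma cmp_comp2:
  "cmp 2 (\<lambda>ys. f (ys ! 0) (ys ! 1)) \<Longrightarrow> cmp k a \<Longrightarrow> cmp k b \<Longrightarrow> cmp k (\<lambda>xs. f (a xs) (b xs))"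
  using cmp_comp[of "[a, b]" "\<lambda>ys. f (ys ! 0) (ys ! 1)" k] by (auto simp: numeral_2_eq_2)

lemma cmp_Suc1: "cmp 1 (\<lambda>ys. Suc (ys ! 0))"
proof -
  have "reval Succ xs (Suc (xs ! 0))" if "length xs = 1" for xs
    using r_succ[of xs] that by (cases xs) auto
  then show ?thesis unfolding cmp_def by blast
qed

lemmas cmp_Suc = cmp_comp1[of Suc, OF cmp_Suc1]

lemma cmp_const: "cmp k (\<lambda>_. c)"
proof (induction c)
  case 0
  show ?case unfolding cmp_def by (blast intro: r_zero)
qed (rule cmp_Suc)

text \<open>\<open>Prim\<close> recurses on the head of its argument list. Composition with
  \<open>h\<close> and all \<open>k\<close> projections puts the computed bound there.\<close>

lemma cmp_rec:
  assumes "cmp k f" "cmp (Suc (Suc k)) g" "cmp k h"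
  shows "cmp k (\<lambda>xs. rec_nat (f xs) (\<lambda>n r. g (n # r # xs)) (h xs))"
proof -
  obtain rf where rf: "\<And>xs. length xs = k \<Longrightarrow> reval rf xs (f xs)"
    using assms(1) by (auto simp: cmp_def)
  obtain rg where rg: "\<And>xs. length xs = Suc (Suc k) \<Longrightarrow> reval rg xs (g xs)"
    using assms(2) by (auto simp: cmp_def)
  have prim: "reval (Prim rf rg) (n # xs) (rec_nat (f xs) (\<lambda>n r. g (n # r # xs)) n)"
    if "length xs = k" for n xs
  proof (induction n)
    case 0
    show ?case using r_prim0[OF rf[OF that]] by simp
  next
    case (Suc n)
    show ?case using r_primS[OF Suc rg] that by simp
  qed
  have "cmp (Suc k) (\<lambda>ys. rec_nat (f (tl ys)) (\<lambda>n r. g (n # r # tl ys)) (hd ys))"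
    unfolding cmp_def
  proof (intro exI allI impI)
    fix ys :: "nat list" assume "length ys = Suc k"
    then obtain n xs where "ys = n # xs" "length xs = k" by (cases ys) auto
    then show "reval (Prim rf rg) ys (rec_nat (f (tl ys)) (\<lambda>n r. g (n # r # tl ys)) (hd ys))"
      using prim by simp
  qed
  then have *: "cmp k (\<lambda>xs. (\<lambda>ys. rec_nat (f (tl ys)) (\<lambda>n r. g (n # r # tl ys)) (hd ys))
      (map (\<lambda>G. G xs) (h # map (\<lambda>i xs. xs ! i) [0..<k])))"
    by (intro cmp_comp) (auto intro: cmp_proj assms(3))
  have eq: "map (\<lambda>i. xs ! i) [0..<k] = xs" if "length xs = k" for xs :: "nat list"
    using that by (metis map_nth)
  show ?thesis using * unfolding cmp_def by (simp add: comp_def eq cong: imp_cong)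
qed

text \<open>Existence of a zero makes the minimisation total; totality of \<open>F\<close> supplies
  the nonzero values that \<open>r_mn\<close> demands below the minimum.\<close>

lemma cmp_least:
  assumes "cmp (Suc k) F" "\<And>xs. length xs = k \<Longrightarrow> \<exists>n. F (n # xs) = 0"
  shows "cmp k (\<lambda>xs. LEAST n. F (n # xs) = 0)"
proof -
  obtain r where r: "\<And>xs. length xs = Suc k \<Longrightarrow> reval r xs (F xs)"
    using assms(1) by (auto simp: cmp_def)
  have "reval (Mn r) xs (LEAST n. F (n # xs) = 0)" if l: "length xs = k" for xs
  proof (rule r_mn)
    let ?n = "LEAST n. F (n # xs) = 0"
    have "F (?n # xs) = 0" using assms(2)[OF l] by (metis (mono_tags, lifting) LeastI)
    then show "reval r (?n # xs) 0" using r[of "?n # xs"] l by simp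
    show "\<forall>m<?n. \<exists>v. reval r (m # xs) v \<and> v \<noteq> 0"
    proof (intro allI impI)
      fix m assume "m < ?n"
      then have "F (m # xs) \<noteq> 0" using not_less_Least by blast
      then show "\<exists>v. reval r (m # xs) v \<and> v \<noteq> 0" using r[of "m # xs"] l by auto
    qed
  qed
  then show ?thesis unfolding cmp_def by blast
qed

lemma cmp_add2: "cmp 2 (\<lambda>ys. ys ! 0 + ys ! 1)"
proof -
  have "rec_nat b (\<lambda>n r. Suc r) a = a + b" for a b :: nat by (induction a) auto
  then show ?thesis
    using cmp_rec[of 2 "\<lambda>ys. ys ! 1" "\<lambda>ys. Suc (ys ! 1)" "\<lambda>ys. ys ! 0"]
    by (simp add: cmp_proj cmp_Suc)
qed
lemmas cmp_add = cmp_comp2[of "(+)", OF cmp_add2]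

lemma cmp_pred1: "cmp 1 (\<lambda>ys. ys ! 0 - 1)"
proof -
  have "rec_nat 0 (\<lambda>n r. n) a = a - 1" for a :: nat by (cases a) auto
  then show ?thesis
    using cmp_rec[of 1 "\<lambda>ys. 0" "\<lambda>ys. ys ! 0" "\<lambda>ys. ys ! 0"] by (simp add: cmp_proj cmp_const)
qed
lemmas cmp_pred = cmp_comp1[of "\<lambda>x. x - 1", OF cmp_pred1]

lemma cmp_sub2: "cmp 2 (\<lambda>ys. ys ! 0 - ys ! 1)"
proof -
  have "rec_nat a (\<lambda>n r. r - 1) b = a - b" for a b :: nat by (induction b) auto
  then show ?thesis
    using cmp_rec[of 2 "\<lambda>ys. ys ! 0" "\<lambda>ys. ys ! 1 - 1" "\<lambda>ys. ys ! 1"]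
      cmp_pred[of 4 "\<lambda>ys. ys ! 1"]
    by (simp add: cmp_proj numeral_eq_Suc)
qed
lemmas cmp_sub = cmp_comp2[of "(-)", OF cmp_sub2]

lemma cmp_triangle1: "cmp 1 (\<lambda>ys. triangle (ys ! 0))"
proof -
  have "rec_nat 0 (\<lambda>n r. r + Suc n) a = triangle a" for a by (induction a) auto
  moreover have "cmp (Suc (Suc 1)) (\<lambda>ys. ys ! 1 + Suc (ys ! 0))"
    by (intro cmp_add cmp_Suc cmp_proj) auto
  ultimately show ?thesis
    using cmp_rec[of 1 "\<lambda>ys. 0" "\<lambda>ys. ys ! 1 + Suc (ys ! 0)" "\<lambda>ys. ys ! 0"]
    by (simp add: cmp_proj cmp_const)
qed
lemmas cmp_triangle = cmp_comp1[of triangle, OF cmp_triangle1]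

lemma cmp_prod_encode:
  "cmp k a \<Longrightarrow> cmp k b \<Longrightarrow> cmp k (\<lambda>xs. prod_encode (a xs, b xs))"
  unfolding prod_encode_def by (simp add: cmp_add cmp_triangle)

text \<open>Here s x is the index m + n of the diagonal on which the pair (m, n) coded by x lies.\<close>
lemma prod_decode_diag:
  defines "s \<equiv> \<lambda>x. LEAST s. Suc x - triangle (Suc s) = 0"
  shows "fst (prod_decode x) = x - triangle (s x)"
    "snd (prod_decode x) = s x - (x - triangle (s x))"
proof -
  obtain m n where x: "x = prod_encode (m, n)" by (metis prod_decode_inverse surj_pair)
  have mono: "triangle i \<le> triangle j" if "i \<le> j" for i j
    using that by (induction rule: dec_induct) auto
  have "s x = m + n" unfolding s_def
  proof (rule Least_equality)
    show "Suc x - triangle (Suc (m + n)) = 0" by (simp add: x prod_encode_def)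
    fix y assume "Suc x - triangle (Suc y) = 0"
    then have "triangle (m + n) < triangle (Suc y)" by (simp add: x prod_encode_def)
    then show "m + n \<le> y" using mono[of "Suc y" "m + n"] by linarith
  qed
  then show "fst (prod_decode x) = x - triangle (s x)"
    "snd (prod_decode x) = s x - (x - triangle (s x))"
    by (auto simp: x) (auto simp: prod_encode_def)
qed

text \<open>Truncated subtraction turns \<open>x < triangle (Suc s)\<close> into a test for zero.
  The search succeeds at the latest with \<open>s = x\<close>, as \<open>triangle (Suc x)\<close> is
  at least \<open>Suc x\<close>.\<close>

lemma cmp_diag: "cmp 1 (\<lambda>xs. LEAST s. Suc (xs ! 0) - triangle (Suc s) = 0)"
proof -
  have "cmp (Suc 1) (\<lambda>ys. Suc (ys ! 1) - triangle (Suc (ys ! 0)))"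
    by (intro cmp_sub cmp_Suc cmp_triangle cmp_proj) auto
  moreover have "\<exists>n. Suc (xs ! 0) - triangle (Suc n) = 0" for xs :: "nat list"
    by (intro exI[of _ "xs ! 0"]) simp
  ultimately show ?thesis
    using cmp_least[of 1 "\<lambda>ys. Suc (ys ! 1) - triangle (Suc (ys ! 0))"] by simp
qed

lemma cmp_fst1: "cmp 1 (\<lambda>xs. fst (prod_decode (xs ! 0)))"
  unfolding prod_decode_diag by (intro cmp_sub cmp_triangle cmp_proj cmp_diag) auto

lemma cmp_snd1: "cmp 1 (\<lambda>xs. snd (prod_decode (xs ! 0)))"
  unfolding prod_decode_diag by (intro cmp_sub cmp_triangle cmp_proj cmp_diag) auto

section \<open>Unary computable functions on paired arguments\<close>

abbreviation pr :: "nat \<Rightarrow> nat \<Rightarrow> nat" where "pr a b \<equiv> prod_encode (a, b)"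
definition p1 :: "nat \<Rightarrow> nat" where "p1 x = fst (prod_decode x)"
definition p2 :: "nat \<Rightarrow> nat" where "p2 x = snd (prod_decode x)"

lemma p1_pr [simp]: "p1 (pr a b) = a" and p2_pr [simp]: "p2 (pr a b) = b"
  by (simp_all add: p1_def p2_def)
lemma pr_p1_p2 [simp]: "pr (p1 x) (p2 x) = x"
  by (simp add: p1_def p2_def)

lemma computable1_iff_cmp: "computable1 f \<longleftrightarrow> cmp 1 (\<lambda>xs. f (xs ! 0))"
proof
  assume "cmp 1 (\<lambda>xs. f (xs ! 0))"
  then obtain r where "\<And>xs. length xs = 1 \<Longrightarrow> reval r xs (f (xs ! 0))" by (auto simp: cmp_def)
  from this[of "[_]"] show "computable1 f" unfolding computable1_def by auto
next
  assume "computable1 f"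
  then obtain r where r: "\<And>x. reval r [x] (f x)" by (auto simp: computable1_def)
  show "cmp 1 (\<lambda>xs. f (xs ! 0))" unfolding cmp_def
  proof (intro exI allI impI)
    fix xs :: "nat list" assume "length xs = 1"
    then obtain x where "xs = [x]" by (cases xs) auto
    then show "reval r xs (f (xs ! 0))" using r by simp
  qed
qed

lemma cmp_computable1: "computable1 f \<Longrightarrow> cmp k a \<Longrightarrow> cmp k (\<lambda>xs. f (a xs))"
  unfolding computable1_iff_cmp by (rule cmp_comp1)

lemma c_comp: "computable1 f \<Longrightarrow> computable1 a \<Longrightarrow> computable1 (\<lambda>x. f (a x))"
  unfolding computable1_iff_cmp[of a] computable1_iff_cmp[of "\<lambda>x. f (a x)"]
  by (rule cmp_computable1)

lemma c_id: "computable1 (\<lambda>x. x)"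
  unfolding computable1_iff_cmp by (rule cmp_proj) simp

lemma c_const: "computable1 (\<lambda>x. c)"
  unfolding computable1_iff_cmp by (rule cmp_const)

lemma c_pair: "computable1 a \<Longrightarrow> computable1 b \<Longrightarrow> computable1 (\<lambda>x. pr (a x) (b x))"
  unfolding computable1_iff_cmp by (rule cmp_prod_encode)

lemma c_Suc: "computable1 a \<Longrightarrow> computable1 (\<lambda>x. Suc (a x))"
  unfolding computable1_iff_cmp by (rule cmp_Suc)

lemma c_add: "computable1 a \<Longrightarrow> computable1 b \<Longrightarrow> computable1 (\<lambda>x. a x + b x)"
  unfolding computable1_iff_cmp by (rule cmp_add)

lemma c_sub: "computable1 a \<Longrightarrow> computable1 b \<Longrightarrow> computable1 (\<lambda>x. a x - b x)"
  unfolding computable1_iff_cmp by (rule cmp_sub)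

lemma c_p1: "computable1 a \<Longrightarrow> computable1 (\<lambda>x. p1 (a x))"
  unfolding computable1_iff_cmp p1_def by (rule cmp_comp1[OF cmp_fst1])

lemma c_p2: "computable1 a \<Longrightarrow> computable1 (\<lambda>x. p2 (a x))"
  unfolding computable1_iff_cmp p2_def by (rule cmp_comp1[OF cmp_snd1])

text \<open>With unary functions only, the step function receives counter, previous value and
  parameter packed as \<open>pr n (pr r e)\<close>.\<close>

lemma c_rec:
  assumes "computable1 f" "computable1 h"
    "computable1 (\<lambda>p. G (p1 p) (p1 (p2 p)) (p2 (p2 p)))"
  shows "computable1 (\<lambda>e. rec_nat (f e) (\<lambda>n r. G n r e) (h e))"
proof -
  let ?g = "\<lambda>p. G (p1 p) (p1 (p2 p)) (p2 (p2 p))"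
  have "cmp (Suc (Suc 1)) (\<lambda>ys. ?g (pr (ys ! 0) (pr (ys ! 1) (ys ! 2))))"
    by (rule cmp_computable1[OF assms(3)]) (intro cmp_prod_encode cmp_proj; simp)
  then have "cmp (Suc (Suc 1)) (\<lambda>ys. G (ys ! 0) (ys ! 1) (ys ! 2))" by simp
  from cmp_rec[OF _ this] assms(1,2) show ?thesis
    unfolding computable1_iff_cmp by (simp add: numeral_2_eq_2)
qed

lemma c_if:
  assumes "computable1 a" "computable1 b" "computable1 c"
  shows "computable1 (\<lambda>x. if a x = 0 then b x else c x)"
proof -
  have "rec_nat s (\<lambda>_ _. t) n = (if n = 0 then s else t)" for s t n :: nat by (cases n) auto
  moreover have "computable1 (\<lambda>e. rec_nat (b e) (\<lambda>n r. c e) (a e))"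
    by (intro c_rec assms c_comp[of c] c_p2 c_id)
  ultimately show ?thesis by simp
qed

lemma decidable3I:
  assumes "computable1 f"
  shows "decidable3 (\<lambda>x y z. f (pr x (pr y z)) = 0)"
proof -
  have "computable1 (\<lambda>x. if f x = 0 then 1 else 0)"
    by (intro c_if assms c_const)
  then have "cmp 3 (\<lambda>ys. (\<lambda>x. if f x = 0 then 1 else 0) (pr (ys ! 0) (pr (ys ! 1) (ys ! 2))))"
    by (rule cmp_computable1) (intro cmp_prod_encode cmp_proj; simp)
  then obtain r where r: "\<And>ys. length ys = 3 \<Longrightarrow>
      reval r ys (if f (pr (ys ! 0) (pr (ys ! 1) (ys ! 2))) = 0 then 1 else 0)"
    by (auto simp: cmp_def)
  show ?thesis unfolding decidable3_def
  proof (intro exI allI)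
    fix x y z
    show "reval r [x, y, z] (if f (pr x (pr y z)) = 0 then 1 else 0)"
      using r[of "[x, y, z]"] by (simp add: numeral_2_eq_2)
  qed
qed

section \<open>Enumeration operators\<close>

abbreviation cns :: "nat \<Rightarrow> nat \<Rightarrow> nat" where "cns x l \<equiv> Suc (pr x l)"
abbreviation ld :: "nat \<Rightarrow> nat list" where "ld \<equiv> list_decode"
abbreviation le :: "nat list \<Rightarrow> nat" where "le \<equiv> list_encode"

definition hdc :: "nat \<Rightarrow> nat" where "hdc l = p1 (l - 1)"
definition tlc :: "nat \<Rightarrow> nat" where "tlc l = p2 (l - 1)"
definition dropc :: "nat \<Rightarrow> nat \<Rightarrow> nat" where "dropc l i = rec_nat l (\<lambda>_ r. tlc r) i"
definition nthc :: "nat \<Rightarrow> nat \<Rightarrow> nat" where "nthc l i = hdc (dropc l i)"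
text \<open>The loop state pairs the unread part with the accumulator and stays put once the input
  is exhausted, so running it \<open>l\<close> times is enough. Reversal is harmless: the results
  serve as collections of queries or goals.\<close>

definition revapp :: "nat \<Rightarrow> nat \<Rightarrow> nat" where
  "revapp l m = p2 (rec_nat (pr l m)
     (\<lambda>_ s. if p1 s = 0 then s else pr (tlc (p1 s)) (cns (hdc (p1 s)) (p2 s))) l)"

lemma tlc_0 [simp]: "tlc 0 = 0" and hdc_0 [simp]: "hdc 0 = 0"
  by (simp_all add: tlc_def hdc_def p1_def p2_def prod_decode_def prod_decode_aux.simps)
lemma tlc_cns [simp]: "tlc (cns a b) = b" and hdc_cns [simp]: "hdc (cns a b) = a"
  by (simp_all add: tlc_def hdc_def)

lemma code_list_cases: obtains "l = 0" | a b where "l = cns a b"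
  by (cases l) (metis pr_p1_p2)+

lemma ld_tlc: "ld (tlc l) = tl (ld l)"
  by (cases l rule: code_list_cases) auto

lemma ld_dropc: "ld (dropc l i) = drop i (ld l)"
  by (induction i) (auto simp: dropc_def ld_tlc drop_Suc tl_drop)

lemma ld_eq_Nil [simp]: "ld l = [] \<longleftrightarrow> l = 0"
  by (cases l rule: code_list_cases) auto

lemma hdc_hd: "hdc l = (case ld l of [] \<Rightarrow> 0 | x # _ \<Rightarrow> x)"
  by (cases l rule: code_list_cases) auto

lemma nthc_nth: "nthc l i = (if i < length (ld l) then ld l ! i else 0)"
proof (cases "i < length (ld l)")
  case True
  then show ?thesis by (simp add: nthc_def hdc_hd ld_dropc flip: Cons_nth_drop_Suc)
qed (simp add: nthc_def hdc_hd ld_dropc)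

lemma nthc_le [simp]: "nthc (le xs) i = (if i < length xs then xs ! i else 0)"
  by (simp add: nthc_nth)

lemma nthc_cns_0 [simp]: "nthc (cns a b) 0 = a"
  by (simp add: nthc_nth)

text \<open>Makes the code of a list a sufficient bound for any loop through the list.\<close>

lemma length_ld_le: "length (ld l) \<le> l"
proof (induction l rule: less_induct)
  case (less l)
  show ?case
  proof (cases l rule: code_list_cases)
    case (2 a b)
    then have "b < l" using le_prod_encode_2[of b a] by simp
    with less[of b] 2 show ?thesis using le_prod_encode_2[of b a] by auto
  qed simp
qed

lemma ld_revapp: "ld (revapp l m) = rev (ld l) @ ld m"
proof -
  define F where "F = (\<lambda>n. rec_nat (pr l m)
     (\<lambda>_ s. if p1 s = 0 then s else pr (tlc (p1 s)) (cns (hdc (p1 s)) (p2 s))) n)"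
  have inv: "ld (p1 (F n)) = drop n (ld l) \<and> rev (ld (p1 (F n))) @ ld (p2 (F n)) = rev (ld l) @ ld m" for n
  proof (induction n)
    case 0
    show ?case by (simp add: F_def)
  next
    case (Suc n)
    have "F (Suc n) = (if p1 (F n) = 0 then F n
        else pr (tlc (p1 (F n))) (cns (hdc (p1 (F n))) (p2 (F n))))"
      by (simp add: F_def)
    moreover have "drop (Suc n) (ld l) = tl (ld (p1 (F n)))"
      using Suc by (simp add: drop_Suc tl_drop)
    ultimately show ?case using Suc by (cases "p1 (F n)" rule: code_list_cases) auto
  qed
  have "p1 (F l) = 0" using inv[of l] length_ld_le[of l] by simp
  with inv[of l] show ?thesis by (simp add: revapp_def F_def)
qed

lemma c_hdc: "computable1 a \<Longrightarrow> computable1 (\<lambda>x. hdc (a x))"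
  unfolding hdc_def by (intro c_p1 c_sub c_const)
lemma c_tlc: "computable1 a \<Longrightarrow> computable1 (\<lambda>x. tlc (a x))"
  unfolding tlc_def by (intro c_p2 c_sub c_const)
lemma c_dropc: "computable1 a \<Longrightarrow> computable1 b \<Longrightarrow> computable1 (\<lambda>x. dropc (a x) (b x))"
  unfolding dropc_def by (intro c_rec c_tlc c_p1 c_p2 c_id)
lemma c_nthc: "computable1 a \<Longrightarrow> computable1 b \<Longrightarrow> computable1 (\<lambda>x. nthc (a x) (b x))"
  unfolding nthc_def by (intro c_hdc c_dropc)
lemma c_revapp: "computable1 a \<Longrightarrow> computable1 b \<Longrightarrow> computable1 (\<lambda>x. revapp (a x) (b x))"
  unfolding revapp_def by (intro c_rec c_tlc c_hdc c_if c_pair c_Suc c_p1 c_p2 c_id)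

text \<open>Counts the positions below the code at which a nonempty tail remains.\<close>

lemma c_length:
  assumes "computable1 a" shows "computable1 (\<lambda>x. length (ld (a x)))"
proof -
  have "rec_nat 0 (\<lambda>i r. if dropc l i = 0 then r else Suc r) n = min n (length (ld l))" for l n
    by (induction n) (auto simp flip: ld_eq_Nil simp: ld_dropc)
  then have "rec_nat 0 (\<lambda>i r. if dropc l i = 0 then r else Suc r) l = length (ld l)" for l
    using length_ld_le[of l] by simp
  moreover have "computable1 (\<lambda>x. rec_nat 0 (\<lambda>i r. if dropc (a x) i = 0 then r else Suc r) (a x))"
    by (intro c_rec c_if c_dropc c_Suc c_p1 c_p2 c_id c_const assms c_comp[OF assms])
  ultimately show ?thesis by simp
qed

lemmas c_intros = c_id c_const c_pair c_Suc c_p1 c_p2 c_hdc c_tlc c_nthc c_length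

section \<open>Recursively enumerable predicates and closure of enumeration operators\<close>

definition re :: "(nat \<Rightarrow> bool) \<Rightarrow> bool" where
  "re P \<longleftrightarrow> (\<exists>f. computable1 f \<and> (\<forall>c. P c \<longleftrightarrow> (\<exists>z. f (pr c z) = 0)))"

text \<open>Enumeration operators: whether c belongs to the operator applied to X is semi-decided by
  guessing z and making the finitely many positive queries listed by q to X.\<close>

definition enum_op :: "((nat \<Rightarrow> bool) \<Rightarrow> nat \<Rightarrow> bool) \<Rightarrow> bool" where
  "enum_op Q \<longleftrightarrow> (\<exists>f q. computable1 f \<and> computable1 q \<and>
     (\<forall>X c. Q X c \<longleftrightarrow> (\<exists>z. f (pr c z) = 0 \<and> (\<forall>p\<in>set (ld (q (pr c z))). X p))))"

lemma enum_opI: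
  assumes "computable1 f" "computable1 q"
    "\<And>X c. Q X c \<longleftrightarrow> (\<exists>z. f (pr c z) = 0 \<and> (\<forall>p\<in>set (ld (q (pr c z))). X p))"
  shows "enum_op Q"
  using assms unfolding enum_op_def by (intro exI[of _ f] exI[of _ q]) simp

text \<open>Even a constant operator comes with queries. Taking the full predicate for
  \<open>X\<close> makes all of them succeed, so only the test is left.\<close>

lemma re_enum_op: "enum_op (\<lambda>X. P) \<Longrightarrow> re P"
proof -
  assume "enum_op (\<lambda>X. P)"
  then obtain f q where f: "computable1 f" and
    "\<forall>X c. P c \<longleftrightarrow> (\<exists>z. f (pr c z) = 0 \<and> (\<forall>p\<in>set (ld (q (pr c z))). (X :: nat \<Rightarrow> bool) p))"
    unfolding enum_op_def by blast
  from this(2)[rule_format, of _ "\<lambda>_. True"] show "re P" using f unfolding re_def by auto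
qed

lemma enum_op_re:
  assumes "re P" "computable1 g" shows "enum_op (\<lambda>X c. P (g c))"
proof -
  obtain f where f: "computable1 f" "\<And>c. P c \<longleftrightarrow> (\<exists>z. f (pr c z) = 0)"
    using assms(1) unfolding re_def by blast
  have "computable1 (\<lambda>p. f (pr (g (p1 p)) (p2 p)))"
    by (intro c_comp[OF f(1)] c_comp[OF assms(2)] c_intros)
  then show ?thesis unfolding enum_op_def
    by (intro exI[of _ "\<lambda>p. f (pr (g (p1 p)) (p2 p))"] exI[of _ "\<lambda>p. 0"])
      (auto simp: f(2) intro: c_const)
qed

lemma enum_op_app: "computable1 g \<Longrightarrow> enum_op (\<lambda>X c. X (g c))"
proof -
  assume g: "computable1 g"
  have "computable1 (\<lambda>p. cns (g (p1 p)) 0)" by (intro c_comp[OF g] c_intros)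
  then show ?thesis unfolding enum_op_def
    by (intro exI[of _ "\<lambda>p. 0"] exI[of _ "\<lambda>p. cns (g (p1 p)) 0"]) (auto intro: c_const)
qed

lemma enum_op_comp:
  assumes "enum_op Q" "computable1 g" shows "enum_op (\<lambda>X c. Q X (g c))"
proof -
  obtain f q where 1: "computable1 f" "computable1 q"
    "\<And>X c. Q X c \<longleftrightarrow> (\<exists>z. f (pr c z) = 0 \<and> (\<forall>p\<in>set (ld (q (pr c z))). X p))"
    using assms(1) unfolding enum_op_def by blast
  let ?a = "\<lambda>w. pr (g (p1 w)) (p2 w)"
  have "computable1 (\<lambda>w. f (?a w))" "computable1 (\<lambda>w. q (?a w))"
    by (intro c_comp[OF 1(1)] c_comp[OF 1(2)] c_comp[OF assms(2)] c_intros)+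
  then show ?thesis by (rule enum_opI) (simp add: 1(3))
qed

lemma enum_op_test: "computable1 g \<Longrightarrow> enum_op (\<lambda>X c. g c = 0)"
proof (rule enum_op_re[of "\<lambda>x. x = 0"])
  show "re (\<lambda>x. x = 0)" unfolding re_def by (intro exI[of _ p1]) (auto intro: c_p1[OF c_id])
qed

lemma enum_op_eq: "computable1 f \<Longrightarrow> computable1 g \<Longrightarrow> enum_op (\<lambda>X c. f c = g c)"
proof -
  assume "computable1 f" "computable1 g"
  then have "enum_op (\<lambda>X c. (f c - g c) + (g c - f c) = 0)" by (intro enum_op_test c_add c_sub)
  moreover have "(\<lambda>X :: nat \<Rightarrow> bool. \<lambda>c. (f c - g c) + (g c - f c) = 0) = (\<lambda>X c. f c = g c)"
    by (intro ext) auto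
  ultimately show ?thesis by simp
qed

lemma enum_op_less: "computable1 f \<Longrightarrow> computable1 g \<Longrightarrow> enum_op (\<lambda>X c. f c < g c)"
proof -
  assume "computable1 f" "computable1 g"
  then have "enum_op (\<lambda>X c. Suc (f c) - g c = 0)" by (intro enum_op_test c_Suc c_sub)
  moreover have "(\<lambda>X :: nat \<Rightarrow> bool. \<lambda>c. Suc (f c) - g c = 0) = (\<lambda>X c. f c < g c)"
    by (intro ext) auto
  ultimately show ?thesis by simp
qed

text \<open>The guess is a pair; tests are added, so that the sum is zero iff both are, and the
  queries are joined.\<close>

lemma enum_op_conj:
  assumes "enum_op P" "enum_op Q" shows "enum_op (\<lambda>X c. P X c \<and> Q X c)"
proof -
  obtain f q where 1: "computable1 f" "computable1 q"
    "\<And>X c. P X c \<longleftrightarrow> (\<exists>z. f (pr c z) = 0 \<and> (\<forall>p\<in>set (ld (q (pr c z))). X p))"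
    using assms(1) unfolding enum_op_def by blast
  obtain f' q' where 2: "computable1 f'" "computable1 q'"
    "\<And>X c. Q X c \<longleftrightarrow> (\<exists>z. f' (pr c z) = 0 \<and> (\<forall>p\<in>set (ld (q' (pr c z))). X p))"
    using assms(2) unfolding enum_op_def by blast
  let ?a = "\<lambda>w. pr (p1 w) (p1 (p2 w))" and ?b = "\<lambda>w. pr (p1 w) (p2 (p2 w))"
  have "computable1 (\<lambda>w. f (?a w) + f' (?b w))" "computable1 (\<lambda>w. revapp (q (?a w)) (q' (?b w)))"
    by (intro c_add c_revapp c_comp[OF 1(1)] c_comp[OF 1(2)] c_comp[OF 2(1)] c_comp[OF 2(2)]
        c_intros)+
  moreover have "P X c \<and> Q X c \<longleftrightarrow> (\<exists>z. f (?a (pr c z)) + f' (?b (pr c z)) = 0 \<and>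
      (\<forall>p\<in>set (ld (revapp (q (?a (pr c z))) (q' (?b (pr c z))))). X p))" (is "?l \<longleftrightarrow> ?r") for X c
  proof
    assume ?l
    then have "P X c" "Q X c" by auto
    obtain z where "f (pr c z) = 0 \<and> (\<forall>p\<in>set (ld (q (pr c z))). X p)"
      using \<open>P X c\<close> 1(3) by blast
    moreover obtain z' where "f' (pr c z') = 0 \<and> (\<forall>p\<in>set (ld (q' (pr c z'))). X p)"
      using \<open>Q X c\<close> 2(3) by blast
    ultimately show ?r by (intro exI[of _ "pr z z'"]) (auto simp: ld_revapp)
  next
    assume ?r
    then show ?l unfolding 1(3) 2(3) by (auto simp: ld_revapp)
  qed
  ultimately show ?thesis by (rule enum_opI)
qed

lemma enum_op_disj:
  assumes "enum_op P" "enum_op Q" shows "enum_op (\<lambda>X c. P X c \<or> Q X c)"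
proof -
  obtain f q where 1: "computable1 f" "computable1 q"
    "\<And>X c. P X c \<longleftrightarrow> (\<exists>z. f (pr c z) = 0 \<and> (\<forall>p\<in>set (ld (q (pr c z))). X p))"
    using assms(1) unfolding enum_op_def by blast
  obtain f' q' where 2: "computable1 f'" "computable1 q'"
    "\<And>X c. Q X c \<longleftrightarrow> (\<exists>z. f' (pr c z) = 0 \<and> (\<forall>p\<in>set (ld (q' (pr c z))). X p))"
    using assms(2) unfolding enum_op_def by blast
  let ?a = "\<lambda>w. pr (p1 w) (p2 (p2 w))"
  let ?f = "\<lambda>w. if p1 (p2 w) = 0 then f (?a w) else f' (?a w)"
  let ?q = "\<lambda>w. if p1 (p2 w) = 0 then q (?a w) else q' (?a w)"
  have "computable1 ?f" "computable1 ?q"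
    by (intro c_if c_comp[OF 1(1)] c_comp[OF 1(2)] c_comp[OF 2(1)] c_comp[OF 2(2)] c_intros)+
  moreover have "P X c \<or> Q X c \<longleftrightarrow> (\<exists>z. ?f (pr c z) = 0 \<and> (\<forall>p\<in>set (ld (?q (pr c z))). X p))"
    (is "?l \<longleftrightarrow> ?r") for X c
  proof
    assume ?l
    then show ?r
    proof
      assume "P X c"
      then obtain z where "f (pr c z) = 0 \<and> (\<forall>p\<in>set (ld (q (pr c z))). X p)" using 1(3) by blast
      then show ?r by (intro exI[of _ "pr 0 z"]) auto
    next
      assume "Q X c"
      then obtain z where "f' (pr c z) = 0 \<and> (\<forall>p\<in>set (ld (q' (pr c z))). X p)" using 2(3) by blast
      then show ?r by (intro exI[of _ "pr 1 z"]) auto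
    qed
  next
    assume ?r
    then show ?l unfolding 1(3) 2(3) by (auto split: if_splits)
  qed
  ultimately show ?thesis by (rule enum_opI)
qed

lemma enum_op_ex:
  assumes "enum_op (\<lambda>X p. Q X (p1 p) (p2 p))" shows "enum_op (\<lambda>X c. \<exists>w. Q X c w)"
proof -
  obtain f q where 1: "computable1 f" "computable1 q"
    "\<And>X c. Q X (p1 c) (p2 c) \<longleftrightarrow> (\<exists>z. f (pr c z) = 0 \<and> (\<forall>p\<in>set (ld (q (pr c z))). X p))"
    using assms(1) unfolding enum_op_def by blast
  let ?a = "\<lambda>w. pr (pr (p1 w) (p1 (p2 w))) (p2 (p2 w))"
  have "computable1 (\<lambda>w. f (?a w))" "computable1 (\<lambda>w. q (?a w))"
    by (intro c_comp[OF 1(1)] c_comp[OF 1(2)] c_intros)+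
  moreover have "(\<exists>w. Q X c w) \<longleftrightarrow>
      (\<exists>z. f (?a (pr c z)) = 0 \<and> (\<forall>p\<in>set (ld (q (?a (pr c z)))). X p))" (is "?l \<longleftrightarrow> ?r") for X c
  proof
    assume ?l
    then obtain w z where "f (pr (pr c w) z) = 0 \<and> (\<forall>p\<in>set (ld (q (pr (pr c w) z))). X p)"
      using 1(3)[of X "pr c _"] by auto
    then show ?r by (intro exI[of _ "pr w z"]) auto
  next
    assume ?r
    then obtain z where "Q X (p1 (pr c (p1 z))) (p2 (pr c (p1 z)))" unfolding 1(3) by auto
    then show ?l by auto
  qed
  ultimately show ?thesis by (rule enum_opI)
qed

text \<open>A bounded universal quantifier stays finitary: the guess is a list with one guess per
  \<open>i\<close>, the tests are summed and the queries collected by primitive recursion up to the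
  bound.\<close>

lemma enum_op_all_less:
  assumes "computable1 n" "enum_op (\<lambda>X p. Q X (p1 p) (p2 p))"
  shows "enum_op (\<lambda>X c. \<forall>i. i < n c \<longrightarrow> Q X c i)"
proof -
  obtain f q where 1: "computable1 f" "computable1 q"
    "\<And>X c. Q X (p1 c) (p2 c) \<longleftrightarrow> (\<exists>z. f (pr c z) = 0 \<and> (\<forall>p\<in>set (ld (q (pr c z))). X p))"
    using assms(2) unfolding enum_op_def by blast
  let ?a = "\<lambda>i w. pr (pr (p1 w) i) (nthc (p2 w) i)"
  define F where "F = (\<lambda>w. rec_nat 0 (\<lambda>i r. r + f (?a i w)) (n (p1 w)))"
  define R where "R = (\<lambda>w. rec_nat 0 (\<lambda>i r. revapp (q (?a i w)) r) (n (p1 w)))"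
  have "computable1 F" unfolding F_def
    by (intro c_rec c_add c_comp[OF 1(1)] c_comp[OF assms(1)] c_intros)
  moreover have "computable1 R" unfolding R_def
    by (intro c_rec c_revapp c_comp[OF 1(2)] c_comp[OF assms(1)] c_intros)
  moreover have F: "F w = 0 \<longleftrightarrow> (\<forall>i<n (p1 w). f (?a i w) = 0)" for w
  proof -
    have "rec_nat 0 (\<lambda>i r. r + f (?a i w)) m = 0 \<longleftrightarrow> (\<forall>i<m. f (?a i w) = 0)" for m
      by (induction m) (auto simp: less_Suc_eq)
    then show ?thesis by (simp add: F_def)
  qed
  have R: "set (ld (R w)) = (\<Union>i<n (p1 w). set (ld (q (?a i w))))" for w
  proof -
    have "set (ld (rec_nat 0 (\<lambda>i r. revapp (q (?a i w)) r) m)) = (\<Union>i<m. set (ld (q (?a i w))))" for m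
      by (induction m) (auto simp: less_Suc_eq ld_revapp)
    then show ?thesis by (simp add: R_def)
  qed
  have "(\<forall>i. i < n c \<longrightarrow> Q X c i) \<longleftrightarrow> (\<exists>z. F (pr c z) = 0 \<and> (\<forall>p\<in>set (ld (R (pr c z))). X p))"
    (is "?l \<longleftrightarrow> ?r") for X c
  proof
    assume ?l
    then have "\<forall>i. \<exists>z. i < n c \<longrightarrow> f (pr (pr c i) z) = 0 \<and> (\<forall>p\<in>set (ld (q (pr (pr c i) z))). X p)"
      using 1(3)[of X "pr c _"] by auto
    then obtain z where "\<And>i. i < n c \<Longrightarrow> f (pr (pr c i) (z i)) = 0 \<and>
        (\<forall>p\<in>set (ld (q (pr (pr c i) (z i)))). X p)" by metis
    then show ?r by (intro exI[of _ "le (map z [0..<n c])"]) (auto simp: F R)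
  next
    assume ?r
    then obtain z where z: "F (pr c z) = 0" "\<forall>p\<in>set (ld (R (pr c z))). X p" by blast
    show ?l
    proof (intro allI impI)
      fix i assume i: "i < n c"
      have "Q X (p1 (pr c i)) (p2 (pr c i))" unfolding 1(3)
        using z i by (intro exI[of _ "nthc z i"]) (auto simp: F R)
      then show "Q X c i" by simp
    qed
  qed
  ultimately show ?thesis by (rule enum_opI)
qed

lemma set_ld_nthc: "x \<in> set (ld l) \<longleftrightarrow> (\<exists>i. i < length (ld l) \<and> nthc l i = x)"
  by (auto simp: in_set_conv_nth nthc_nth)

lemma enum_op_mem:
  assumes "computable1 f" "computable1 l" shows "enum_op (\<lambda>X c. f c \<in> set (ld (l c)))"
  unfolding set_ld_nthc
  by (intro enum_op_ex enum_op_conj enum_op_less enum_op_eq c_nthc c_length c_p1 c_p2 c_id c_comp[OF assms(1)]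
      c_comp[OF assms(2)])

lemma enum_op_ball:
  assumes "computable1 l" "enum_op (\<lambda>X p. Q X (p1 p) (p2 p))"
  shows "enum_op (\<lambda>X c. \<forall>x\<in>set (ld (l c)). Q X c x)"
proof -
  have "(\<forall>x\<in>set (ld (l c)). Q X c x) \<longleftrightarrow>
      (\<forall>i. i < length (ld (l c)) \<longrightarrow> Q X c (nthc (l c) i))" for X c
    using set_ld_nthc[of _ "l c"] by metis
  moreover have "enum_op (\<lambda>X c. \<forall>i. i < length (ld (l c)) \<longrightarrow> Q X c (nthc (l c) i))"
  proof (rule enum_op_all_less)
    have "enum_op (\<lambda>X c. (\<lambda>X p. Q X (p1 p) (p2 p)) X (pr (p1 c) (nthc (l (p1 c)) (p2 c))))"
      by (rule enum_op_comp[OF assms(2)]) (intro c_intros c_comp[OF assms(1)])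
    then show "enum_op (\<lambda>X p. Q X (p1 p) (nthc (l (p1 p)) (p2 p)))" by simp
  qed (intro c_length assms(1))
  ultimately show ?thesis by simp
qed

text \<open>Applied by \<open>intro\<close>, these rules follow the syntax of a formula, turning
  bound variables into projections of one packed argument. The inductive predicates on codes are
  thus seen to be enumerable without writing programs.\<close>

lemmas enum_op_intros = enum_op_eq enum_op_less enum_op_conj enum_op_disj enum_op_ex enum_op_all_less enum_op_mem enum_op_ball

text \<open>The least fixed point is semi-decided by reducing a stack of open goals to the empty stack.\<close>

lemma re_lfp:
  assumes "enum_op Q" shows "re (lfp Q)"
proof -
  obtain f q where 1: "computable1 f" "computable1 q"
    "\<And>X c. Q X c \<longleftrightarrow> (\<exists>z. f (pr c z) = 0 \<and> (\<forall>p\<in>set (ld (q (pr c z))). X p))"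
    using assms unfolding enum_op_def by blast
  have mono: "mono Q"
  proof (intro monoI le_funI le_boolI)
    fix X Y :: "nat \<Rightarrow> bool" and c assume "X \<le> Y" "Q X c"
    then show "Q Y c" unfolding 1(3) by (meson le_funE le_boolE)
  qed
  have fix1: "Q (lfp Q) c \<Longrightarrow> lfp Q c" for c
    using lfp_unfold[OF mono] by metis
  \<comment> \<open>A state is a stack of open goals paired with a stream of guesses. A correct
    guess for the top goal replaces that goal by its queries; a wrong one is merely
    consumed.\<close>
  define step where "step = (\<lambda>s. if p1 s = 0 then s else
     if f (pr (hdc (p1 s)) (p1 (p2 s))) = 0
     then pr (revapp (q (pr (hdc (p1 s)) (p1 (p2 s)))) (tlc (p1 s))) (p2 (p2 s))
     else pr (p1 s) (p2 (p2 s)))"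
  define run where "run = (\<lambda>p. p1 (rec_nat (pr (cns (p1 p) 0) (p2 (p2 p))) (\<lambda>_ s. step s) (p1 (p2 p))))"
  have "computable1 step" unfolding step_def
    by (intro c_if c_revapp c_comp[OF 1(1)] c_comp[OF 1(2)] c_intros)
  then have run: "computable1 run" unfolding run_def
    by (intro c_p1 c_rec c_intros) (rule c_comp, assumption, intro c_intros)
  have pow: "rec_nat s (\<lambda>_ s. step s) n = (step ^^ n) s" for n s
    by (induction n) auto
  have sound: "\<forall>g\<in>set (ld (p1 s)). lfp Q g" if "p1 ((step ^^ n) s) = 0" for n s
    using that
  proof (induction n arbitrary: s)
    case (Suc n)
    then have IH: "\<forall>g\<in>set (ld (p1 (step s))). lfp Q g" by (simp only: funpow_Suc_right comp_apply)
    show ?case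
    proof (cases "p1 s" rule: code_list_cases)
      case (2 g G)
      show ?thesis
      proof (cases "f (pr g (p1 (p2 s))) = 0")
        case True
        with IH 2 have *: "\<forall>p\<in>set (ld (q (pr g (p1 (p2 s))))). lfp Q p" "\<forall>p\<in>set (ld G). lfp Q p"
          by (auto simp: step_def ld_revapp)
        then have "Q (lfp Q) g" using True 1(3) by blast
        with * fix1 2 show ?thesis by auto
      next
        case False
        then show ?thesis using IH 2 by (simp add: step_def)
      qed
    qed simp
  qed simp
  define solv where "solv gs \<longleftrightarrow> (\<exists>n w. p1 ((step ^^ n) (pr (le gs) w)) = 0)" for gs
  \<comment> \<open>Induction over the least fixed point. The quantifier over the rest
    \<open>gs\<close> of the stack is essential, because the queries of \<open>g\<close> are pushed
    one after another onto a nonempty stack.\<close>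
  have "Q (\<lambda>g. \<forall>gs. solv gs \<longrightarrow> solv (g # gs)) \<le> (\<lambda>g. \<forall>gs. solv gs \<longrightarrow> solv (g # gs))"
  proof (intro le_funI le_boolI allI impI)
    fix g gs assume "Q (\<lambda>g. \<forall>gs. solv gs \<longrightarrow> solv (g # gs)) g" "solv gs"
    then obtain z where z: "f (pr g z) = 0"
      "\<And>p gs. p \<in> set (ld (q (pr g z))) \<Longrightarrow> solv gs \<Longrightarrow> solv (p # gs)" unfolding 1(3) by blast
    have "solv (ps @ gs)" if "set ps \<subseteq> set (ld (q (pr g z)))" for ps
      using that by (induction ps) (auto intro: z(2) \<open>solv gs\<close>)
    then have "solv (rev (ld (q (pr g z))) @ gs)" by simp
    then obtain n w where "p1 ((step ^^ n) (pr (le (rev (ld (q (pr g z))) @ gs)) w)) = 0"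
      unfolding solv_def by blast
    moreover have "le (rev (ld (q (pr g z))) @ gs) = revapp (q (pr g z)) (le gs)"
      by (metis ld_revapp list_decode_inverse list_encode_inverse)
    ultimately have "p1 ((step ^^ Suc n) (pr (le (g # gs)) (pr z w))) = 0"
      by (simp del: funpow.simps add: funpow_Suc_right step_def z(1))
    then show "solv (g # gs)" unfolding solv_def by blast
  qed
  then have "lfp Q g \<Longrightarrow> solv gs \<Longrightarrow> solv (g # gs)" for g gs
    by (drule_tac lfp_lowerbound) (auto simp: le_fun_def)
  moreover have "solv []" unfolding solv_def by (intro exI[of _ 0]) auto
  ultimately have complete: "lfp Q c \<Longrightarrow> solv [c]" for c by blast
  have "lfp Q c \<longleftrightarrow> (\<exists>z. run (pr c z) = 0)" for c
  proof
    assume "lfp Q c"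
    then obtain n w where "p1 ((step ^^ n) (pr (cns c 0) w)) = 0"
      using complete[of c] unfolding solv_def by auto
    then show "\<exists>z. run (pr c z) = 0" by (intro exI[of _ "pr n w"]) (simp add: run_def pow)
  next
    assume "\<exists>z. run (pr c z) = 0"
    then obtain z where "p1 ((step ^^ p1 z) (pr (cns c 0) (p2 z))) = 0" by (auto simp: run_def pow)
    from sound[OF this] show "lfp Q c" by simp
  qed
  with run show ?thesis unfolding re_def by blast
qed

text \<open>\<open>C\<close> occurs negatively, so its witness joins the universal variable, which
  is read as a pair. The witnesses of \<open>W\<close> and \<open>D\<close> are paired in the
  existential variable.\<close>

lemma Pi2I:
  assumes "re W" "re C" "re D"
  shows "Pi2 {x. W x \<and> (\<forall>y. C (pr x y) \<longrightarrow> D (pr x y))}"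
proof -
  obtain w where w: "computable1 w" "\<And>c. W c \<longleftrightarrow> (\<exists>z. w (pr c z) = 0)"
    using assms(1) unfolding re_def by blast
  obtain c where c: "computable1 c" "\<And>x. C x \<longleftrightarrow> (\<exists>z. c (pr x z) = 0)"
    using assms(2) unfolding re_def by blast
  obtain d where d: "computable1 d" "\<And>x. D x \<longleftrightarrow> (\<exists>z. d (pr x z) = 0)"
    using assms(3) unfolding re_def by blast
  define h where "h p = w (pr (p1 p) (p1 (p2 (p2 p)))) +
     (if c (pr (pr (p1 p) (p1 (p1 (p2 p)))) (p2 (p1 (p2 p)))) = 0
      then d (pr (pr (p1 p) (p1 (p1 (p2 p)))) (p2 (p2 (p2 p)))) else 0)" for p
  have "computable1 h" unfolding h_def
    by (intro c_add c_if c_comp[OF w(1)] c_comp[OF c(1)] c_comp[OF d(1)] c_intros)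
  then have dec: "decidable3 (\<lambda>x y z. h (pr x (pr y z)) = 0)" by (rule decidable3I)
  have "W x \<and> (\<forall>y. C (pr x y) \<longrightarrow> D (pr x y)) \<longleftrightarrow> (\<forall>y. \<exists>z. h (pr x (pr y z)) = 0)" (is "?l \<longleftrightarrow> ?r") for x
  proof
    assume l: ?l
    then obtain z1 where z1: "w (pr x z1) = 0" using w(2) by blast
    show ?r
    proof
      fix y
      show "\<exists>z. h (pr x (pr y z)) = 0"
      proof (cases "c (pr (pr x (p1 y)) (p2 y)) = 0")
        case True
        then obtain z2 where "d (pr (pr x (p1 y)) z2) = 0" using l c(2) d(2) by blast
        with z1 show ?thesis by (intro exI[of _ "pr z1 z2"]) (simp add: h_def)
      next
        case False
        with z1 show ?thesis by (intro exI[of _ "pr z1 0"]) (simp add: h_def)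
      qed
    qed
  next
    assume r: ?r
    then have "W x" unfolding w(2) by (auto simp: h_def)
    moreover have "D (pr x y)" if C: "C (pr x y)" for y
    proof -
      obtain z where "c (pr (pr x y) z) = 0" using C c(2) by blast
      then show ?thesis using r[rule_format, of "pr y z"] unfolding d(2) by (auto simp: h_def)
    qed
    ultimately show ?l by blast
  qed
  with dec show ?thesis unfolding Pi2_def
    by (intro exI[of _ "\<lambda>x y z. h (pr x (pr y z)) = 0"]) simp
qed

section \<open>Trees, classes and handlers\<close>

lemma inT_Prod: "inT e (Prod a b) \<longleftrightarrow> (\<exists>x y. e = EPair x y \<and> inT x a \<and> inT y b)"
  by (auto elim: inT.cases intro: inT.intros)
lemma inT_Sum: "inT e (Sum as) \<longleftrightarrow> (\<exists>l x. e = EInj l x \<and> l < length as \<and> inT x (as ! l))"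
  by (auto elim: inT.cases intro: inT.intros)
lemma inT_One: "inT e One \<longleftrightarrow> e = EUnit"
  by (auto elim: inT.cases intro: inT.intros)

lemma inT_evalV: "typeV \<Gamma> v t \<Longrightarrow> list_all2 inT env \<Gamma> \<Longrightarrow> inT (evalV env v) t"
  by (induction rule: typeV.induct) (auto intro: inT.intros simp: list_all2_conv_all_nth)

text \<open>The fundamental lemma of logical relations for templates. Suitable choices of
  \<open>R\<close> give preservation of well-formedness and the passage between trees and their
  classes.\<close>

lemma evalT_rel:
  assumes "wfT sig \<Gamma> Z T" "list_all2 inT env \<Gamma>"
    and ops: "\<And>i a \<kappa> \<kappa>'. i < length sig \<Longrightarrow> inT a (fst (sig ! i)) \<Longrightarrow>
      (\<And>x. inT x (snd (sig ! i)) \<Longrightarrow> R (\<kappa> x) (\<kappa>' x)) \<Longrightarrow> R (ops i a \<kappa>) (ops' i a \<kappa>')"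
    and b: "\<And>j x. j < length Z \<Longrightarrow> inT x (Z ! j) \<Longrightarrow> R (b j x) (b' j x)"
  shows "R (evalT ops env b T) (evalT ops' env b' T)"
  using assms(1,2) ops b
proof (induction arbitrary: env rule: wfT.induct)
  case (1 j Z \<Gamma> v sig)
  show ?case unfolding evalT.simps
    by (rule 1(5)) (use 1 in \<open>auto intro: inT_evalV\<close>)
next
  case (2 \<Gamma> v a b sig Z T)
  then obtain x y where "evalV env v = EPair x y" "inT x a" "inT y b"
    using inT_evalV inT_Prod by blast
  with 2 show ?case by simp
next
  case (3 \<Gamma> v as Ts sig Z)
  then obtain l x where "evalV env v = EInj l x" "l < length as" "inT x (as ! l)"
    using inT_evalV inT_Sum by blast
  with 3 show ?case by simp
next
  case (4 i sig \<Gamma> v Z T)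
  show ?case unfolding evalT.simps
    by (rule 4(6)) (use 4 in \<open>auto intro: inT_evalV\<close>)
qed

lemma wft_evalT:
  assumes "wfT sig \<Gamma> Z T" "list_all2 inT env \<Gamma>"
    "\<And>j x. j < length Z \<Longrightarrow> inT x (Z ! j) \<Longrightarrow> wft sig (b j x)"
  shows "wft sig (evalT Node env b T)"
  by (rule evalT_rel[where R = "\<lambda>s _. wft sig s" and ops' = Node, OF assms(1,2)])
    (auto intro: wft.intros assms(3))

lemma teq_wft:
  assumes "wf_theory sig eqs" "teq sig eqs s t" shows "wft sig s" "wft sig t"
proof -
  have "wft sig s \<and> wft sig t" using assms(2)
  proof induction
    case (teq_cong i a k k')
    then show ?case by (auto intro: wft.intros)
  next
    case (teq_ax \<Gamma> Z T1 T2 env b)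
    then show ?case using assms(1) by (fastforce simp: wf_theory_def intro: wft_evalT)
  qed auto
  then show "wft sig s" "wft sig t" by auto
qed

text \<open>The handler acting on representatives instead of classes, which removes
  \<open>SOME\<close> from all later arguments.\<close>

definition hops :: "tmpl list \<Rightarrow> nat \<Rightarrow> elem \<Rightarrow> (elem \<Rightarrow> tree) \<Rightarrow> tree" where
  "hops H i a \<kappa> = evalT Node [a] (\<lambda>_. \<kappa>) (H ! i)"

lemma wfT_handler:
  "wf_handler sig H \<Longrightarrow> i < length sig \<Longrightarrow> wfT sig [fst (sig ! i)] [snd (sig ! i)] (H ! i)"
  by (simp add: wf_handler_def)

lemma wft_hops:
  assumes "wf_handler sig H" "i < length sig" "inT a (fst (sig ! i))"
    "\<And>x. inT x (snd (sig ! i)) \<Longrightarrow> wft sig (k x)"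
  shows "wft sig (hops H i a k)"
  unfolding hops_def by (rule wft_evalT[OF wfT_handler[OF assms(1,2)]]) (use assms in auto)

definition cls :: "signature \<Rightarrow> equation list \<Rightarrow> tree \<Rightarrow> tree set" where
  "cls sig eqs t = {s. teq sig eqs t s}"

lemma cls_eq: "wft sig s \<Longrightarrow> cls sig eqs s = cls sig eqs t \<longleftrightarrow> teq sig eqs s t"
  unfolding cls_def set_eq_iff mem_Collect_eq by (meson teq_refl teq_sym teq_trans)

text \<open>Whatever \<open>SOME\<close> picks from a class is provably equal to the given
  representative. At ill-typed arguments \<open>SOME\<close> may return anything, but
  \<open>teq_cong\<close> looks at well-typed arguments only.\<close>

lemma free_ops_cls:
  assumes "i < length sig" "inT a (fst (sig ! i))"
    "\<And>x. inT x (snd (sig ! i)) \<Longrightarrow> wft sig (k x) \<and> \<kappa> x = cls sig eqs (k x)"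
  shows "free_ops sig eqs i a \<kappa> = cls sig eqs (Node i a k)"
proof -
  have "teq sig eqs (k x) (SOME t. t \<in> \<kappa> x)" if "inT x (snd (sig ! i))" for x
  proof -
    have "k x \<in> \<kappa> x" using assms(3)[OF that] by (simp add: cls_def teq_refl)
    then have "(SOME t. t \<in> \<kappa> x) \<in> \<kappa> x" by (rule someI)
    then show ?thesis using assms(3)[OF that] by (simp add: cls_def)
  qed
  then have "teq sig eqs (Node i a k) (Node i a (\<lambda>x. SOME t. t \<in> \<kappa> x))"
    using assms(1,2) by (blast intro: teq_cong)
  then show ?thesis unfolding free_ops_def cls_def by (blast intro: teq_trans teq_sym)
qed

lemma evalT_free_ops:
  assumes "wfT sig \<Gamma> Z T" "list_all2 inT env \<Gamma>"
    "\<And>j x. j < length Z \<Longrightarrow> inT x (Z ! j) \<Longrightarrow> wft sig (b j x) \<and> B j x = cls sig eqs (b j x)"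
  shows "evalT (free_ops sig eqs) env B T = cls sig eqs (evalT Node env b T)"
proof -
  let ?R = "\<lambda>t X. wft sig t \<and> X = cls sig eqs t"
  have "?R (evalT Node env b T) (evalT (free_ops sig eqs) env B T)"
    by (rule evalT_rel[where R = ?R, OF assms(1,2)])
      (intro conjI wft.intros free_ops_cls, auto simp: assms(3))
  then show ?thesis by simp
qed

lemma handler_ops_cls:
  assumes "wf_handler sig H" "i < length sig" "inT a (fst (sig ! i))"
    "\<And>x. inT x (snd (sig ! i)) \<Longrightarrow> wft sig (k x) \<and> \<kappa> x = cls sig eqs (k x)"
  shows "handler_ops sig eqs H i a \<kappa> = cls sig eqs (hops H i a k)"
  unfolding handler_ops_def hops_def
  by (rule evalT_free_ops[OF wfT_handler[OF assms(1,2)]]) (use assms in auto)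

lemma evalT_handler_ops:
  assumes "wf_handler sig H" "wfT sig \<Gamma> Z T" "list_all2 inT env \<Gamma>"
    "\<And>j x. j < length Z \<Longrightarrow> inT x (Z ! j) \<Longrightarrow> wft sig (b j x) \<and> B j x = cls sig eqs (b j x)"
  shows "wft sig (evalT (hops H) env b T) \<and>
    evalT (handler_ops sig eqs H) env B T = cls sig eqs (evalT (hops H) env b T)"
  by (rule evalT_rel[where R = "\<lambda>t X. wft sig t \<and> X = cls sig eqs t", OF assms(2,3)])
    (intro conjI wft_hops handler_ops_cls assms(1), auto simp: assms(4))

lemma free_carrier_cls: "free_carrier sig eqs = {cls sig eqs t | t. wft sig t}"
  by (simp add: free_carrier_def cls_def)

text \<open>The closure clause of \<open>is_model\<close> holds for every well-formed handler, so
  only the equations remain. An assignment of classes is lifted to trees by choosing representatives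
  at the well-typed arguments.\<close>

lemma handler_correct_iff:
  assumes thy: "wf_theory sig eqs" and H: "wf_handler sig H"
  shows "handler_correct sig eqs H \<longleftrightarrow> (\<forall>(\<Gamma>, Z, T1, T2) \<in> set eqs. \<forall>env b.
    list_all2 inT env \<Gamma> \<longrightarrow> (\<forall>j<length Z. \<forall>x. inT x (Z ! j) \<longrightarrow> wft sig (b j x)) \<longrightarrow>
    teq sig eqs (evalT (hops H) env b T1) (evalT (hops H) env b T2))" (is "_ \<longleftrightarrow> ?r")
proof -
  have closed: "handler_ops sig eqs H i a \<kappa> \<in> free_carrier sig eqs"
    if i: "i < length sig" "inT a (fst (sig ! i))"
      and \<kappa>: "\<forall>x. inT x (snd (sig ! i)) \<longrightarrow> \<kappa> x \<in> free_carrier sig eqs" for i a \<kappa>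
  proof -
    have "\<forall>x. \<exists>t. inT x (snd (sig ! i)) \<longrightarrow> wft sig t \<and> \<kappa> x = cls sig eqs t"
      using \<kappa> unfolding free_carrier_cls by blast
    then obtain k where k: "\<And>x. inT x (snd (sig ! i)) \<Longrightarrow> wft sig (k x) \<and> \<kappa> x = cls sig eqs (k x)"
      by metis
    then have "handler_ops sig eqs H i a \<kappa> = cls sig eqs (hops H i a k)"
      by (intro handler_ops_cls[OF H i])
    moreover have "wft sig (hops H i a k)" using k by (intro wft_hops[OF H i]) auto
    ultimately show ?thesis unfolding free_carrier_cls by blast
  qed
  have wf: "wfT sig \<Gamma> Z T1" "wfT sig \<Gamma> Z T2" if "(\<Gamma>, Z, T1, T2) \<in> set eqs" for \<Gamma> Z T1 T2
    using that thy by (auto simp: wf_theory_def)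
  have "(\<forall>env B. list_all2 inT env \<Gamma> \<longrightarrow>
      (\<forall>j<length Z. \<forall>x. inT x (Z ! j) \<longrightarrow> B j x \<in> free_carrier sig eqs) \<longrightarrow>
      evalT (handler_ops sig eqs H) env B T1 = evalT (handler_ops sig eqs H) env B T2) \<longleftrightarrow>
    (\<forall>env b. list_all2 inT env \<Gamma> \<longrightarrow> (\<forall>j<length Z. \<forall>x. inT x (Z ! j) \<longrightarrow> wft sig (b j x)) \<longrightarrow>
      teq sig eqs (evalT (hops H) env b T1) (evalT (hops H) env b T2))" (is "?A \<longleftrightarrow> ?B")
    if e: "(\<Gamma>, Z, T1, T2) \<in> set eqs" for \<Gamma> Z T1 T2
  proof (intro iffI allI impI)
    fix env b
    assume A: ?A and env: "list_all2 inT env \<Gamma>"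
      and b: "\<forall>j<length Z. \<forall>x. inT x (Z ! j) \<longrightarrow> wft sig (b j x)"
    let ?B = "\<lambda>j x. cls sig eqs (b j x)"
    have "evalT (handler_ops sig eqs H) env ?B T1 = evalT (handler_ops sig eqs H) env ?B T2"
      by (rule A[rule_format, OF env]) (use b in \<open>auto simp: free_carrier_cls\<close>)
    then show "teq sig eqs (evalT (hops H) env b T1) (evalT (hops H) env b T2)"
      using evalT_handler_ops[OF H wf(1)[OF e] env, of b ?B]
        evalT_handler_ops[OF H wf(2)[OF e] env, of b ?B] b by (simp add: cls_eq)
  next
    fix env B
    assume A: ?B and env: "list_all2 inT env \<Gamma>"
      and B: "\<forall>j<length Z. \<forall>x. inT x (Z ! j) \<longrightarrow> B j x \<in> free_carrier sig eqs"
    have "\<forall>j x. \<exists>t. j < length Z \<longrightarrow> inT x (Z ! j) \<longrightarrow> wft sig t \<and> B j x = cls sig eqs t"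
      using B unfolding free_carrier_cls by blast
    then obtain b where b: "\<And>j x. j < length Z \<Longrightarrow> inT x (Z ! j) \<Longrightarrow>
        wft sig (b j x) \<and> B j x = cls sig eqs (b j x)" by metis
    then have "teq sig eqs (evalT (hops H) env b T1) (evalT (hops H) env b T2)"
      using A[rule_format, OF env, of b] by simp
    then show "evalT (handler_ops sig eqs H) env B T1 = evalT (handler_ops sig eqs H) env B T2"
      using evalT_handler_ops[OF H wf(1)[OF e] env, of b B]
        evalT_handler_ops[OF H wf(2)[OF e] env, of b B] b by (simp add: cls_eq)
  qed
  then have "(case e of (\<Gamma>, Z, T1, T2) \<Rightarrow> \<forall>env B. list_all2 inT env \<Gamma> \<longrightarrow>
      (\<forall>j<length Z. \<forall>x. inT x (Z ! j) \<longrightarrow> B j x \<in> free_carrier sig eqs) \<longrightarrow>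
      evalT (handler_ops sig eqs H) env B T1 = evalT (handler_ops sig eqs H) env B T2) \<longleftrightarrow>
    (case e of (\<Gamma>, Z, T1, T2) \<Rightarrow> \<forall>env b. list_all2 inT env \<Gamma> \<longrightarrow>
      (\<forall>j<length Z. \<forall>x. inT x (Z ! j) \<longrightarrow> wft sig (b j x)) \<longrightarrow>
      teq sig eqs (evalT (hops H) env b T1) (evalT (hops H) env b T2))"
    if "e \<in> set eqs" for e using that by (cases e) (simp only: prod.case)
  from ball_cong[OF refl this] show ?thesis
    unfolding handler_correct_def is_model_def using closed by simp
qed

section \<open>Correctness of handlers is in Pi2\<close>

declare list_encode_eq [simp]

text \<open>Tags 1 in codes have to keep their shape for unification with the rules below.\<close>

declare One_nat_def [simp del]

section \<open>Codes of elements and enumeration of the finite types\<close>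

primrec ce :: "elem \<Rightarrow> nat" where
  "ce EUnit = pr 0 0"
| "ce (EPair x y) = pr 1 (pr (ce x) (ce y))"
| "ce (EInj l x) = pr 2 (pr l (ce x))"

lemma ce_inj [simp]: "ce x = ce y \<longleftrightarrow> x = y"
proof (induction x arbitrary: y)
  case EUnit
  show ?case by (cases y) auto
next
  case (EPair x1 x2)
  then show ?case by (cases y) auto
next
  case (EInj l x)
  then show ?case by (cases y) auto
qed

lemma enc_ty_inj [simp]: "enc_ty a = enc_ty b \<longleftrightarrow> a = b"
proof (induction a arbitrary: b)
  case One
  show ?case by (cases b) auto
next
  case (Prod a1 a2)
  then show ?case by (cases b) auto
next
  case (Sum as)
  show ?case
  proof (cases b)
    case (Sum bs)
    have "map enc_ty as = map enc_ty bs \<longleftrightarrow> as = bs"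
      using Sum.IH by (auto simp: list_eq_iff_nth_eq)
    then show ?thesis using Sum by simp
  qed auto
qed

abbreviation tys :: "ty list \<Rightarrow> nat" where "tys \<Gamma> \<equiv> le (map enc_ty \<Gamma>)"
abbreviation elems :: "elem list \<Rightarrow> nat" where "elems env \<equiv> le (map ce env)"

text \<open>Every number codes a list, so once each entry has been decoded separately, a choice
  function decodes the whole list.\<close>

lemma code_eq_map:
  assumes "\<And>i. i < length (ld l) \<Longrightarrow> nthc l i = f (g i)"
  shows "l = le (map f (map g [0..<length (ld l)]))"
proof -
  have "ld l = map f (map g [0..<length (ld l)])"
  proof (rule nth_equalityI)
    fix i assume i: "i < length (ld l)"
    then show "ld l ! i = map f (map g [0..<length (ld l)]) ! i"
      using assms[OF i] by (simp add: nthc_nth)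
  qed simp
  then show ?thesis by (metis list_decode_inverse)
qed

lemma finite_inT: "finite {x. inT x t}"
proof (induction t)
  case One
  show ?case by (simp add: inT_One)
next
  case (Prod a b)
  have "{x. inT x (Prod a b)} = (\<lambda>(x, y). EPair x y) ` ({x. inT x a} \<times> {x. inT x b})"
    by (auto simp: inT_Prod)
  then show ?case using Prod by simp
next
  case (Sum as)
  have "{x. inT x (Sum as)} = (\<Union>l<length as. EInj l ` {x. inT x (as ! l)})"
    by (auto simp: inT_Sum)
  then show ?case using Sum by simp
qed

lemma enum_inT: "\<exists>xs. set (ld xs) = ce ` {x. inT x t}"
  by (metis finite_imageI finite_inT finite_list list_encode_inverse)

text \<open>Pairs of a type code and a list enumerating exactly the codes of the elements of the type.\<close>

context notes [[inductive_internals]] begin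
inductive ty_enum :: "nat \<Rightarrow> bool" where
  "ty_enum (pr (pr 0 0) (cns (pr 0 0) 0))"
| "ty_enum (pr a xa) \<Longrightarrow> ty_enum (pr b xb) \<Longrightarrow>
   \<forall>x\<in>set (ld xa). \<forall>y\<in>set (ld xb). pr 1 (pr x y) \<in> set (ld xs) \<Longrightarrow>
   \<forall>z\<in>set (ld xs). \<exists>x y. x \<in> set (ld xa) \<and> y \<in> set (ld xb) \<and> z = pr 1 (pr x y) \<Longrightarrow>
   ty_enum (pr (pr 1 (pr a b)) xs)"
| "\<forall>i<length (ld as). \<exists>ys. ty_enum (pr (nthc as i) ys) \<and>
     (\<forall>y\<in>set (ld ys). pr 2 (pr i y) \<in> set (ld xs)) \<Longrightarrow>
   \<forall>z\<in>set (ld xs). \<exists>i y ys. i < length (ld as) \<and> ty_enum (pr (nthc as i) ys) \<and>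
     y \<in> set (ld ys) \<and> z = pr 2 (pr i y) \<Longrightarrow>
   ty_enum (pr (pr 2 as) xs)"
end

text \<open>\<open>inductive_internals\<close> exposes the defining \<open>lfp\<close>, to which
  \<open>re_lfp\<close> applies; the closure rules then treat the body built from the introduction
  rules. All later predicates on codes follow this pattern.\<close>

lemma re_ty_enum: "re ty_enum"
  unfolding ty_enum_def by (rule re_lfp) (intro enum_op_intros enum_op_app c_intros)

text \<open>Derivability does double duty: besides supplying the list of elements, it certifies that
  the first component is the code of a type.\<close>

lemma ty_enum_sound: "ty_enum c \<Longrightarrow> \<exists>t xs. c = pr (enc_ty t) xs \<and> set (ld xs) = ce ` {x. inT x t}"
proof (induction rule: ty_enum.induct)
  case 1
  show ?case by (intro exI[of _ One] exI[of _ "cns (pr 0 0) 0"]) (simp add: inT_One)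
next
  case (2 a xa b xb xs)
  then obtain s t where s: "a = enc_ty s" "set (ld xa) = ce ` {x. inT x s}"
    and t: "b = enc_ty t" "set (ld xb) = ce ` {x. inT x t}" by auto
  have "set (ld xs) = ce ` {x. inT x (Prod s t)}"
  proof
    show "set (ld xs) \<subseteq> ce ` {x. inT x (Prod s t)}"
    proof
      fix z assume "z \<in> set (ld xs)"
      then obtain x y where "inT x s" "inT y t" "z = ce (EPair x y)" using 2 s t by fastforce
      then show "z \<in> ce ` {x. inT x (Prod s t)}" by (auto simp: inT_Prod intro!: image_eqI)
    qed
    show "ce ` {x. inT x (Prod s t)} \<subseteq> set (ld xs)" using 2 s t by (auto simp: inT_Prod)
  qed
  then show ?case using s t by (intro exI[of _ "Prod s t"] exI[of _ xs]) simp
next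
  case (3 as xs)
  have ex: "\<exists>t ys. nthc as i = enc_ty t \<and> set (ld ys) = ce ` {x. inT x t} \<and>
      (\<forall>y\<in>set (ld ys). pr 2 (pr i y) \<in> set (ld xs))" if "i < length (ld as)" for i
    using 3(1) that by fastforce
  then obtain t where t: "\<And>i. i < length (ld as) \<Longrightarrow> nthc as i = enc_ty (t i)" by metis
  define ts where "ts = map t [0..<length (ld as)]"
  have as: "as = tys ts" unfolding ts_def by (rule code_eq_map) (rule t)
  have "set (ld xs) = ce ` {x. inT x (Sum ts)}"
  proof
    show "set (ld xs) \<subseteq> ce ` {x. inT x (Sum ts)}"
    proof
      fix z assume "z \<in> set (ld xs)"
      then obtain i y ys u where "i < length ts" "enc_ty (ts ! i) = enc_ty u" "y \<in> set (ld ys)"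
        "set (ld ys) = ce ` {x. inT x u}" "z = pr 2 (pr i y)" using 3(2) by (fastforce simp: as)
      then obtain x where "i < length ts" "inT x (ts ! i)" "z = ce (EInj i x)" by auto
      then show "z \<in> ce ` {x. inT x (Sum ts)}" by (auto simp: inT_Sum intro!: image_eqI)
    qed
    show "ce ` {x. inT x (Sum ts)} \<subseteq> set (ld xs)"
    proof
      fix z assume "z \<in> ce ` {x. inT x (Sum ts)}"
      then obtain i x where "i < length ts" "inT x (ts ! i)" "z = pr 2 (pr i (ce x))"
        by (auto simp: inT_Sum)
      then show "z \<in> set (ld xs)" using ex[of i] by (auto simp: as)
    qed
  qed
  then show ?case by (intro exI[of _ "Sum ts"] exI[of _ xs]) (simp add: as)
qed

text \<open>Because the list is exact, quantification over all elements of a type becomes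
  quantification over a list, which an enumeration operator may use even universally.\<close>

lemma ty_enum_elems: "ty_enum (pr (enc_ty t) xs) \<Longrightarrow> set (ld xs) = ce ` {x. inT x t}"
  using ty_enum_sound by fastforce

lemma ty_enum_ex: "\<exists>xs. ty_enum (pr (enc_ty t) xs)"
proof (induction t)
  case One
  show ?case using ty_enum.intros(1) by (intro exI[of _ "cns (pr 0 0) 0"]) simp
next
  case (Prod a b)
  then obtain xa xb where ab: "ty_enum (pr (enc_ty a) xa)" "ty_enum (pr (enc_ty b) xb)" by blast
  obtain xs where "set (ld xs) = ce ` {x. inT x (Prod a b)}" using enum_inT by blast
  then have "ty_enum (pr (pr 1 (pr (enc_ty a) (enc_ty b))) xs)"
    by (intro ty_enum.intros(2)[OF ab])
      (auto simp: inT_Prod ty_enum_elems[OF ab(1)] ty_enum_elems[OF ab(2)] intro!: image_eqI[where f = ce])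
  then show ?case by auto
next
  case (Sum as)
  obtain xs where xs: "set (ld xs) = ce ` {x. inT x (Sum as)}" using enum_inT by blast
  have "\<exists>ys. ty_enum (pr (enc_ty (as ! i)) ys) \<and> set (ld ys) = ce ` {x. inT x (as ! i)}"
    if "i < length as" for i using Sum[of "as ! i"] that ty_enum_elems by auto
  then obtain ys where ys: "\<And>i. i < length as \<Longrightarrow> ty_enum (pr (enc_ty (as ! i)) (ys i)) \<and>
      set (ld (ys i)) = ce ` {x. inT x (as ! i)}" by metis
  have "ty_enum (pr (pr 2 (tys as)) xs)"
  proof (rule ty_enum.intros(3))
    show "\<forall>i<length (ld (tys as)). \<exists>ys. ty_enum (pr (nthc (tys as) i) ys) \<and>
        (\<forall>y\<in>set (ld ys). pr 2 (pr i y) \<in> set (ld xs))"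
    proof (intro allI impI)
      fix i assume i: "i < length (ld (tys as))"
      have "pr 2 (pr i y) \<in> set (ld xs)" if y: "y \<in> set (ld (ys i))" for y
      proof -
        obtain x where "y = ce x" "inT x (as ! i)" using y i ys by auto
        then have "pr 2 (pr i y) = ce (EInj i x)" "inT (EInj i x) (Sum as)"
          using i by (auto simp: inT_Sum)
        then show ?thesis unfolding xs by blast
      qed
      then show "\<exists>ys. ty_enum (pr (nthc (tys as) i) ys) \<and>
        (\<forall>y\<in>set (ld ys). pr 2 (pr i y) \<in> set (ld xs))"
        using ys[of i] i by (intro exI[of _ "ys i"]) auto
    qed
    show "\<forall>z\<in>set (ld xs). \<exists>i y ys. i < length (ld (tys as)) \<and> ty_enum (pr (nthc (tys as) i) ys) \<and>
        y \<in> set (ld ys) \<and> z = pr 2 (pr i y)"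
    proof
      fix z assume "z \<in> set (ld xs)"
      then obtain i x where "i < length as" "inT x (as ! i)" "z = pr 2 (pr i (ce x))"
        unfolding xs by (auto simp: inT_Sum)
      then show "\<exists>i y ys. i < length (ld (tys as)) \<and> ty_enum (pr (nthc (tys as) i) ys) \<and>
        y \<in> set (ld ys) \<and> z = pr 2 (pr i y)"
        using ys[of i] by (intro exI[of _ i] exI[of _ "ce x"] exI[of _ "ys i"]) auto
    qed
  qed
  then show ?case by auto
qed

section \<open>Typing and recognition of instances on codes\<close>

context notes [[inductive_internals]] begin
text \<open>In the rule for injections the typed value says something about one summand only; the
  premise on \<open>ty_enum\<close> certifies that all entries of \<open>as\<close> are codes of
  types.\<close>

inductive typeV_code :: "nat \<Rightarrow> bool" where
  "i < length (ld G) \<Longrightarrow> typeV_code (pr G (pr (pr 0 i) (nthc G i)))"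
| "typeV_code (pr G (pr (pr 1 0) (pr 0 0)))"
| "typeV_code (pr G (pr v a)) \<Longrightarrow> typeV_code (pr G (pr w b)) \<Longrightarrow> typeV_code (pr G (pr (pr 2 (pr v w)) (pr 1 (pr a b))))"
| "l < length (ld as) \<Longrightarrow> ty_enum (pr (pr 2 as) xs) \<Longrightarrow> typeV_code (pr G (pr v (nthc as l))) \<Longrightarrow>
   typeV_code (pr G (pr (pr 3 (pr l v)) (pr 2 as)))"
end

lemma re_typeV_code: "re typeV_code"
  unfolding typeV_code_def by (rule re_lfp) (intro enum_op_intros enum_op_app enum_op_re[OF re_ty_enum] c_intros)

lemma typeV_code_sound:
  "typeV_code c \<Longrightarrow> c = pr (tys \<Gamma>) (pr v t) \<Longrightarrow> \<exists>V \<tau>. v = enc_val V \<and> t = enc_ty \<tau> \<and> typeV \<Gamma> V \<tau>"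
proof (induction arbitrary: v t rule: typeV_code.induct)
  case (1 i G)
  then show ?case
    by (intro exI[of _ "VVar i"] exI[of _ "\<Gamma> ! i"]) (auto intro: typeV.intros)
next
  case (2 G)
  then show ?case by (intro exI[of _ VUnit] exI[of _ One]) (auto intro: typeV.intros)
next
  case (3 G v' a w b)
  then have "v = pr 2 (pr v' w)" "t = pr 1 (pr a b)" "G = tys \<Gamma>" by auto
  moreover obtain V \<tau> W \<sigma> where "v' = enc_val V" "a = enc_ty \<tau>" "typeV \<Gamma> V \<tau>"
    "w = enc_val W" "b = enc_ty \<sigma>" "typeV \<Gamma> W \<sigma>"
    using 3(3)[of v' a] 3(4)[of w b] calculation by auto
  ultimately show ?case
    by (intro exI[of _ "VPair V W"] exI[of _ "Prod \<tau> \<sigma>"]) (auto intro: typeV.intros)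
next
  case (4 l as xs G v')
  then have *: "v = pr 3 (pr l v')" "t = pr 2 as" "G = tys \<Gamma>" by auto
  obtain u where "pr 2 as = enc_ty u" using ty_enum_sound[OF 4(2)] by auto
  then obtain ts where ts: "as = tys ts" by (cases u) auto
  moreover obtain V \<tau> where "v' = enc_val V" "nthc as l = enc_ty \<tau>" "typeV \<Gamma> V \<tau>"
    using 4(4)[of v' "nthc as l"] * by auto
  ultimately show ?case using * 4(1)
    by (intro exI[of _ "VInj l V"] exI[of _ "Sum ts"]) (auto intro: typeV.intros)
qed

lemma typeV_code_complete: "typeV \<Gamma> V \<tau> \<Longrightarrow> typeV_code (pr (tys \<Gamma>) (pr (enc_val V) (enc_ty \<tau>)))"
proof (induction rule: typeV.induct)
  case (1 n \<Gamma>)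
  then show ?case using typeV_code.intros(1)[of n "tys \<Gamma>"] by simp
next
  case (4 l as \<Gamma> v)
  obtain xs where "ty_enum (pr (enc_ty (Sum as)) xs)" using ty_enum_ex by blast
  then show ?case using typeV_code.intros(4)[of l "tys as" xs "tys \<Gamma>" "enc_val v"] 4 by simp
qed (auto intro: typeV_code.intros)

context notes [[inductive_internals]] begin
inductive wfT_code :: "nat \<Rightarrow> bool" where
  "j < length (ld Z) \<Longrightarrow> typeV_code (pr G (pr v (nthc Z j))) \<Longrightarrow> wfT_code (pr S (pr G (pr Z (pr 0 (pr j v)))))"
| "typeV_code (pr G (pr v (pr 1 (pr a b)))) \<Longrightarrow> wfT_code (pr S (pr (cns a (cns b G)) (pr Z T))) \<Longrightarrow>
   wfT_code (pr S (pr G (pr Z (pr 1 (pr v T)))))"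
| "typeV_code (pr G (pr v (pr 2 as))) \<Longrightarrow> length (ld Ts) = length (ld as) \<Longrightarrow>
   \<forall>l<length (ld Ts). wfT_code (pr S (pr (cns (nthc as l) G) (pr Z (nthc Ts l)))) \<Longrightarrow>
   wfT_code (pr S (pr G (pr Z (pr 2 (pr v Ts)))))"
| "i < length (ld S) \<Longrightarrow> typeV_code (pr G (pr v (p1 (nthc S i)))) \<Longrightarrow>
   wfT_code (pr S (pr (cns (p2 (nthc S i)) G) (pr Z T))) \<Longrightarrow>
   wfT_code (pr S (pr G (pr Z (pr 3 (pr i (pr v T))))))"
end

lemma re_wfT_code: "re wfT_code"
  unfolding wfT_code_def by (rule re_lfp) (intro enum_op_intros enum_op_app enum_op_re[OF re_typeV_code] c_intros)

lemma length_enc_sig [simp]: "length (ld (enc_sig sig)) = length sig"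
  by (simp add: enc_sig_def)
lemma nthc_enc_sig [simp]:
  "i < length sig \<Longrightarrow> nthc (enc_sig sig) i = pr (enc_ty (fst (sig ! i))) (enc_ty (snd (sig ! i)))"
  by (simp add: enc_sig_def split: prod.split)

lemma enc_ty_ProdD: "pr 1 (pr a b) = enc_ty t \<Longrightarrow> \<exists>s u. t = Prod s u \<and> a = enc_ty s \<and> b = enc_ty u"
  by (cases t) auto
lemma enc_ty_SumD: "pr 2 as = enc_ty t \<Longrightarrow> \<exists>ts. t = Sum ts \<and> as = tys ts"
  by (cases t) auto

text \<open>Here \<open>t\<close> is an arbitrary number. Derivability alone produces a template
  with that code, so \<open>wfinst\<close> can also reject numbers that code no instance.\<close>

lemma wfT_code_sound:
  "wfT_code c \<Longrightarrow> c = pr (enc_sig sig) (pr (tys \<Gamma>) (pr (tys Z) t)) \<Longrightarrow> \<exists>T. t = enc_tmpl T \<and> wfT sig \<Gamma> Z T"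
proof (induction arbitrary: \<Gamma> t rule: wfT_code.induct)
  case (1 j Z' G v S)
  then have *: "Z' = tys Z" "G = tys \<Gamma>" "S = enc_sig sig" "t = pr 0 (pr j v)" "j < length Z" by auto
  moreover obtain V where "v = enc_val V" "typeV \<Gamma> V (Z ! j)"
    using typeV_code_sound[OF 1(2), of \<Gamma> v "enc_ty (Z ! j)"] * by auto
  ultimately show ?case by (intro exI[of _ "TZ j V"]) (auto intro: wfT.intros)
next
  case (2 G v a b S Z' T')
  then have *: "Z' = tys Z" "G = tys \<Gamma>" "S = enc_sig sig" "t = pr 1 (pr v T')" by auto
  obtain V s u where V: "v = enc_val V" "typeV \<Gamma> V (Prod s u)" "a = enc_ty s" "b = enc_ty u"
    using typeV_code_sound[OF 2(1), of \<Gamma> v "pr 1 (pr a b)"] * enc_ty_ProdD by blast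
  moreover obtain T where "T' = enc_tmpl T" "wfT sig (s # u # \<Gamma>) Z T"
    using 2(3)[of "s # u # \<Gamma>" T'] * V by auto
  ultimately show ?case using * by (intro exI[of _ "MatchPair V T"]) (auto intro: wfT.intros)
next
  case (3 G v as Ts S Z')
  then have *: "Z' = tys Z" "G = tys \<Gamma>" "S = enc_sig sig" "t = pr 2 (pr v Ts)" by auto
  obtain V ts where V: "v = enc_val V" "typeV \<Gamma> V (Sum ts)" "as = tys ts"
    using typeV_code_sound[OF 3(1), of \<Gamma> v "pr 2 as"] * enc_ty_SumD by blast
  have "\<exists>T. nthc Ts l = enc_tmpl T \<and> wfT sig (ts ! l # \<Gamma>) Z T" if "l < length (ld Ts)" for l
    using 3(3)[rule_format, OF that, THEN conjunct2, rule_format, of "ts ! l # \<Gamma>" "nthc Ts l"]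
      * V that 3(2) by auto
  then obtain T where T: "\<And>l. l < length (ld Ts) \<Longrightarrow> nthc Ts l = enc_tmpl (T l) \<and>
      wfT sig (ts ! l # \<Gamma>) Z (T l)" by metis
  define Us where "Us = map T [0..<length (ld Ts)]"
  have "Ts = le (map enc_tmpl Us)" unfolding Us_def by (rule code_eq_map) (simp add: T)
  moreover have "wfT sig \<Gamma> Z (MatchSum V Us)"
    by (rule wfT.intros(3)[OF V(2)]) (use 3(2) V T in \<open>auto simp: Us_def\<close>)
  ultimately show ?case using * V by (intro exI[of _ "MatchSum V Us"]) auto
next
  case (4 i S G v Z' T')
  then have *: "Z' = tys Z" "G = tys \<Gamma>" "S = enc_sig sig" "t = pr 3 (pr i (pr v T'))"
    "i < length sig" by auto
  obtain V where V: "v = enc_val V" "typeV \<Gamma> V (fst (sig ! i))"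
    using typeV_code_sound[OF 4(2), of \<Gamma> v "enc_ty (fst (sig ! i))"] * by auto
  moreover obtain T where "T' = enc_tmpl T" "wfT sig (snd (sig ! i) # \<Gamma>) Z T"
    using 4(4)[of "snd (sig ! i) # \<Gamma>" T'] * by auto
  ultimately show ?case using * by (intro exI[of _ "TOp i V T"]) (auto intro: wfT.intros)
qed

lemma wfT_code_complete:
  "wfT sig \<Gamma> Z T \<Longrightarrow> wfT_code (pr (enc_sig sig) (pr (tys \<Gamma>) (pr (tys Z) (enc_tmpl T))))"
proof (induction rule: wfT.induct)
  case (1 j Z \<Gamma> v sig)
  then show ?case
    using wfT_code.intros(1)[of j "tys Z" "tys \<Gamma>" "enc_val v" "enc_sig sig"] typeV_code_complete[OF 1(2)] by simp
next
  case (2 \<Gamma> v a b sig Z T)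
  then show ?case
    using wfT_code.intros(2)[of "tys \<Gamma>" "enc_val v" "enc_ty a" "enc_ty b" "enc_sig sig" "tys Z"] typeV_code_complete[OF 2(1)]
    by simp
next
  case (3 \<Gamma> v as Ts sig Z)
  then show ?case
    using wfT_code.intros(3)[of "tys \<Gamma>" "enc_val v" "tys as" "le (map enc_tmpl Ts)" "enc_sig sig" "tys Z"]
      typeV_code_complete[OF 3(1)] by simp
next
  case (4 i sig \<Gamma> v Z T)
  then show ?case
    using wfT_code.intros(4)[of i "enc_sig sig" "tys \<Gamma>" "enc_val v" "tys Z" "enc_tmpl T"]
      typeV_code_complete[OF 4(2)] by simp
qed

definition istys :: "nat \<Rightarrow> bool" where
  "istys = (\<lambda>G. \<forall>i<length (ld G). \<exists>xs. ty_enum (pr (nthc G i) xs))"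

lemma re_istys: "re istys"
  unfolding istys_def by (rule re_enum_op) (intro enum_op_intros enum_op_re[OF re_ty_enum] c_intros)

lemma istys_iff: "istys G \<longleftrightarrow> (\<exists>\<Gamma>. G = tys \<Gamma>)"
proof
  assume "istys G"
  then have "\<forall>i<length (ld G). \<exists>t. nthc G i = enc_ty t"
    unfolding istys_def using ty_enum_sound by fastforce
  then obtain t where "\<And>i. i < length (ld G) \<Longrightarrow> nthc G i = enc_ty (t i)" by metis
  from code_eq_map[of G enc_ty t, OF this] show "\<exists>\<Gamma>. G = tys \<Gamma>" by blast
qed (auto simp: istys_def ty_enum_ex)

definition wfinst :: "nat \<Rightarrow> bool" where
  "wfinst = (\<lambda>x. \<exists>S E H. x = pr S (pr E H) \<and>
     (\<forall>i<length (ld S). \<exists>xs ys. ty_enum (pr (p1 (nthc S i)) xs) \<and> ty_enum (pr (p2 (nthc S i)) ys)) \<and>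
     (\<forall>e\<in>set (ld E). \<exists>G Z T1 T2. e = cns G (cns Z (cns T1 (cns T2 0))) \<and> istys G \<and> istys Z \<and>
        wfT_code (pr S (pr G (pr Z T1))) \<and> wfT_code (pr S (pr G (pr Z T2)))) \<and>
     length (ld H) = length (ld S) \<and>
     (\<forall>i<length (ld S). wfT_code (pr S (pr (cns (p1 (nthc S i)) 0) (pr (cns (p2 (nthc S i)) 0) (nthc H i))))))"

lemma re_wfinst: "re wfinst"
  unfolding wfinst_def
  by (rule re_enum_op) (intro enum_op_intros enum_op_re[OF re_ty_enum] enum_op_re[OF re_istys] enum_op_re[OF re_wfT_code] c_intros)

lemma wfinst_iff:
  "wfinst x \<longleftrightarrow> (\<exists>sig eqs H. x = enc_instance sig eqs H \<and> wf_theory sig eqs \<and> wf_handler sig H)"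
proof
  assume "wfinst x"
  then obtain S E K where x: "x = pr S (pr E K)"
    and S: "\<And>i. i < length (ld S) \<Longrightarrow>
      \<exists>xs ys. ty_enum (pr (p1 (nthc S i)) xs) \<and> ty_enum (pr (p2 (nthc S i)) ys)"
    and E: "\<And>e. e \<in> set (ld E) \<Longrightarrow> \<exists>G Z T1 T2. e = cns G (cns Z (cns T1 (cns T2 0))) \<and>
        istys G \<and> istys Z \<and> wfT_code (pr S (pr G (pr Z T1))) \<and> wfT_code (pr S (pr G (pr Z T2)))"
    and K: "length (ld K) = length (ld S)"
      "\<And>i. i < length (ld S) \<Longrightarrow>
        wfT_code (pr S (pr (cns (p1 (nthc S i)) 0) (pr (cns (p2 (nthc S i)) 0) (nthc K i))))"
    unfolding wfinst_def by auto
  have "\<exists>ab. nthc S i = (\<lambda>(a, b). pr (enc_ty a) (enc_ty b)) ab" if i: "i < length (ld S)" for i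
  proof -
    obtain a b where "p1 (nthc S i) = enc_ty a" "p2 (nthc S i) = enc_ty b"
      using S[OF i] ty_enum_sound by fastforce
    then have "nthc S i = pr (enc_ty a) (enc_ty b)" by (metis pr_p1_p2)
    then show ?thesis by (intro exI[of _ "(a, b)"]) simp
  qed
  then obtain ab where "\<And>i. i < length (ld S) \<Longrightarrow> nthc S i = (\<lambda>(a, b). pr (enc_ty a) (enc_ty b)) (ab i)"
    by metis
  from code_eq_map[of S _ ab, OF this] obtain sig where S_eq: "S = enc_sig sig"
    unfolding enc_sig_def by blast
  define ok where "ok e \<longleftrightarrow> (case e of (\<Gamma>, Z, T1, T2) \<Rightarrow> wfT sig \<Gamma> Z T1 \<and> wfT sig \<Gamma> Z T2)" for e
  have "\<exists>e'. nthc E i = enc_eq e' \<and> ok e'"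
    if i: "i < length (ld E)" for i
  proof -
    have "nthc E i \<in> set (ld E)" using i set_ld_nthc by blast
    then obtain G Z t1 t2 where e: "nthc E i = cns G (cns Z (cns t1 (cns t2 0)))"
      and "istys G" "istys Z" and t: "wfT_code (pr S (pr G (pr Z t1)))" "wfT_code (pr S (pr G (pr Z t2)))"
      using E by blast
    then obtain \<Gamma> Z' where GZ: "G = tys \<Gamma>" "Z = tys Z'" unfolding istys_iff by blast
    obtain T1 T2 where "t1 = enc_tmpl T1" "wfT sig \<Gamma> Z' T1" "t2 = enc_tmpl T2" "wfT sig \<Gamma> Z' T2"
      using wfT_code_sound[OF t(1)[unfolded GZ S_eq] refl] wfT_code_sound[OF t(2)[unfolded GZ S_eq] refl] by blast
    then show ?thesis using e GZ by (intro exI[of _ "(\<Gamma>, Z', T1, T2)"]) (simp add: enc_eq_def ok_def)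
  qed
  then obtain e' where e': "\<And>i. i < length (ld E) \<Longrightarrow> nthc E i = enc_eq (e' i)"
    "\<And>i. i < length (ld E) \<Longrightarrow> ok (e' i)"
    by metis
  define eqs where "eqs = map e' [0..<length (ld E)]"
  have E_eq: "E = le (map enc_eq eqs)" unfolding eqs_def by (rule code_eq_map) (rule e'(1))
  have thy: "wf_theory sig eqs" using e'(2) by (auto simp: wf_theory_def eqs_def ok_def)
  have "\<exists>T. nthc K i = enc_tmpl T \<and> wfT sig [fst (sig ! i)] [snd (sig ! i)] T" if i: "i < length sig" for i
    using wfT_code_sound[OF K(2)[of i], of sig "[fst (sig ! i)]" "[snd (sig ! i)]" "nthc K i"] i
    by (simp add: S_eq)
  then obtain T where T: "\<And>i. i < length sig \<Longrightarrow> nthc K i = enc_tmpl (T i)"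
    "\<And>i. i < length sig \<Longrightarrow> wfT sig [fst (sig ! i)] [snd (sig ! i)] (T i)" by metis
  define H where "H = map T [0..<length (ld K)]"
  have "K = le (map enc_tmpl H)" unfolding H_def
    by (rule code_eq_map) (use K(1) S_eq T in simp)
  moreover have "wf_handler sig H" using T(2) K(1) by (simp add: wf_handler_def H_def S_eq)
  ultimately show "\<exists>sig eqs H. x = enc_instance sig eqs H \<and> wf_theory sig eqs \<and> wf_handler sig H"
    using x S_eq E_eq thy unfolding enc_instance_def by blast
next
  assume "\<exists>sig eqs H. x = enc_instance sig eqs H \<and> wf_theory sig eqs \<and> wf_handler sig H"
  then obtain sig eqs H where x: "x = enc_instance sig eqs H" and thy: "wf_theory sig eqs"
    and H: "wf_handler sig H" by blast
  have "\<exists>G Z T1 T2. e = cns G (cns Z (cns T1 (cns T2 0))) \<and> istys G \<and> istys Z \<and>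
        wfT_code (pr (enc_sig sig) (pr G (pr Z T1))) \<and> wfT_code (pr (enc_sig sig) (pr G (pr Z T2)))"
    if e: "e \<in> enc_eq ` set eqs" for e
  proof -
    obtain \<Gamma> Z T1 T2 where "(\<Gamma>, Z, T1, T2) \<in> set eqs" "e = enc_eq (\<Gamma>, Z, T1, T2)"
      using e by force
    then show ?thesis using thy
      by (intro exI[of _ "tys \<Gamma>"] exI[of _ "tys Z"] exI[of _ "enc_tmpl T1"] exI[of _ "enc_tmpl T2"])
        (fastforce simp: enc_eq_def wf_theory_def istys_iff intro: wfT_code_complete)
  qed
  moreover have "wfT_code (pr (enc_sig sig) (pr (cns (enc_ty (fst (sig ! i))) 0)
      (pr (cns (enc_ty (snd (sig ! i))) 0) (enc_tmpl (H ! i)))))" if "i < length sig" for i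
    using wfT_code_complete[OF wfT_handler[OF H that]] by simp
  moreover have "length H = length sig" using H by (simp add: wf_handler_def)
  ultimately show "wfinst x" unfolding wfinst_def x enc_instance_def
    by (intro exI[of _ "enc_sig sig"] exI[of _ "le (map enc_eq eqs)"] exI[of _ "le (map enc_tmpl H)"])
      (simp add: ty_enum_ex)
qed

section \<open>Evaluation and trees on codes\<close>

context notes [[inductive_internals]] begin
inductive evalV_code :: "nat \<Rightarrow> bool" where
  "evalV_code (pr env (pr (pr 0 i) (nthc env i)))"
| "evalV_code (pr env (pr (pr 1 0) (pr 0 0)))"
| "evalV_code (pr env (pr v x)) \<Longrightarrow> evalV_code (pr env (pr w y)) \<Longrightarrow>
   evalV_code (pr env (pr (pr 2 (pr v w)) (pr 1 (pr x y))))"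
| "evalV_code (pr env (pr v x)) \<Longrightarrow> evalV_code (pr env (pr (pr 3 (pr l v)) (pr 2 (pr l x))))"
end

lemma re_evalV_code: "re evalV_code"
  unfolding evalV_code_def by (rule re_lfp) (intro enum_op_intros enum_op_app c_intros)

inductive_simps evalV_code_simps:
  "evalV_code (pr env (pr (pr 0 i) e))" "evalV_code (pr env (pr (pr 1 0) e))"
  "evalV_code (pr env (pr (pr 2 (pr v w)) e))" "evalV_code (pr env (pr (pr 3 (pr l v)) e))"

text \<open>On well-typed values the relation is the graph of \<open>evalV\<close>. On other inputs
  it may be partial or hold by the default entry 0 of \<open>nthc\<close>, which is
  harmless.\<close>

lemma evalV_code_iff:
  "typeV \<Gamma> V t \<Longrightarrow> list_all2 inT env \<Gamma> \<Longrightarrow>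
   evalV_code (pr (elems env) (pr (enc_val V) e)) \<longleftrightarrow> e = ce (evalV env V)"
  by (induction arbitrary: e rule: typeV.induct) (auto simp: evalV_code_simps list_all2_lengthD)

context notes [[inductive_internals]] begin
text \<open>Arguments of evalT_code: the instance code, the value environment, the environment of template
  variables, the template, and its result. The parameter P computes an operation from a table of
  its arguments; tables are lists indexed by element codes.\<close>
inductive evalT_code :: "(nat \<Rightarrow> bool) \<Rightarrow> nat \<Rightarrow> bool" for P where
  "evalV_code (pr env (pr v e)) \<Longrightarrow>
   evalT_code P (pr q (pr env (pr bs (pr (pr 0 (pr j v)) (nthc (nthc bs j) e)))))"
| "evalV_code (pr env (pr v (pr 1 (pr x y)))) \<Longrightarrow> evalT_code P (pr q (pr (cns x (cns y env)) (pr bs (pr T t)))) \<Longrightarrow>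
   evalT_code P (pr q (pr env (pr bs (pr (pr 1 (pr v T)) t))))"
| "evalV_code (pr env (pr v (pr 2 (pr l x)))) \<Longrightarrow> evalT_code P (pr q (pr (cns x env) (pr bs (pr (nthc Ts l) t)))) \<Longrightarrow>
   evalT_code P (pr q (pr env (pr bs (pr (pr 2 (pr v Ts)) t))))"
| "evalV_code (pr env (pr v a)) \<Longrightarrow> ty_enum (pr (p2 (nthc (p1 q) i)) xs) \<Longrightarrow>
   \<forall>x\<in>set (ld xs). evalT_code P (pr q (pr (cns x env) (pr bs (pr T (nthc kap x))))) \<Longrightarrow>
   P (pr q (pr i (pr a (pr kap t)))) \<Longrightarrow>
   evalT_code P (pr q (pr env (pr bs (pr (pr 3 (pr i (pr v T))) t))))"
end

lemma re_evalT_code: "re P \<Longrightarrow> re (evalT_code P)"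
  unfolding evalT_code_def
  by (rule re_lfp) (intro enum_op_intros enum_op_app enum_op_re[OF re_evalV_code] enum_op_re[OF re_ty_enum] enum_op_re[of P] c_intros)

inductive_simps evalT_code_simps:
  "evalT_code P (pr q (pr env (pr bs (pr (pr 0 (pr j v)) t))))"
  "evalT_code P (pr q (pr env (pr bs (pr (pr 1 (pr v T)) t))))"
  "evalT_code P (pr q (pr env (pr bs (pr (pr 2 (pr v Ts)) t))))"
  "evalT_code P (pr q (pr env (pr bs (pr (pr 3 (pr i (pr v T))) t))))"

definition node_op_code :: "nat \<Rightarrow> bool" where
  "node_op_code = (\<lambda>c. \<exists>q i a kap. c = pr q (pr i (pr a (pr kap (pr i (pr a kap))))))"
text \<open>\<open>p2 (p2 q)\<close> is the handler component of the instance code. Its template is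
  evaluated with the single value \<open>a\<close> and the single table \<open>kap\<close>, the
  operations inside it building tree nodes.\<close>

definition handler_op_code :: "nat \<Rightarrow> bool" where
  "handler_op_code = (\<lambda>c. \<exists>q i a kap t. c = pr q (pr i (pr a (pr kap t))) \<and>
     evalT_code node_op_code (pr q (pr (cns a 0) (pr (cns kap 0) (pr (nthc (p2 (p2 q)) i) t)))))"

lemma re_node_op_code: "re node_op_code"
  unfolding node_op_code_def by (rule re_enum_op) (intro enum_op_intros c_intros)
lemma re_handler_op_code: "re handler_op_code"
  unfolding handler_op_code_def by (rule re_enum_op) (intro enum_op_intros enum_op_re[OF re_evalT_code[OF re_node_op_code]] c_intros)

text \<open>A function in neither direction: the table is constrained only at codes of elements of
  the coarity, and the continuation only at those elements. Trees with a common code are provably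
  equal by \<open>rep_teq\<close>.\<close>

inductive rep :: "signature \<Rightarrow> nat \<Rightarrow> tree \<Rightarrow> bool" for sig where
  "i < length sig \<Longrightarrow> inT a (fst (sig ! i)) \<Longrightarrow>
   \<forall>x. inT x (snd (sig ! i)) \<longrightarrow> rep sig (nthc kap (ce x)) (k x) \<Longrightarrow>
   rep sig (pr i (pr (ce a) kap)) (Node i a k)"

lemma rep_wft: "rep sig c t \<Longrightarrow> wft sig t"
  by (induction rule: rep.induct) (auto intro: wft.intros)

text \<open>The type is finite, so a list longer than all codes of its elements stores the function,
  with \<open>the_inv ce\<close> decoding the position.\<close>

lemma ex_table: "\<exists>kap. \<forall>x. inT x t \<longrightarrow> nthc kap (ce x) = f x"
proof -
  obtain n where n: "\<And>x. inT x t \<Longrightarrow> ce x < n"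
    using finite_imageI[OF finite_inT[of t], of ce] finite_nat_set_iff_bounded by auto
  show ?thesis
    using n by (intro exI[of _ "le (map (\<lambda>m. f (the_inv ce m)) [0..<n])"])
      (auto simp: the_inv_f_f inj_def)
qed

lemma wft_rep: "wft sig t \<Longrightarrow> \<exists>c. rep sig c t"
proof (induction rule: wft.induct)
  case (1 i a k)
  then have "\<forall>x. \<exists>c. inT x (snd (sig ! i)) \<longrightarrow> rep sig c (k x)" by blast
  then obtain c where c: "\<And>x. inT x (snd (sig ! i)) \<Longrightarrow> rep sig (c x) (k x)" by metis
  obtain kap where "\<And>x. inT x (snd (sig ! i)) \<Longrightarrow> nthc kap (ce x) = c x" using ex_table by blast
  with c 1 have "rep sig (pr i (pr (ce a) kap)) (Node i a k)" by (auto intro: rep.intros)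
  then show ?case by blast
qed

lemma rep_teq: "rep sig c s \<Longrightarrow> rep sig c t \<Longrightarrow> teq sig eqs s t"
proof (induction arbitrary: t rule: rep.induct)
  case (1 i a kap k)
  from 1(4) obtain k' where "t = Node i a k'"
    "\<forall>x. inT x (snd (sig ! i)) \<longrightarrow> rep sig (nthc kap (ce x)) (k' x)" by cases auto
  with 1 show ?case by (auto intro: teq_cong)
qed

context notes [[inductive_internals]] begin
inductive tree_code :: "nat \<Rightarrow> bool" where
  "i < length (ld S) \<Longrightarrow> ty_enum (pr (p1 (nthc S i)) ys) \<Longrightarrow> a \<in> set (ld ys) \<Longrightarrow>
   ty_enum (pr (p2 (nthc S i)) xs) \<Longrightarrow> \<forall>x\<in>set (ld xs). tree_code (pr S (nthc kap x)) \<Longrightarrow>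
   tree_code (pr S (pr i (pr a kap)))"
end

lemma re_tree_code: "re tree_code"
  unfolding tree_code_def by (rule re_lfp) (intro enum_op_intros enum_op_app enum_op_re[OF re_ty_enum] c_intros)

lemma tree_code_iff: "tree_code (pr (enc_sig sig) c) \<longleftrightarrow> (\<exists>t. rep sig c t)"
proof
  have "d = pr (enc_sig sig) c \<Longrightarrow> \<exists>t. rep sig c t" if "tree_code d" for d
    using that
  proof (induction arbitrary: c rule: tree_code.induct)
    case (1 i S ys a xs kap)
    then have *: "S = enc_sig sig" "c = pr i (pr a kap)" "i < length sig" by auto
    then obtain a' where a': "a = ce a'" "inT a' (fst (sig ! i))" using 1 ty_enum_elems by fastforce
    have "\<forall>x. \<exists>t. inT x (snd (sig ! i)) \<longrightarrow> rep sig (nthc kap (ce x)) t"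
      using 1(4,5) * ty_enum_elems[of "snd (sig ! i)" xs] by auto
    then obtain k where "\<And>x. inT x (snd (sig ! i)) \<Longrightarrow> rep sig (nthc kap (ce x)) (k x)" by metis
    then have "rep sig c (Node i a' k)" using * a' by (auto intro: rep.intros)
    then show ?case by blast
  qed
  then show "tree_code (pr (enc_sig sig) c) \<Longrightarrow> \<exists>t. rep sig c t" by blast
next
  assume "\<exists>t. rep sig c t"
  then obtain t where "rep sig c t" by blast
  then show "tree_code (pr (enc_sig sig) c)"
  proof (induction rule: rep.induct)
    case (1 i a kap k)
    obtain ys xs where "ty_enum (pr (enc_ty (fst (sig ! i))) ys)" "ty_enum (pr (enc_ty (snd (sig ! i))) xs)"
      using ty_enum_ex by blast
    then show ?case using 1
      by (intro tree_code.intros[of i "enc_sig sig" ys "ce a" xs]) (auto simp: ty_enum_elems)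
  qed
qed

text \<open>Totality and correctness of \<open>P\<close> as an implementation of \<open>ops\<close>.
  Results need not be unique, since a tree has many codes.\<close>

definition opspec :: "signature \<Rightarrow> nat \<Rightarrow> (nat \<Rightarrow> bool) \<Rightarrow> (nat \<Rightarrow> elem \<Rightarrow> (elem \<Rightarrow> tree) \<Rightarrow> tree) \<Rightarrow> bool" where
  "opspec sig q P ops \<longleftrightarrow> (\<forall>i a kap k. i < length sig \<longrightarrow> inT a (fst (sig ! i)) \<longrightarrow>
     (\<forall>x. inT x (snd (sig ! i)) \<longrightarrow> rep sig (nthc kap (ce x)) (k x)) \<longrightarrow>
     (\<exists>c. P (pr q (pr i (pr (ce a) (pr kap c))))) \<and>
     (\<forall>c. P (pr q (pr i (pr (ce a) (pr kap c)))) \<longrightarrow> rep sig c (ops i a k)))"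

lemma evalT_code_rep:
  assumes q: "p1 q = enc_sig sig" and P: "opspec sig q P ops"
    and "wfT sig \<Gamma> Z T" "list_all2 inT env \<Gamma>"
    and bs: "\<And>j x. j < length Z \<Longrightarrow> inT x (Z ! j) \<Longrightarrow> rep sig (nthc (nthc bs j) (ce x)) (b j x)"
  shows "(\<exists>c. evalT_code P (pr q (pr (elems env) (pr bs (pr (enc_tmpl T) c))))) \<and>
    (\<forall>c. evalT_code P (pr q (pr (elems env) (pr bs (pr (enc_tmpl T) c)))) \<longrightarrow>
      rep sig c (evalT ops env b T))"
  using assms(3,4,1,2) bs
proof (induction arbitrary: env rule: wfT.induct)
  case (1 j Z \<Gamma> v sig)
  then show ?case using evalV_code_iff[OF 1(2,3)] inT_evalV[OF 1(2,3)] by (auto simp: evalT_code_simps)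
next
  case (2 \<Gamma> v a b sig Z T)
  obtain x y where xy: "evalV env v = EPair x y" "inT x a" "inT y b"
    using inT_evalV[OF 2(1,4)] inT_Prod by blast
  then have "evalT_code P (pr q (pr (elems env) (pr bs (pr (enc_tmpl (MatchPair v T)) c)))) \<longleftrightarrow>
      evalT_code P (pr q (pr (elems (x # y # env)) (pr bs (pr (enc_tmpl T) c))))" for c
    using evalV_code_iff[OF 2(1,4)] by (auto simp: evalT_code_simps)
  then show ?case using 2(3)[of "x # y # env"] 2(4-) xy by simp
next
  case (3 \<Gamma> v as Ts sig Z)
  obtain l x where lx: "evalV env v = EInj l x" "l < length as" "inT x (as ! l)"
    using inT_evalV[OF 3(1,4)] inT_Sum by blast
  then have "evalT_code P (pr q (pr (elems env) (pr bs (pr (enc_tmpl (MatchSum v Ts)) c)))) \<longleftrightarrow>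
      evalT_code P (pr q (pr (elems (x # env)) (pr bs (pr (enc_tmpl (Ts ! l)) c))))" for c
    using evalV_code_iff[OF 3(1,4)] 3(2) by (auto simp: evalT_code_simps)
  then show ?case
    using 3(3)[rule_format, of l, THEN conjunct2, rule_format, of "x # env"] 3(2,4-) lx by simp
next
  case (4 i sig \<Gamma> v Z T)
  let ?k = "\<lambda>x. evalT ops (x # env) b T"
  obtain xs where xs: "ty_enum (pr (enc_ty (snd (sig ! i))) xs)" using ty_enum_ex by blast
  have a: "inT (evalV env v) (fst (sig ! i))" by (rule inT_evalV[OF 4(2,5)])
  \<comment> \<open>Replaces the enumerating list in the rule by a quantifier over the elements of
    the coarity.\<close>
  have iff: "evalT_code P (pr q (pr (elems env) (pr bs (pr (enc_tmpl (TOp i v T)) c)))) \<longleftrightarrow>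
      (\<exists>kap. (\<forall>x. inT x (snd (sig ! i)) \<longrightarrow>
        evalT_code P (pr q (pr (elems (x # env)) (pr bs (pr (enc_tmpl T) (nthc kap (ce x))))))) \<and>
      P (pr q (pr i (pr (ce (evalV env v)) (pr kap c)))))" for c
  proof
    assume "evalT_code P (pr q (pr (elems env) (pr bs (pr (enc_tmpl (TOp i v T)) c))))"
    then obtain ys kap where "ty_enum (pr (enc_ty (snd (sig ! i))) ys)"
      "\<forall>x\<in>set (ld ys). evalT_code P (pr q (pr (cns x (elems env)) (pr bs (pr (enc_tmpl T) (nthc kap x)))))"
      "P (pr q (pr i (pr (ce (evalV env v)) (pr kap c))))"
      using evalV_code_iff[OF 4(2,5)] 4(1,6) by (auto simp: evalT_code_simps)
    then show "\<exists>kap. (\<forall>x. inT x (snd (sig ! i)) \<longrightarrow>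
        evalT_code P (pr q (pr (elems (x # env)) (pr bs (pr (enc_tmpl T) (nthc kap (ce x))))))) \<and>
      P (pr q (pr i (pr (ce (evalV env v)) (pr kap c))))"
      by (intro exI[of _ kap]) (simp add: ty_enum_elems)
  next
    assume "\<exists>kap. (\<forall>x. inT x (snd (sig ! i)) \<longrightarrow>
        evalT_code P (pr q (pr (elems (x # env)) (pr bs (pr (enc_tmpl T) (nthc kap (ce x))))))) \<and>
      P (pr q (pr i (pr (ce (evalV env v)) (pr kap c))))"
    then obtain kap where "\<forall>x. inT x (snd (sig ! i)) \<longrightarrow>
        evalT_code P (pr q (pr (elems (x # env)) (pr bs (pr (enc_tmpl T) (nthc kap (ce x))))))"
      "P (pr q (pr i (pr (ce (evalV env v)) (pr kap c))))" by blast
    then show "evalT_code P (pr q (pr (elems env) (pr bs (pr (enc_tmpl (TOp i v T)) c))))"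
      unfolding enc_tmpl.simps using evalV_code_iff[OF 4(2,5)] xs 4(1,6)
      by (intro evalT_code.intros(4)[of _ _ "ce (evalV env v)" _ _ xs _ _ _ kap]) (auto simp: ty_enum_elems)
  qed
  have IH: "(\<exists>c. evalT_code P (pr q (pr (elems (x # env)) (pr bs (pr (enc_tmpl T) c))))) \<and>
    (\<forall>c. evalT_code P (pr q (pr (elems (x # env)) (pr bs (pr (enc_tmpl T) c)))) \<longrightarrow> rep sig c (?k x))"
    if "inT x (snd (sig ! i))" for x
    using 4(4)[of "x # env"] 4(5-) that by simp
  then obtain f where f: "\<And>x. inT x (snd (sig ! i)) \<Longrightarrow>
      evalT_code P (pr q (pr (elems (x # env)) (pr bs (pr (enc_tmpl T) (f x)))))" by metis
  \<comment> \<open>The finitely many results of the continuation, one for each element, are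
    gathered in one table.\<close>
  obtain kap where kap: "\<And>x. inT x (snd (sig ! i)) \<Longrightarrow> nthc kap (ce x) = f x" using ex_table by blast
  have "\<forall>x. inT x (snd (sig ! i)) \<longrightarrow>
      evalT_code P (pr q (pr (elems (x # env)) (pr bs (pr (enc_tmpl T) (nthc kap (ce x))))))"
    using f kap by simp
  moreover obtain c where "P (pr q (pr i (pr (ce (evalV env v)) (pr kap c))))"
    using 4(7)[unfolded opspec_def, rule_format, OF 4(1) a, of kap ?k] IH f kap by metis
  moreover have "rep sig c (ops i (evalV env v) ?k)"
    if "\<forall>x. inT x (snd (sig ! i)) \<longrightarrow>
        evalT_code P (pr q (pr (elems (x # env)) (pr bs (pr (enc_tmpl T) (nthc kap (ce x))))))"
      "P (pr q (pr i (pr (ce (evalV env v)) (pr kap c))))" for kap c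
    using 4(7)[unfolded opspec_def, rule_format, OF 4(1) a, of kap ?k] IH that by metis
  ultimately show ?case unfolding iff evalT.simps by blast
qed

lemma opspec_node_op_code: "opspec sig q node_op_code Node"
  unfolding opspec_def node_op_code_def by (auto intro: rep.intros)

lemma opspec_handler_op_code:
  assumes "wf_handler sig H"
  shows "opspec sig (enc_instance sig eqs H) handler_op_code (hops H)"
  unfolding opspec_def
proof (intro allI impI)
  fix i a kap k
  assume i: "i < length sig" and a: "inT a (fst (sig ! i))"
    and k: "\<forall>x. inT x (snd (sig ! i)) \<longrightarrow> rep sig (nthc kap (ce x)) (k x)"
  let ?q = "enc_instance sig eqs H"
  have "handler_op_code (pr ?q (pr i (pr (ce a) (pr kap c)))) \<longleftrightarrow>
      evalT_code node_op_code (pr ?q (pr (elems [a]) (pr (cns kap 0) (pr (enc_tmpl (H ! i)) c))))" for c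
    using i assms by (simp add: handler_op_code_def enc_instance_def wf_handler_def)
  moreover have "p1 ?q = enc_sig sig" by (simp add: enc_instance_def)
  ultimately show "(\<exists>c. handler_op_code (pr ?q (pr i (pr (ce a) (pr kap c))))) \<and>
     (\<forall>c. handler_op_code (pr ?q (pr i (pr (ce a) (pr kap c)))) \<longrightarrow> rep sig c (hops H i a k))"
    using evalT_code_rep[OF _ opspec_node_op_code wfT_handler[OF assms i], of ?q "[a]" "cns kap 0" "\<lambda>_. k"] a k
    by (simp add: hops_def)
qed

text \<open>Serves two purposes. With \<open>node_op_code\<close> the pairs are the axiom instances
  of provable equality; with \<open>handler_op_code\<close> they are the equalities that correctness
  demands. The argument packs the instance code with the codes of the two evaluated sides.\<close>

definition inst :: "(nat \<Rightarrow> bool) \<Rightarrow> nat \<Rightarrow> bool" where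
  "inst P = (\<lambda>c. \<exists>G Z T1 T2 env bs.
     cns G (cns Z (cns T1 (cns T2 0))) \<in> set (ld (p1 (p2 (p1 c)))) \<and>
     length (ld env) = length (ld G) \<and>
     (\<forall>i<length (ld G). \<exists>xs. ty_enum (pr (nthc G i) xs) \<and> nthc env i \<in> set (ld xs)) \<and>
     (\<forall>j<length (ld Z). \<exists>xs. ty_enum (pr (nthc Z j) xs) \<and>
        (\<forall>x\<in>set (ld xs). tree_code (pr (p1 (p1 c)) (nthc (nthc bs j) x)))) \<and>
     evalT_code P (pr (p1 c) (pr env (pr bs (pr T1 (p1 (p2 c)))))) \<and>
     evalT_code P (pr (p1 c) (pr env (pr bs (pr T2 (p2 (p2 c)))))))"

lemma re_inst: "re P \<Longrightarrow> re (inst P)"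
  unfolding inst_def
  by (rule re_enum_op) (intro enum_op_intros enum_op_re[OF re_ty_enum] enum_op_re[OF re_tree_code] enum_op_re[OF re_evalT_code[of P]] c_intros)

locale instance_code =
  fixes sig :: signature and eqs :: "equation list" and H :: "tmpl list"
  assumes thy: "wf_theory sig eqs" and handler: "wf_handler sig H"
begin

abbreviation "q \<equiv> enc_instance sig eqs H"

lemma q_simps: "p1 q = enc_sig sig" "p1 (p2 q) = le (map enc_eq eqs)"
  by (simp_all add: enc_instance_def)

lemma eq_wf: "(\<Gamma>, Z, T1, T2) \<in> set eqs \<Longrightarrow> wfT sig \<Gamma> Z T1 \<and> wfT sig \<Gamma> Z T2"
  using thy by (auto simp: wf_theory_def)

lemma inst_sound:
  assumes "opspec sig q P ops" "inst P (pr q (pr s t))"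
  obtains \<Gamma> Z T1 T2 env b where "(\<Gamma>, Z, T1, T2) \<in> set eqs" "list_all2 inT env \<Gamma>"
    "\<And>j x. j < length Z \<Longrightarrow> inT x (Z ! j) \<Longrightarrow> wft sig (b j x)"
    "rep sig s (evalT ops env b T1)" "rep sig t (evalT ops env b T2)"
proof -
  obtain G Z' t1 t2 ec bs where e: "cns G (cns Z' (cns t1 (cns t2 0))) \<in> enc_eq ` set eqs"
    and ec_len: "length (ld ec) = length (ld G)"
    and ec_in: "\<forall>i<length (ld G). \<exists>xs. ty_enum (pr (nthc G i) xs) \<and> nthc ec i \<in> set (ld xs)"
    and bs: "\<forall>j<length (ld Z'). \<exists>xs. ty_enum (pr (nthc Z' j) xs) \<and>
        (\<forall>x\<in>set (ld xs). tree_code (pr (enc_sig sig) (nthc (nthc bs j) x)))"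
    and ev: "evalT_code P (pr q (pr ec (pr bs (pr t1 s))))" "evalT_code P (pr q (pr ec (pr bs (pr t2 t))))"
    using assms(2) unfolding inst_def p1_pr p2_pr q_simps list_encode_inverse set_map by blast
  obtain \<Gamma> Z T1 T2 where eq: "(\<Gamma>, Z, T1, T2) \<in> set eqs"
    and "cns G (cns Z' (cns t1 (cns t2 0))) = enc_eq (\<Gamma>, Z, T1, T2)"
    using e by force
  then have c: "G = tys \<Gamma>" "Z' = tys Z" "t1 = enc_tmpl T1" "t2 = enc_tmpl T2"
    by (simp_all add: enc_eq_def)
  have "\<exists>x. nthc ec i = ce x \<and> inT x (\<Gamma> ! i)" if "i < length \<Gamma>" for i
    using ec_in that c ty_enum_elems by fastforce
  then obtain f where f: "\<And>i. i < length \<Gamma> \<Longrightarrow> nthc ec i = ce (f i) \<and> inT (f i) (\<Gamma> ! i)" by metis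
  define env where "env = map f [0..<length (ld ec)]"
  have len: "length (ld ec) = length \<Gamma>" using ec_len c by simp
  have ec: "ec = elems env" unfolding env_def by (rule code_eq_map) (use f len in simp)
  have env: "list_all2 inT env \<Gamma>" using f len by (simp add: env_def list_all2_conv_all_nth)
  have "\<forall>j x. \<exists>u. j < length Z \<longrightarrow> inT x (Z ! j) \<longrightarrow> rep sig (nthc (nthc bs j) (ce x)) u"
    using bs c ty_enum_elems by (fastforce simp: tree_code_iff)
  then obtain b where b: "\<And>j x. j < length Z \<Longrightarrow> inT x (Z ! j) \<Longrightarrow>
      rep sig (nthc (nthc bs j) (ce x)) (b j x)" by metis
  have "rep sig s (evalT ops env b T1)" "rep sig t (evalT ops env b T2)"
    using evalT_code_rep[OF q_simps(1) assms(1) _ env b] eq_wf[OF eq] ev[unfolded c ec] by blast+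
  then show ?thesis using that[OF eq env] b rep_wft by blast
qed

lemma inst_complete:
  assumes "opspec sig q P ops" "(\<Gamma>, Z, T1, T2) \<in> set eqs" "list_all2 inT env \<Gamma>"
    "\<And>j x. j < length Z \<Longrightarrow> inT x (Z ! j) \<Longrightarrow> wft sig (b j x)"
  obtains s t where "inst P (pr q (pr s t))"
    "rep sig s (evalT ops env b T1)" "rep sig t (evalT ops env b T2)"
proof -
  have "\<forall>j x. \<exists>c. j < length Z \<longrightarrow> inT x (Z ! j) \<longrightarrow> rep sig c (b j x)"
    using assms(4) wft_rep by blast
  then obtain f where f: "\<And>j x. j < length Z \<Longrightarrow> inT x (Z ! j) \<Longrightarrow> rep sig (f j x) (b j x)" by metis
  have "\<forall>j. \<exists>kap. \<forall>x. inT x (Z ! j) \<longrightarrow> nthc kap (ce x) = f j x" using ex_table by blast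
  then obtain g where g: "\<And>j x. inT x (Z ! j) \<Longrightarrow> nthc (g j) (ce x) = f j x" by metis
  define bs where "bs = le (map g [0..<length Z])"
  have bs: "rep sig (nthc (nthc bs j) (ce x)) (b j x)" if "j < length Z" "inT x (Z ! j)" for j x
    using that f g by (simp add: bs_def)
  note ev = evalT_code_rep[OF q_simps(1) assms(1) _ assms(3) bs]
  obtain s t where st: "evalT_code P (pr q (pr (elems env) (pr bs (pr (enc_tmpl T1) s))))"
    "evalT_code P (pr q (pr (elems env) (pr bs (pr (enc_tmpl T2) t))))"
    using ev eq_wf[OF assms(2)] by blast
  have "\<exists>xs. ty_enum (pr (enc_ty (\<Gamma> ! i)) xs) \<and> ce (env ! i) \<in> set (ld xs)" if "i < length \<Gamma>" for i
  proof -
    obtain xs where xs: "ty_enum (pr (enc_ty (\<Gamma> ! i)) xs)" using ty_enum_ex by blast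
    then show ?thesis using assms(3) that
      by (intro exI[of _ xs]) (auto simp: ty_enum_elems list_all2_conv_all_nth)
  qed
  moreover have "\<exists>xs. ty_enum (pr (enc_ty (Z ! j)) xs) \<and>
      (\<forall>x\<in>set (ld xs). tree_code (pr (enc_sig sig) (nthc (nthc bs j) x)))" if "j < length Z" for j
  proof -
    obtain xs where xs: "ty_enum (pr (enc_ty (Z ! j)) xs)" using ty_enum_ex by blast
    then show ?thesis using bs[OF that] by (intro exI[of _ xs]) (auto simp: ty_enum_elems tree_code_iff)
  qed
  moreover have "cns (tys \<Gamma>) (cns (tys Z) (cns (enc_tmpl T1) (cns (enc_tmpl T2) 0))) \<in> enc_eq ` set eqs"
    using assms(2) by (intro image_eqI[of _ _ "(\<Gamma>, Z, T1, T2)"]) (simp_all add: enc_eq_def)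
  moreover have "length env = length \<Gamma>" using assms(3) by (rule list_all2_lengthD)
  ultimately have "inst P (pr q (pr s t))"
    unfolding inst_def p1_pr p2_pr q_simps list_encode_inverse set_map
    using st by (intro exI[of _ "tys \<Gamma>"] exI[of _ "tys Z"] exI[of _ "enc_tmpl T1"]
        exI[of _ "enc_tmpl T2"] exI[of _ "elems env"] exI[of _ bs]) simp
  moreover have "rep sig s (evalT ops env b T1)" "rep sig t (evalT ops env b T2)"
    using ev eq_wf[OF assms(2)] st by blast+
  ultimately show ?thesis using that by blast
qed

end

section \<open>Provable equality on codes\<close>

context notes [[inductive_internals]] begin
text \<open>Reflexivity on codes of well-formed trees is derivable from congruence, see
  \<open>teq_code_same_rep\<close>; congruence also identifies different codes of one tree.\<close>

inductive teq_code :: "nat \<Rightarrow> bool" where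
  teq_code_sym: "teq_code (pr q (pr s t)) \<Longrightarrow> teq_code (pr q (pr t s))"
| teq_code_trans: "teq_code (pr q (pr s t)) \<Longrightarrow> teq_code (pr q (pr t u)) \<Longrightarrow> teq_code (pr q (pr s u))"
| teq_code_cong: "i < length (ld (p1 q)) \<Longrightarrow> ty_enum (pr (p1 (nthc (p1 q) i)) ys) \<Longrightarrow> a \<in> set (ld ys) \<Longrightarrow>
   ty_enum (pr (p2 (nthc (p1 q) i)) xs) \<Longrightarrow>
   \<forall>x\<in>set (ld xs). teq_code (pr q (pr (nthc kap x) (nthc kap' x))) \<Longrightarrow>
   teq_code (pr q (pr (pr i (pr a kap)) (pr i (pr a kap'))))"
| teq_code_ax: "inst node_op_code (pr q (pr s t)) \<Longrightarrow> teq_code (pr q (pr s t))"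
end

lemma re_teq_code: "re teq_code"
  unfolding teq_code_def
  by (rule re_lfp) (intro enum_op_intros enum_op_app enum_op_re[OF re_ty_enum] enum_op_re[OF re_inst[OF re_node_op_code]] c_intros)

context instance_code begin

lemma teq_code_sound:
  "teq_code c \<Longrightarrow> c = pr q (pr cs ct) \<Longrightarrow> \<exists>s t. rep sig cs s \<and> rep sig ct t \<and> teq sig eqs s t"
proof (induction arbitrary: cs ct rule: teq_code.induct)
  case (teq_code_sym q' s t)
  then show ?case using teq_code_sym(2)[of s t] by (auto intro: teq_sym)
next
  case (teq_code_trans q' s t u)
  then obtain s' t' t'' u' where "rep sig s s'" "rep sig t t'" "teq sig eqs s' t'"
    "rep sig t t''" "rep sig u u'" "teq sig eqs t'' u'"
    using teq_code_trans(3)[of s t] teq_code_trans(4)[of t u] by auto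
  \<comment> \<open>The two induction hypotheses may decode the middle code to different trees;
    \<open>rep_teq\<close> closes the gap.\<close>
  moreover from this have "teq sig eqs t' t''" by (blast intro: rep_teq)
  ultimately have "teq sig eqs s' u'" by (blast intro: teq_trans)
  moreover have "cs = s" "ct = u" using teq_code_trans(5) by auto
  ultimately show ?case using \<open>rep sig s s'\<close> \<open>rep sig u u'\<close> by blast
next
  case (teq_code_cong i q' ys a xs kap kap')
  then have *: "q' = q" "i < length sig" "cs = pr i (pr a kap)" "ct = pr i (pr a kap')"
    by (auto simp: q_simps)
  have "ty_enum (pr (enc_ty (fst (sig ! i))) ys)" using teq_code_cong(2) * by (simp add: q_simps)
  then obtain a' where a': "a = ce a'" "inT a' (fst (sig ! i))" using teq_code_cong(3) ty_enum_elems by fastforce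
  have "ty_enum (pr (enc_ty (snd (sig ! i))) xs)" using teq_code_cong(4) * by (simp add: q_simps)
  then have "\<forall>x. \<exists>s t. inT x (snd (sig ! i)) \<longrightarrow>
      rep sig (nthc kap (ce x)) s \<and> rep sig (nthc kap' (ce x)) t \<and> teq sig eqs s t"
    using teq_code_cong(5) * ty_enum_elems by auto
  then obtain k k' where "\<And>x. inT x (snd (sig ! i)) \<Longrightarrow> rep sig (nthc kap (ce x)) (k x) \<and>
      rep sig (nthc kap' (ce x)) (k' x) \<and> teq sig eqs (k x) (k' x)" by metis
  then have "rep sig cs (Node i a' k)" "rep sig ct (Node i a' k')" "teq sig eqs (Node i a' k) (Node i a' k')"
    using * a' by (auto intro: rep.intros teq_cong)
  then show ?case by blast
next
  case (teq_code_ax q' s t)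
  then have "inst node_op_code (pr q (pr cs ct))" by auto
  then obtain \<Gamma> Z T1 T2 env b where "(\<Gamma>, Z, T1, T2) \<in> set eqs" "list_all2 inT env \<Gamma>"
    "\<And>j x. j < length Z \<Longrightarrow> inT x (Z ! j) \<Longrightarrow> wft sig (b j x)"
    "rep sig cs (evalT Node env b T1)" "rep sig ct (evalT Node env b T2)"
    using inst_sound[OF opspec_node_op_code] by blast
  then show ?case by (blast intro: teq_ax)
qed

lemma teq_code_congI:
  assumes "i < length sig" "inT a (fst (sig ! i))"
    "\<And>x. inT x (snd (sig ! i)) \<Longrightarrow> teq_code (pr q (pr (nthc kap (ce x)) (nthc kap' (ce x))))"
  shows "teq_code (pr q (pr (pr i (pr (ce a) kap)) (pr i (pr (ce a) kap'))))"
proof -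
  obtain ys xs where "ty_enum (pr (enc_ty (fst (sig ! i))) ys)" "ty_enum (pr (enc_ty (snd (sig ! i))) xs)"
    using ty_enum_ex by blast
  then show ?thesis using assms by (intro teq_code_cong[of i _ ys _ xs]) (auto simp: q_simps ty_enum_elems)
qed

lemma teq_code_same_rep: "rep sig c t \<Longrightarrow> rep sig d t \<Longrightarrow> teq_code (pr q (pr c d))"
proof (induction arbitrary: d rule: rep.induct)
  case (1 i a kap k)
  from 1(4) obtain kap' where "d = pr i (pr (ce a) kap')"
    "\<forall>x. inT x (snd (sig ! i)) \<longrightarrow> rep sig (nthc kap' (ce x)) (k x)" by cases auto
  with 1 show ?case by (auto intro: teq_code_congI)
qed

lemma teq_code_complete: "teq sig eqs s t \<Longrightarrow> rep sig c s \<Longrightarrow> rep sig d t \<Longrightarrow> teq_code (pr q (pr c d))"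
proof (induction arbitrary: c d rule: teq.induct)
  case (teq_refl t)
  then show ?case by (blast intro: teq_code_same_rep)
next
  case (teq_sym s t)
  then show ?case by (blast intro: teq_code_sym)
next
  case (teq_trans s t u)
  obtain e where "rep sig e t" using wft_rep teq_wft(1)[OF thy teq_trans(2)] by blast
  with teq_trans show ?case by (blast intro: teq_code_trans)
next
  case (teq_cong i a k k')
  from teq_cong(4) obtain kap where c: "c = pr i (pr (ce a) kap)"
    "\<forall>x. inT x (snd (sig ! i)) \<longrightarrow> rep sig (nthc kap (ce x)) (k x)" by cases auto
  from teq_cong(5) obtain kap' where d: "d = pr i (pr (ce a) kap')"
    "\<forall>x. inT x (snd (sig ! i)) \<longrightarrow> rep sig (nthc kap' (ce x)) (k' x)" by cases auto
  show ?case unfolding c(1) d(1)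
    by (rule teq_code_congI[OF teq_cong(1,2)]) (use teq_cong(3) c(2) d(2) in blast)
next
  case (teq_ax \<Gamma> Z T1 T2 env b)
  obtain c' d' where "inst node_op_code (pr q (pr c' d'))"
    "rep sig c' (evalT Node env b T1)" "rep sig d' (evalT Node env b T2)"
    using inst_complete[OF opspec_node_op_code teq_ax(1,2)] teq_ax(3) by metis
  \<comment> \<open>The axiom instance brings its own codes of the two sides, which are linked to
    the prescribed codes by transitivity.\<close>
  with teq_ax(4,5) show ?case by (meson teq_code_ax teq_code_trans teq_code_same_rep)
qed

lemma correct_iff: "handler_correct sig eqs H \<longleftrightarrow> (\<forall>y. inst handler_op_code (pr q y) \<longrightarrow> teq_code (pr q y))"
proof
  assume c: "handler_correct sig eqs H"
  show "\<forall>y. inst handler_op_code (pr q y) \<longrightarrow> teq_code (pr q y)"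
  proof (intro allI impI)
    fix y assume "inst handler_op_code (pr q y)"
    then have "inst handler_op_code (pr q (pr (p1 y) (p2 y)))" by simp
    then obtain \<Gamma> Z T1 T2 env b where *: "(\<Gamma>, Z, T1, T2) \<in> set eqs" "list_all2 inT env \<Gamma>"
      "\<And>j x. j < length Z \<Longrightarrow> inT x (Z ! j) \<Longrightarrow> wft sig (b j x)"
      "rep sig (p1 y) (evalT (hops H) env b T1)" "rep sig (p2 y) (evalT (hops H) env b T2)"
      using inst_sound[OF opspec_handler_op_code[OF handler]] by blast
    have "teq sig eqs (evalT (hops H) env b T1) (evalT (hops H) env b T2)"
      using c *(1-3) unfolding handler_correct_iff[OF thy handler] by blast
    from teq_code_complete[OF this *(4,5)] show "teq_code (pr q y)" by simp
  qed
next
  assume r: "\<forall>y. inst handler_op_code (pr q y) \<longrightarrow> teq_code (pr q y)"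
  have "teq sig eqs (evalT (hops H) env b T1) (evalT (hops H) env b T2)"
    if e: "(\<Gamma>, Z, T1, T2) \<in> set eqs" and env: "list_all2 inT env \<Gamma>"
      and b: "\<forall>j<length Z. \<forall>x. inT x (Z ! j) \<longrightarrow> wft sig (b j x)" for \<Gamma> Z T1 T2 env b
  proof -
    obtain s t where st: "inst handler_op_code (pr q (pr s t))"
      "rep sig s (evalT (hops H) env b T1)" "rep sig t (evalT (hops H) env b T2)"
      using inst_complete[OF opspec_handler_op_code[OF handler] e env, of b] b by metis
    then obtain s' t' where "rep sig s s'" "rep sig t t'" "teq sig eqs s' t'"
      using r teq_code_sound by blast
    with st show ?thesis by (meson rep_teq teq_trans)
  qed
  then show "handler_correct sig eqs H" unfolding handler_correct_iff[OF thy handler] by blast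
qed

end

theorem Pi2_CORRECT_HANDLER: "Pi2 CORRECT_HANDLER"
proof -
  have "CORRECT_HANDLER = {x. wfinst x \<and> (\<forall>y. inst handler_op_code (pr x y) \<longrightarrow> teq_code (pr x y))}"
    unfolding CORRECT_HANDLER_def wfinst_iff
    using instance_code.correct_iff[OF instance_code.intro] by fast
  then show ?thesis using Pi2I[OF re_wfinst re_inst[OF re_handler_op_code] re_teq_code] by simp
qed

section \<open>A machine as an equational theory\<close>

datatype fo = FVar nat | FApp nat "fo list"

text \<open>An operation with n arguments becomes a symbol whose coarity is a sum of n copies of
  \<open>One\<close>: its bound variable is the argument position, and the match returns the
  argument there.\<close>

primrec tm :: "fo \<Rightarrow> tmpl" where
  "tm (FVar j) = TZ j VUnit"
| "tm (FApp i ts) = TOp i VUnit (MatchSum (VVar 0) (map tm ts))"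

primrec feval :: "(nat \<Rightarrow> 'm list \<Rightarrow> 'm) \<Rightarrow> (nat \<Rightarrow> 'm) \<Rightarrow> fo \<Rightarrow> 'm" where
  "feval F b (FVar j) = b j"
| "feval F b (FApp i ts) = F i (map (feval F b) ts)"

text \<open>The continuation built from a list is a normal form. An arbitrary continuation with the
  same arguments agrees with it only on well-typed labels, so such trees are compared by
  \<open>teq\<close> rather than equality.\<close>

definition nop :: "(nat \<Rightarrow> elem \<Rightarrow> (elem \<Rightarrow> 'm) \<Rightarrow> 'm) \<Rightarrow> nat \<Rightarrow> 'm list \<Rightarrow> 'm" where
  "nop ops i xs = ops i EUnit (\<lambda>x. case x of EInj l _ \<Rightarrow> xs ! l | _ \<Rightarrow> undefined)"

text \<open>The substitution lemma, as \<open>feval FApp\<close> is substitution.\<close>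

lemma feval_feval: "feval F b (feval FApp s t) = feval F (\<lambda>j. feval F b (s j)) t"
  by (induction t) (auto simp: comp_def cong: map_cong)

text \<open>The operations 0 to 5 are the data constructors Z and C, the machine configurations Ev and Ap,
  the outcome Acc, and Rd; operation 6 is the one that the handler redefines.\<close>

definition ar :: "nat list" where "ar = [0, 2, 3, 2, 0, 1]"
definition hsig :: signature where
  "hsig = map (\<lambda>n. (One, Sum (replicate n One))) ar @ [(One, One)]"

text \<open>The quantifier over the image under \<open>map\<close> keeps the recursion in the form
  accepted by \<open>primrec\<close>. The bound 6 excludes the operation that the handler
  redefines.\<close>

primrec wff :: "nat \<Rightarrow> fo \<Rightarrow> bool" where
  "wff n (FVar j) \<longleftrightarrow> j < n"
| "wff n (FApp i ts) \<longleftrightarrow> i < 6 \<and> length ts = ar ! i \<and> (\<forall>b\<in>set (map (wff n) ts). b)"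

lemma length_ar [simp]: "length ar = 6"
  by (simp add: ar_def)
lemma hsig_nth: "i < 6 \<Longrightarrow> hsig ! i = (One, Sum (replicate (ar ! i) One))"
  by (simp add: hsig_def nth_append)
lemma hsig_6: "hsig ! 6 = (One, One)" and length_hsig: "length hsig = 7"
  by (simp_all add: hsig_def ar_def)

lemma inT_args: "inT x (Sum (replicate n One)) \<longleftrightarrow> (\<exists>l<n. x = EInj l EUnit)"
  by (auto simp: inT_Sum inT_One)

lemma wfT_tm: "wff n t \<Longrightarrow> wfT hsig \<Gamma> (replicate n One) (tm t)"
proof (induction t arbitrary: \<Gamma>)
  case (FVar j)
  then show ?case using wfT.intros(1)[of j "replicate n One" \<Gamma> VUnit] by (simp add: typeV.intros)
next
  case (FApp i ts)
  then have i: "i < 6" "length ts = ar ! i" by auto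
  have "wfT hsig (Sum (replicate (ar ! i) One) # \<Gamma>) (replicate n One) (MatchSum (VVar 0) (map tm ts))"
  proof (rule wfT.intros(3))
    show "typeV (Sum (replicate (ar ! i) One) # \<Gamma>) (VVar 0) (Sum (replicate (ar ! i) One))"
      using typeV.intros(1)[of 0 "Sum (replicate (ar ! i) One) # \<Gamma>"] by simp
  qed (use FApp i in auto)
  then show ?case unfolding tm.simps
    by (intro wfT.intros(4)) (use i in \<open>auto simp: hsig_nth length_hsig typeV.intros\<close>)
qed

text \<open>The counterpart of \<open>evalT_rel\<close> for first-order terms, relating
  continuations to lists of arguments. It serves for plain trees, for the handler and for the
  separating model.\<close>

lemma tm_rel:
  assumes F: "\<And>i k xs. i < 6 \<Longrightarrow> length xs = ar ! i \<Longrightarrow>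
      (\<And>l. l < ar ! i \<Longrightarrow> R (k (EInj l EUnit)) (xs ! l)) \<Longrightarrow> R (ops i EUnit k) (F i xs)"
    and b: "\<And>j. j < n \<Longrightarrow> R (b j EUnit) (\<beta> j)"
  shows "wff n t \<Longrightarrow> R (evalT ops env b (tm t)) (feval F \<beta> t)"
proof (induction t arbitrary: env)
  case (FVar j)
  then show ?case using b by simp
next
  case (FApp i ts)
  then show ?case by (auto intro!: F)
qed

abbreviation "tZ \<equiv> FApp 0 []"
abbreviation "tC a b \<equiv> FApp 1 [a, b]"
abbreviation "tEv a b c \<equiv> FApp 2 [a, b, c]"
abbreviation "tAp a b \<equiv> FApp 3 [a, b]"
abbreviation "tAcc \<equiv> FApp 4 []"
abbreviation "tRd a \<equiv> FApp 5 [a]"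

primrec num :: "nat \<Rightarrow> fo" where
  num_0: "num 0 = tZ"
| num_Suc: "num (Suc n) = tC tZ (num n)"
declare num.simps [simp del]

text \<open>With the equations of \<open>num\<close> removed from the simplifier, numeral tags stay
  folded and are told apart by this lemma.\<close>

lemma num_inj [simp]: "num m = num n \<longleftrightarrow> m = n"
proof (induction m arbitrary: n)
  case 0
  show ?case by (cases n) (auto simp: num.simps)
next
  case (Suc m)
  then show ?case by (cases n) (auto simp: num.simps)
qed

lemma wff_num [simp]: "wff n (num m)"
  by (induction m) (auto simp: num.simps ar_def One_nat_def)

lemma feval_FApp_num [simp]: "feval FApp s (num m) = num m"
  by (induction m) (auto simp: num.simps)

text \<open>A continuation-passing interpreter for recursive functions. Numbers, argument lists, codes of
  functions and continuations are data built from Z and C; codes and continuations carry a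
  numeral as tag. Tag 6 is the evaluation of a list of functions.\<close>

definition rules :: "(fo \<times> fo) list" where
  "rules = [
    (tEv (tC (num 0) (FVar 0)) (FVar 1) (FVar 2), tAp (FVar 2) tZ),
    (tEv (tC (num 1) (FVar 0)) tZ (FVar 2), tAp (FVar 2) (tC tZ tZ)),
    (tEv (tC (num 1) (FVar 0)) (tC (FVar 1) (FVar 3)) (FVar 2), tAp (FVar 2) (tC tZ (FVar 1))),
    (tEv (tC (num 2) (FVar 0)) tZ (FVar 2), tAp (FVar 2) tZ),
    (tEv (tC (num 2) tZ) (tC (FVar 1) (FVar 3)) (FVar 2), tAp (FVar 2) (FVar 1)),
    (tEv (tC (num 2) (tC tZ (FVar 0))) (tC (FVar 1) (FVar 3)) (FVar 2), tEv (tC (num 2) (FVar 0)) (FVar 3) (FVar 2)),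
    (tEv (tC (num 3) (tC (FVar 0) (FVar 1))) (FVar 2) (FVar 3),
       tEv (tC (num 6) (FVar 1)) (FVar 2) (tC (num 0) (tC (FVar 0) (FVar 3)))),
    (tEv (tC (num 6) tZ) (FVar 2) (FVar 3), tAp (FVar 3) tZ),
    (tEv (tC (num 6) (tC (FVar 0) (FVar 1))) (FVar 2) (FVar 3),
       tEv (FVar 0) (FVar 2) (tC (num 1) (tC (FVar 1) (tC (FVar 2) (FVar 3))))),
    (tAp (tC (num 1) (tC (FVar 1) (tC (FVar 2) (FVar 3)))) (FVar 0),
       tEv (tC (num 6) (FVar 1)) (FVar 2) (tC (num 2) (tC (FVar 0) (FVar 3)))),
    (tAp (tC (num 2) (tC (FVar 0) (FVar 3))) (FVar 1), tAp (FVar 3) (tC (FVar 0) (FVar 1))),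
    (tAp (tC (num 0) (tC (FVar 0) (FVar 3))) (FVar 1), tEv (FVar 0) (FVar 1) (FVar 3)),
    (tEv (tC (num 4) (tC (FVar 0) (FVar 1))) (tC tZ (FVar 2)) (FVar 3), tEv (FVar 0) (FVar 2) (FVar 3)),
    (tEv (tC (num 4) (tC (FVar 0) (FVar 1))) (tC (tC tZ (FVar 4)) (FVar 2)) (FVar 3),
       tEv (tC (num 4) (tC (FVar 0) (FVar 1))) (tC (FVar 4) (FVar 2))
         (tC (num 3) (tC (FVar 1) (tC (FVar 4) (tC (FVar 2) (FVar 3)))))),
    (tAp (tC (num 3) (tC (FVar 1) (tC (FVar 4) (tC (FVar 2) (FVar 3))))) (FVar 0),
       tEv (FVar 1) (tC (FVar 4) (tC (FVar 0) (FVar 2))) (FVar 3)),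
    (tEv (tC (num 5) (FVar 0)) (FVar 1) (FVar 2),
       tEv (FVar 0) (tC tZ (FVar 1)) (tC (num 4) (tC (FVar 0) (tC tZ (tC (FVar 1) (FVar 2)))))),
    (tAp (tC (num 4) (tC (FVar 0) (tC (FVar 3) (tC (FVar 1) (FVar 2))))) tZ, tAp (FVar 2) (FVar 3)),
    (tAp (tC (num 4) (tC (FVar 0) (tC (FVar 3) (tC (FVar 1) (FVar 2))))) (tC tZ (FVar 4)),
       tEv (FVar 0) (tC (tC tZ (FVar 3)) (FVar 1))
         (tC (num 4) (tC (FVar 0) (tC (tC tZ (FVar 3)) (tC (FVar 1) (FVar 2)))))),
    (tAp (tC (num 5) (FVar 0)) (FVar 1), tAcc)]"

text \<open>Arbitrary substitutions are needed for the model, whose carrier contains the open term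
  \<open>FVar 0\<close>. Closed substitutions, as in \<open>cstep\<close>, yield well-formed trees
  and hence provable equalities. Both rewrite at the root only.\<close>

definition step :: "fo \<Rightarrow> fo \<Rightarrow> bool" where
  "step s t \<longleftrightarrow> (\<exists>(L, R)\<in>set rules. \<exists>\<sigma>. s = feval FApp \<sigma> L \<and> t = feval FApp \<sigma> R)"
definition cstep :: "fo \<Rightarrow> fo \<Rightarrow> bool" where
  "cstep s t \<longleftrightarrow> (\<exists>(L, R)\<in>set rules. \<exists>\<sigma>. (\<forall>j. wff 0 (\<sigma> j)) \<and> s = feval FApp \<sigma> L \<and> t = feval FApp \<sigma> R)"

lemma cstep_step: "cstep s t \<Longrightarrow> step s t"
  unfolding cstep_def step_def by fast

text \<open>No two left-hand sides have a common instance, and every variable of a right-hand side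
  occurs on the left.\<close>

lemma step_det: "step s t \<Longrightarrow> step s u \<Longrightarrow> t = u"
  unfolding step_def rules_def by (simp, elim disjE exE conjE; simp)

lemma not_step_tAcc: "\<not> step tAcc t"
  unfolding step_def rules_def by simp

text \<open>Padding with a closed term makes the substitution closed at every index.\<close>

definition subst_of :: "fo list \<Rightarrow> nat \<Rightarrow> fo" where
  "subst_of xs j = (if j < length xs then xs ! j else tZ)"

lemma cstepI:
  assumes "n < length rules" "list_all (wff 0) xs"
    "s = feval FApp (subst_of xs) (fst (rules ! n))" "t = feval FApp (subst_of xs) (snd (rules ! n))"
  shows "cstep s t"
proof -
  have "rules ! n \<in> set rules" using assms(1) by simp
  moreover have "wff 0 (subst_of xs j)" for j using assms(2) by (auto simp: subst_of_def list_all_length ar_def)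
  ultimately show ?thesis using assms(3,4) unfolding cstep_def
    by (intro bexI[of _ "rules ! n"]) (auto split: prod.split intro!: exI[of _ "subst_of xs"])
qed

text \<open>The letters a to e instantiate \<open>FVar 0\<close> to \<open>FVar 4\<close>. Code tags
  0 to 5 follow the constructors of \<open>recf\<close>. Continuation tags mean: 0 call a function
  on the collected arguments, 1 evaluate the remaining arguments, 2 prepend a value, 3 perform a
  recursion step, 4 test a minimisation candidate, 5 accept.\<close>

lemma machine_steps:
  assumes [simp]: "wff 0 a" "wff 0 b" "wff 0 c" "wff 0 d" "wff 0 e"
  shows
    "cstep (tEv (tC (num 0) a) b c) (tAp c tZ)"
    "cstep (tEv (tC (num 1) a) tZ c) (tAp c (tC tZ tZ))"
    "cstep (tEv (tC (num 1) a) (tC b d) c) (tAp c (tC tZ b))"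
    "cstep (tEv (tC (num 2) a) tZ c) (tAp c tZ)"
    "cstep (tEv (tC (num 2) tZ) (tC b d) c) (tAp c b)"
    "cstep (tEv (tC (num 2) (tC tZ a)) (tC b d) c) (tEv (tC (num 2) a) d c)"
    "cstep (tEv (tC (num 3) (tC a b)) c d) (tEv (tC (num 6) b) c (tC (num 0) (tC a d)))"
    "cstep (tEv (tC (num 6) tZ) c d) (tAp d tZ)"
    "cstep (tEv (tC (num 6) (tC a b)) c d) (tEv a c (tC (num 1) (tC b (tC c d))))"
    "cstep (tAp (tC (num 1) (tC b (tC c d))) a) (tEv (tC (num 6) b) c (tC (num 2) (tC a d)))"
    "cstep (tAp (tC (num 2) (tC a d)) b) (tAp d (tC a b))"
    "cstep (tAp (tC (num 0) (tC a d)) b) (tEv a b d)"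
    "cstep (tEv (tC (num 4) (tC a b)) (tC tZ c) d) (tEv a c d)"
    "cstep (tEv (tC (num 4) (tC a b)) (tC (tC tZ e) c) d)
       (tEv (tC (num 4) (tC a b)) (tC e c) (tC (num 3) (tC b (tC e (tC c d)))))"
    "cstep (tAp (tC (num 3) (tC b (tC e (tC c d)))) a) (tEv b (tC e (tC a c)) d)"
    "cstep (tEv (tC (num 5) a) b c) (tEv a (tC tZ b) (tC (num 4) (tC a (tC tZ (tC b c)))))"
    "cstep (tAp (tC (num 4) (tC a (tC d (tC b c)))) tZ) (tAp c d)"
    "cstep (tAp (tC (num 4) (tC a (tC d (tC b c)))) (tC tZ e))
       (tEv a (tC (tC tZ d) b) (tC (num 4) (tC a (tC (tC tZ d) (tC b c)))))"
    "cstep (tAp (tC (num 5) a) b) tAcc"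
  by (rule cstepI[of 0 "[a, b, c, d, e]"] cstepI[of "Suc 0" "[a, b, c, d, e]"]
      cstepI[of 2 "[a, b, c, d, e]"] cstepI[of 3 "[a, b, c, d, e]"] cstepI[of 4 "[a, b, c, d, e]"]
      cstepI[of 5 "[a, b, c, d, e]"] cstepI[of 6 "[a, b, c, d, e]"] cstepI[of 7 "[a, b, c, d, e]"]
      cstepI[of 8 "[a, b, c, d, e]"] cstepI[of 9 "[a, b, c, d, e]"] cstepI[of 10 "[a, b, c, d, e]"]
      cstepI[of 11 "[a, b, c, d, e]"] cstepI[of 12 "[a, b, c, d, e]"] cstepI[of 13 "[a, b, c, d, e]"]
      cstepI[of 14 "[a, b, c, d, e]"] cstepI[of 15 "[a, b, c, d, e]"] cstepI[of 16 "[a, b, c, d, e]"]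
      cstepI[of 17 "[a, b, c, d, e]"] cstepI[of 18 "[a, b, c, d, e]"],
      simp_all add: rules_def subst_of_def; fail)+


section \<open>Simulation of recursive functions by the machine\<close>

definition flist :: "fo list \<Rightarrow> fo" where "flist ts = foldr (\<lambda>a b. tC a b) ts tZ"
abbreviation "lst xs \<equiv> flist (map num xs)"

lemma flist_simps [simp]: "flist [] = tZ" "flist (t # ts) = tC t (flist ts)"
  by (simp_all add: flist_def)

primrec code :: "recf \<Rightarrow> fo" where
  "code Zero = tC (num 0) tZ"
| "code Succ = tC (num 1) tZ"
| "code (Proj i) = tC (num 2) (num i)"
| "code (Comp f gs) = tC (num 3) (tC (code f) (flist (map code gs)))"
| "code (Prim f g) = tC (num 4) (tC (code f) (code g))"
| "code (Mn f) = tC (num 5) (code f)"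

lemma wff_tC [simp]: "wff n (tC a b) \<longleftrightarrow> wff n a \<and> wff n b" and wff_tZ [simp]: "wff n tZ"
  by (auto simp: ar_def One_nat_def)
lemmas [simp del] = wff.simps(2)

lemma wff_flist [simp]: "wff n (flist ts) \<longleftrightarrow> (\<forall>t\<in>set ts. wff n t)"
  by (induction ts) auto

lemma wff_code [simp]: "wff n (code f)"
  by (induction f) auto

lemma sim_Proj:
  "wff 0 k \<Longrightarrow> cstep\<^sup>+\<^sup>+ (tEv (code (Proj i)) (lst xs) k) (tAp k (num (if i < length xs then xs ! i else 0)))"
proof (induction xs arbitrary: i)
  case Nil
  then show ?case using machine_steps(4)[of "num i" _ k] by (auto simp: num_0)
next
  case (Cons x xs)
  show ?case
  proof (cases i)
    case 0
    then show ?thesis using machine_steps(5)[of _ "num x" k "lst xs"] Cons by (auto simp: num_0)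
  next
    case (Suc j)
    then have "cstep (tEv (code (Proj i)) (lst (x # xs)) k) (tEv (code (Proj j)) (lst xs) k)"
      using machine_steps(6)[of "num j" "num x" k "lst xs"] Cons.prems by (simp add: num_Suc)
    from tranclp_into_tranclp2[OF this Cons.IH[OF Cons.prems]] show ?thesis using Suc by (auto split: if_splits)
  qed
qed

text \<open>The simulation of each component is a hypothesis, so that this lemma can be applied
  inside the induction over \<open>reval\<close>. Values are collected on the way back by
  continuations with tag 2.\<close>

lemma sim_args:
  assumes "length ys = length gs" "wff 0 k"
    "\<And>j k. j < length gs \<Longrightarrow> wff 0 k \<Longrightarrow> cstep\<^sup>+\<^sup>+ (tEv (code (gs ! j)) (lst xs) k) (tAp k (num (ys ! j)))"
  shows "cstep\<^sup>+\<^sup>+ (tEv (tC (num 6) (flist (map code gs))) (lst xs) k) (tAp k (lst ys))"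
  using assms
proof (induction gs arbitrary: ys k)
  case Nil
  then show ?case using machine_steps(8)[of _ _ "lst xs" k] by auto
next
  case (Cons g gs)
  then obtain y ys' where ys: "ys = y # ys'" "length ys' = length gs" by (cases ys) auto
  have g: "wff 0 (flist (map code gs))" by simp
  let ?k1 = "tC (num 1) (tC (flist (map code gs)) (tC (lst xs) k))"
  let ?k2 = "tC (num 2) (tC (num y) k)"
  have "cstep (tEv (tC (num 6) (flist (map code (g # gs)))) (lst xs) k) (tEv (code g) (lst xs) ?k1)"
    using machine_steps(9)[of "code g" "flist (map code gs)" "lst xs" k] g Cons.prems(2) by simp
  moreover have "cstep\<^sup>+\<^sup>+ (tEv (code g) (lst xs) ?k1) (tAp ?k1 (num y))"
    using Cons.prems(3)[of 0 ?k1] g Cons.prems(2) ys by simp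
  moreover have "cstep (tAp ?k1 (num y)) (tEv (tC (num 6) (flist (map code gs))) (lst xs) ?k2)"
    using machine_steps(10)[of "num y" "flist (map code gs)" "lst xs" k] g Cons.prems(2) by simp
  moreover have "cstep\<^sup>+\<^sup>+ (tEv (tC (num 6) (flist (map code gs))) (lst xs) ?k2) (tAp ?k2 (lst ys'))"
    using Cons.IH[OF ys(2), of ?k2] Cons.prems(3)[of "Suc _"] Cons.prems(2) ys by auto
  moreover have "cstep (tAp ?k2 (lst ys')) (tAp k (lst ys))"
    using machine_steps(11)[of "num y" "lst ys'" _ k] Cons.prems(2) ys by simp
  ultimately show ?case by (meson tranclp.r_into_trancl tranclp_trans)
qed

text \<open>Stated for every closed continuation, since each rule pushes its own before a
  subcomputation starts. At least one step is claimed: \<open>run_diverges\<close> needs strict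
  progress.\<close>

lemma sim: "reval f xs v \<Longrightarrow> wff 0 k \<Longrightarrow> cstep\<^sup>+\<^sup>+ (tEv (code f) (lst xs) k) (tAp k (num v))"
proof (induction arbitrary: k rule: reval.induct)
  case (r_zero xs)
  then show ?case using machine_steps(1)[of tZ "lst xs" k] by (auto simp: num_0)
next
  case (r_succ xs)
  then show ?case using machine_steps(2)[of tZ _ k] machine_steps(3)[of tZ _ k]
    by (cases xs) (auto simp: num_0 num_Suc)
next
  case (r_proj i xs)
  then show ?case by (rule sim_Proj)
next
  case (r_comp ys gs xs f z)
  let ?k = "tC (num 0) (tC (code f) k)"
  have g: "wff 0 (flist (map code gs))" by simp
  have "cstep (tEv (code (Comp f gs)) (lst xs) k) (tEv (tC (num 6) (flist (map code gs))) (lst xs) ?k)"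
    using machine_steps(7)[of "code f" "flist (map code gs)" "lst xs" k] g r_comp.prems by simp
  moreover have "cstep\<^sup>+\<^sup>+ (tEv (tC (num 6) (flist (map code gs))) (lst xs) ?k) (tAp ?k (lst ys))"
    by (rule sim_args[OF r_comp(1)]) (use r_comp in auto)
  moreover have "cstep (tAp ?k (lst ys)) (tEv (code f) (lst ys) k)"
    using machine_steps(12)[of "code f" "lst ys" _ k] r_comp.prems by simp
  moreover have "cstep\<^sup>+\<^sup>+ (tEv (code f) (lst ys) k) (tAp k (num z))" using r_comp by blast
  ultimately show ?case by (meson tranclp.r_into_trancl tranclp_trans)
next
  case (r_prim0 f xs y g)
  have "cstep (tEv (code (Prim f g)) (lst (0 # xs)) k) (tEv (code f) (lst xs) k)"
    using machine_steps(13)[of "code f" "code g" "lst xs" k] r_prim0.prems by (simp add: num_0)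
  then show ?case using r_prim0 by (blast intro: tranclp_into_tranclp2)
next
  case (r_primS f g n xs r y)
  let ?k = "tC (num 3) (tC (code g) (tC (num n) (tC (lst xs) k)))"
  have "cstep (tEv (code (Prim f g)) (lst (Suc n # xs)) k) (tEv (code (Prim f g)) (lst (n # xs)) ?k)"
    using machine_steps(14)[of "code f" "code g" "lst xs" k "num n"] r_primS.prems by (simp add: num_Suc)
  moreover have "cstep\<^sup>+\<^sup>+ (tEv (code (Prim f g)) (lst (n # xs)) ?k) (tAp ?k (num r))"
    by (rule r_primS.IH(1)) (use r_primS.prems in simp)
  moreover have "cstep (tAp ?k (num r)) (tEv (code g) (lst (n # r # xs)) k)"
    using machine_steps(15)[of "num r" "code g" "lst xs" k "num n"] r_primS.prems by simp
  moreover have "cstep\<^sup>+\<^sup>+ (tEv (code g) (lst (n # r # xs)) k) (tAp k (num y))"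
    by (rule r_primS.IH(2)) (use r_primS.prems in simp)
  ultimately show ?case by (meson tranclp.r_into_trancl tranclp_trans)
next
  case (r_mn f n xs)
  let ?k = "\<lambda>m. tC (num 4) (tC (code f) (tC (num m) (tC (lst xs) k)))"
  have "cstep\<^sup>+\<^sup>+ (tEv (code (Mn f)) (lst xs) k) (tEv (code f) (lst (m # xs)) (?k m))" if "m \<le> n" for m
    using that
  proof (induction m)
    case 0
    then show ?case using machine_steps(16)[of "code f" "lst xs" k] r_mn.prems by (auto simp: num_0)
  next
    case (Suc m)
    then obtain w where "\<And>k. wff 0 k \<Longrightarrow> cstep\<^sup>+\<^sup>+ (tEv (code f) (lst (m # xs)) k) (tAp k (num (Suc w)))"
      using r_mn.IH(2) by (metis Suc_le_eq not0_implies_Suc)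
    then have "cstep\<^sup>+\<^sup>+ (tEv (code f) (lst (m # xs)) (?k m)) (tAp (?k m) (num (Suc w)))"
      using r_mn.prems by simp
    moreover have "cstep (tAp (?k m) (num (Suc w))) (tEv (code f) (lst (Suc m # xs)) (?k (Suc m)))"
      using machine_steps(18)[of "code f" "lst xs" k "num m" "num w"] r_mn.prems by (simp add: num_Suc)
    moreover have "cstep\<^sup>+\<^sup>+ (tEv (code (Mn f)) (lst xs) k) (tEv (code f) (lst (m # xs)) (?k m))"
      using Suc by simp
    ultimately show ?case by (meson tranclp.r_into_trancl tranclp_trans)
  qed
  from this[of n] have "cstep\<^sup>+\<^sup>+ (tEv (code (Mn f)) (lst xs) k) (tEv (code f) (lst (n # xs)) (?k n))" by simp
  moreover have "cstep\<^sup>+\<^sup>+ (tEv (code f) (lst (n # xs)) (?k n)) (tAp (?k n) (num 0))"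
    by (rule r_mn.IH(1)) (use r_mn.prems in simp)
  moreover have "cstep (tAp (?k n) (num 0)) (tAp k (num n))"
    using machine_steps(17)[of "code f" "lst xs" k "num n"] r_mn.prems by (simp add: num_0)
  ultimately show ?case by (meson tranclp.r_into_trancl tranclp_trans)
qed

definition run :: "recf \<Rightarrow> nat \<Rightarrow> fo \<Rightarrow> fo" where
  "run g x t = tEv (code (Mn g)) (tC (num x) (tC t tZ)) (tC (num 5) tZ)"

lemma run_accepts:
  assumes "reval (Mn g) [x, y] n" shows "cstep\<^sup>+\<^sup>+ (run g x (num y)) tAcc"
proof -
  have "cstep\<^sup>+\<^sup>+ (run g x (num y)) (tAp (tC (num 5) tZ) (num n))"
    using sim[OF assms, of "tC (num 5) tZ"] by (simp add: run_def)
  moreover have "cstep (tAp (tC (num 5) tZ) (num n)) tAcc" using machine_steps(19)[of tZ "num n" tZ tZ tZ] by simp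
  ultimately show ?thesis by (rule tranclp.trancl_into_trancl)
qed

text \<open>By determinism, and because \<open>tAcc\<close> has no successor, a path to
  \<open>tAcc\<close> runs through every state reachable in at least one step; from there it is
  strictly shorter.\<close>

lemma step_path: "step\<^sup>+\<^sup>+ s u \<Longrightarrow> (step ^^ n) s tAcc \<Longrightarrow> \<exists>m<n. (step ^^ m) u tAcc"
proof (induction arbitrary: n rule: converse_tranclp_induct)
  case (base s)
  then have "s \<noteq> tAcc" using not_step_tAcc by blast
  then obtain m where "n = Suc m" using base(2) by (cases n) auto
  moreover obtain t where "step s t" "(step ^^ m) t tAcc"
    using relpowp_Suc_D2 base(2) calculation by metis
  ultimately show ?case using step_det base(1) by blast
next
  case (step s t)
  then have "s \<noteq> tAcc" using not_step_tAcc by blast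
  then obtain m where n: "n = Suc m" using step(4) by (cases n) auto
  moreover obtain t' where "step s t'" "(step ^^ m) t' tAcc"
    using relpowp_Suc_D2 step(4) calculation by metis
  moreover have "t' = t" using step_det step(1) calculation by blast
  ultimately show ?case using step.IH[of m] less_SucI by blast
qed

lemma cstep_trancl_step: "cstep\<^sup>+\<^sup>+ s t \<Longrightarrow> step\<^sup>+\<^sup>+ s t"
  by (induction rule: tranclp_induct) (auto intro: cstep_step tranclp.trancl_into_trancl)

text \<open>Infinite descent: an accepting path from the test of candidate z would pass through the
  test of \<open>Suc z\<close> and contain a shorter accepting path.\<close>

lemma run_diverges:
  assumes "\<And>z. \<exists>v. reval g [z, x, y] (Suc v)"
  shows "\<not> step\<^sup>*\<^sup>* (run g x (num y)) tAcc"
proof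
  let ?k = "\<lambda>z. tC (num 4) (tC (code g) (tC (num z) (tC (lst [x, y]) (tC (num 5) tZ))))"
  have loop: "\<not> (step ^^ n) (tEv (code g) (lst [z, x, y]) (?k z)) tAcc" for n z
  proof (induction n arbitrary: z rule: less_induct)
    case (less n)
    obtain v where "reval g [z, x, y] (Suc v)" using assms by blast
    from sim[OF this, of "?k z"]
    have "cstep\<^sup>+\<^sup>+ (tEv (code g) (lst [z, x, y]) (?k z)) (tAp (?k z) (num (Suc v)))" by simp
    moreover have "cstep (tAp (?k z) (num (Suc v))) (tEv (code g) (lst [Suc z, x, y]) (?k (Suc z)))"
      using machine_steps(18)[of "code g" "lst [x, y]" "tC (num 5) tZ" "num z" "num v"]
      by (simp add: num_Suc)
    ultimately have "step\<^sup>+\<^sup>+ (tEv (code g) (lst [z, x, y]) (?k z)) (tEv (code g) (lst [Suc z, x, y]) (?k (Suc z)))"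
      by (intro cstep_trancl_step) (rule tranclp.trancl_into_trancl)
    with less step_path show ?case by blast
  qed
  assume "step\<^sup>*\<^sup>* (run g x (num y)) tAcc"
  then obtain n where "(step ^^ n) (run g x (num y)) tAcc" by (metis rtranclp_imp_relpowp)
  moreover have "cstep (run g x (num y)) (tEv (code g) (lst [0, x, y]) (?k 0))"
    using machine_steps(16)[of "code g" "lst [x, y]" "tC (num 5) tZ" tZ tZ] by (simp add: run_def num_0)
  ultimately show False using step_path[OF cstep_trancl_step[OF tranclp.r_into_trancl]] loop by blast
qed

section \<open>The reduction\<close>

text \<open>\<open>Rd\<close> measures the right spine of \<open>C\<close> cells, ignoring heads,
  and sends every non-data head to zero except \<open>Rd\<close> itself. There is one rule for each
  of the operations 0 to 5; the remaining one equals \<open>tAcc\<close> already.\<close>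

definition rrules :: "(fo \<times> fo) list" where
  "rrules = [(tRd tZ, tZ), (tRd (tC (FVar 0) (FVar 1)), tC tZ (tRd (FVar 1))), (tRd tAcc, tZ),
    (tRd (tEv (FVar 0) (FVar 1) (FVar 2)), tZ), (tRd (tAp (FVar 0) (FVar 1)), tZ), (tRd (tRd (FVar 0)), tRd (FVar 0))]"

definition heqs :: "equation list" where
  "heqs = map (\<lambda>(L, R). ([], replicate 6 One, tm L, tm R)) (rules @ rrules) @
     [([], replicate 6 One, TOp 6 VUnit (TZ 0 VUnit), tm tAcc)]"

definition search_handler :: "recf \<Rightarrow> nat \<Rightarrow> tmpl list" where
  "search_handler g x = map (\<lambda>i. TOp i VUnit (TZ 0 (VVar 0))) [0, 1, 2, 3, 4, 5] @ [tm (run g x (tRd (FVar 0)))]"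

lemma ar_simps: "ar ! 0 = 0" "ar ! 1 = 2" "ar ! 2 = 3" "ar ! 3 = 2" "ar ! 4 = 0" "ar ! 5 = 1"
  by (simp_all add: ar_def One_nat_def)

lemma wff_rules: "(L, R) \<in> set (rules @ rrules) \<Longrightarrow> wff 6 L \<and> wff 6 R"
  unfolding rules_def rrules_def
  by (simp add: wff.simps(2) ar_simps, elim disjE conjE; simp add: wff.simps(2) ar_simps)

lemma wff_run: "wff n t \<Longrightarrow> wff n (run g x t)"
  by (simp add: run_def wff.simps(2) ar_simps)

lemma wf_theory_heqs: "wf_theory hsig heqs"
proof -
  have "wfT hsig [] (replicate 6 One) (tm L) \<and> wfT hsig [] (replicate 6 One) (tm R)"
    if "(L, R) \<in> set (rules @ rrules)" for L R
    using wff_rules[OF that] wfT_tm by blast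
  moreover have "wfT hsig [] (replicate 6 One) (TOp 6 VUnit (TZ 0 VUnit))"
    using wfT.intros(1)[of 0 "replicate 6 One" "[One]" VUnit hsig]
    by (intro wfT.intros(4)) (auto simp: hsig_6 length_hsig intro: typeV.intros)
  moreover have "wfT hsig [] (replicate 6 One) (tm tAcc)"
    by (rule wfT_tm) (simp add: wff.simps(2) ar_simps)
  ultimately show ?thesis unfolding wf_theory_def heqs_def by auto
qed

lemma less_6: "(i :: nat) < 6 \<longleftrightarrow> i = 0 \<or> i = 1 \<or> i = 2 \<or> i = 3 \<or> i = 4 \<or> i = 5"
  by auto

lemma search_handler_nth: "i < 6 \<Longrightarrow> search_handler g x ! i = TOp i VUnit (TZ 0 (VVar 0))"
  "search_handler g x ! 6 = tm (run g x (tRd (FVar 0)))"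
  by (auto simp: search_handler_def less_6 One_nat_def)

lemma wf_handler_search_handler: "wf_handler hsig (search_handler g x)"
proof -
  have "wfT hsig [fst (hsig ! i)] [snd (hsig ! i)] (search_handler g x ! i)" if i: "i < 7" for i
  proof (cases "i = 6")
    case True
    have "wfT hsig [One] (replicate 1 One) (tm (run g x (tRd (FVar 0))))"
      by (rule wfT_tm, rule wff_run) (simp add: wff.simps(2) ar_simps)
    then show ?thesis by (simp add: True hsig_6 search_handler_nth(2) One_nat_def)
  next
    case False
    then have "i < 6" using i by simp
    have "wfT hsig [snd (hsig ! i), One] [snd (hsig ! i)] (TZ 0 (VVar 0))"
      using wfT.intros(1)[of 0 "[snd (hsig ! i)]"] typeV.intros(1)[of 0 "[snd (hsig ! i), One]"] by simp
    then show ?thesis using \<open>i < 6\<close>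
      by (auto simp: search_handler_nth hsig_nth length_hsig intro!: wfT.intros(4) intro: typeV.intros)
  qed
  then show ?thesis by (simp add: wf_handler_def length_hsig search_handler_def)
qed

section \<open>Provable equality of terms in the fixed theory\<close>

lemma teq_nodeI:
  assumes "i < 6" "\<And>l. l < ar ! i \<Longrightarrow> teq hsig eqs (k (EInj l EUnit)) (k' (EInj l EUnit))"
  shows "teq hsig eqs (Node i EUnit k) (Node i EUnit k')"
  using assms by (intro teq_cong) (auto simp: hsig_nth length_hsig inT_args inT_One)

lemma teq_tm:
  assumes "wff n t" "\<And>j. j < n \<Longrightarrow> teq hsig eqs (b j EUnit) (\<beta> j)"
  shows "teq hsig eqs (evalT Node env b (tm t)) (feval (nop Node) \<beta> t)"
  by (rule tm_rel[where R = "teq hsig eqs" and n = n])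
    (auto simp: nop_def assms intro!: teq_nodeI)

text \<open>On terms free of operation 6 the handler acts as the identity up to provable equality,
  so all equations but the one for operation 6 survive handling.\<close>

lemma teq_tm_hops:
  assumes "wff n t" "\<And>j. j < n \<Longrightarrow> teq hsig eqs (b j EUnit) (\<beta> j)"
  shows "teq hsig eqs (evalT (hops (search_handler g x)) env b (tm t)) (feval (nop Node) \<beta> t)"
  by (rule tm_rel[where R = "teq hsig eqs" and n = n])
    (auto simp: nop_def hops_def search_handler_nth assms intro!: teq_nodeI)

lemma teq_nop:
  assumes "i < 6" "length xs = ar ! i" "length ys = ar ! i" "\<And>l. l < ar ! i \<Longrightarrow> teq hsig eqs (xs ! l) (ys ! l)"
  shows "teq hsig eqs (nop Node i xs) (nop Node i ys)"
  unfolding nop_def using assms by (intro teq_nodeI) auto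

lemma teq_feval:
  assumes "\<And>j. j < n \<Longrightarrow> teq hsig eqs (\<alpha> j) (\<beta> j)"
  shows "wff n t \<Longrightarrow> teq hsig eqs (feval (nop Node) \<alpha> t) (feval (nop Node) \<beta> t)"
  by (induction t) (auto intro!: teq_nop assms simp: wff.simps(2))

lemma wft_feval:
  assumes "\<And>j. j < n \<Longrightarrow> wft hsig (\<beta> j)"
  shows "wff n t \<Longrightarrow> wft hsig (feval (nop Node) \<beta> t)"
  using teq_wft(1)[OF wf_theory_heqs teq_feval[where n = n and \<alpha> = \<beta> and \<beta> = \<beta>]] assms
  by (blast intro: teq_refl)

abbreviation ground :: "fo \<Rightarrow> tree" where "ground \<equiv> feval (nop Node) (\<lambda>_. Dummy)"

lemma wft_ground: "wff 0 t \<Longrightarrow> wft hsig (ground t)"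
  by (rule wft_feval) auto

lemma rule_teq:
  assumes "(L, R) \<in> set (rules @ rrules)" "\<And>j. j < 6 \<Longrightarrow> wft hsig (\<beta> j)"
  shows "teq hsig heqs (feval (nop Node) \<beta> L) (feval (nop Node) \<beta> R)"
proof -
  have "([], replicate 6 One, tm L, tm R) \<in> set heqs"
    using assms(1) by (force simp: heqs_def)
  then have "teq hsig heqs (evalT Node [] (\<lambda>j _. \<beta> j) (tm L)) (evalT Node [] (\<lambda>j _. \<beta> j) (tm R))"
    by (rule teq_ax) (use assms(2) in auto)
  moreover have "teq hsig heqs (evalT Node [] (\<lambda>j _. \<beta> j) (tm L)) (feval (nop Node) \<beta> L)"
    "teq hsig heqs (evalT Node [] (\<lambda>j _. \<beta> j) (tm R)) (feval (nop Node) \<beta> R)"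
    using wff_rules[OF assms(1)] by (auto intro!: teq_tm teq_refl assms(2))
  ultimately show ?thesis by (meson teq_sym teq_trans)
qed

lemma cstep_teq:
  assumes "cstep s t" shows "teq hsig heqs (ground s) (ground t)"
proof -
  obtain L R \<sigma> where "(L, R) \<in> set rules" "\<And>j. wff 0 (\<sigma> j)" "s = feval FApp \<sigma> L" "t = feval FApp \<sigma> R"
    using assms unfolding cstep_def by blast
  then show ?thesis
    using rule_teq[of L R "\<lambda>j. ground (\<sigma> j)"] by (simp add: feval_feval wft_ground)
qed

lemma cstep_trancl_teq: "cstep\<^sup>+\<^sup>+ s t \<Longrightarrow> teq hsig heqs (ground s) (ground t)"
  by (induction rule: tranclp_induct) (blast intro: cstep_teq teq_trans)+

lemma Rd_teq:
  assumes "wft hsig a" "wft hsig b" "wft hsig c"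
  shows "teq hsig heqs (nop Node 5 [nop Node 0 []]) (nop Node 0 [])"
    "teq hsig heqs (nop Node 5 [nop Node 1 [a, b]]) (nop Node 1 [nop Node 0 [], nop Node 5 [b]])"
    "teq hsig heqs (nop Node 5 [nop Node 4 []]) (nop Node 0 [])"
    "teq hsig heqs (nop Node 5 [nop Node 2 [a, b, c]]) (nop Node 0 [])"
    "teq hsig heqs (nop Node 5 [nop Node 3 [a, b]]) (nop Node 0 [])"
    "teq hsig heqs (nop Node 5 [nop Node 5 [a]]) (nop Node 5 [a])"
proof -
  let ?\<beta> = "\<lambda>j :: nat. if j = 0 then a else if j = 1 then b else c"
  have *: "teq hsig heqs (feval (nop Node) ?\<beta> (fst (rrules ! n))) (feval (nop Node) ?\<beta> (snd (rrules ! n)))"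
    if "n < 6" for n
    by (rule rule_teq) (use that assms in \<open>auto simp: rrules_def less_6 One_nat_def\<close>)
  show "teq hsig heqs (nop Node 5 [nop Node 0 []]) (nop Node 0 [])"
    "teq hsig heqs (nop Node 5 [nop Node 1 [a, b]]) (nop Node 1 [nop Node 0 [], nop Node 5 [b]])"
    "teq hsig heqs (nop Node 5 [nop Node 4 []]) (nop Node 0 [])"
    "teq hsig heqs (nop Node 5 [nop Node 2 [a, b, c]]) (nop Node 0 [])"
    "teq hsig heqs (nop Node 5 [nop Node 3 [a, b]]) (nop Node 0 [])"
    "teq hsig heqs (nop Node 5 [nop Node 5 [a]]) (nop Node 5 [a])"
    using *[of 0] *[of 1] *[of 2] *[of 3] *[of 4] *[of 5] by (simp_all add: rrules_def One_nat_def)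
qed

text \<open>The axiom speaks about the constant continuation only; congruence first makes
  \<open>k\<close> constant, as \<open>EUnit\<close> is its sole well-typed argument.\<close>

lemma teq_P:
  assumes "wft hsig (Node 6 EUnit k)" shows "teq hsig heqs (Node 6 EUnit k) (nop Node 4 [])"
proof -
  have k: "wft hsig (k EUnit)" using assms by cases (auto simp: hsig_6 inT_One)
  have "teq hsig heqs (Node 6 EUnit k) (Node 6 EUnit (\<lambda>_. k EUnit))"
    by (rule teq_cong) (auto simp: hsig_6 length_hsig inT_One k intro: teq_refl)
  moreover have "([], replicate 6 One, TOp 6 VUnit (TZ 0 VUnit), tm tAcc) \<in> set heqs"
    by (simp add: heqs_def)
  then have "teq hsig heqs (evalT Node [] (\<lambda>_ _. k EUnit) (TOp 6 VUnit (TZ 0 VUnit)))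
      (evalT Node [] (\<lambda>_ _. k EUnit) (tm tAcc))"
    by (rule teq_ax) (auto simp: k)
  moreover have "teq hsig heqs (evalT Node [] (\<lambda>_ _. k EUnit) (tm tAcc)) (nop Node 4 [])"
    using teq_tm[of 0 tAcc heqs "\<lambda>_ _. k EUnit"] by (simp add: wff.simps(2) ar_simps)
  ultimately show ?thesis by (simp, meson teq_trans)
qed

text \<open>The terms Rd(v) are provably numerals, so that junk values of v are harmless.\<close>

lemma Rd_numeral: "wft hsig v \<Longrightarrow> \<exists>n. teq hsig heqs (nop Node 5 [v]) (ground (num n))"
proof (induction rule: wft.induct)
  case (1 i a k)
  let ?e = "\<lambda>l. k (EInj l EUnit)"
  have a: "a = EUnit" using 1(1,2) hsig_nth[of i] hsig_6
    by (cases "i < 6") (auto simp: length_hsig inT_One less_Suc_eq numeral_eq_Suc)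
  have w: "wft hsig (Node i a k)" using 1 by (auto intro: wft.intros)
  have Rd: "teq hsig heqs (nop Node 5 [Node i a k]) (nop Node 5 [u])"
    if "teq hsig heqs (Node i a k) u" for u
    using that by (intro teq_nop) (auto simp: ar_simps One_nat_def)
  show ?case
  proof (cases "i = 6")
    case True
    with w a have "teq hsig heqs (Node i a k) (nop Node 4 [])" using teq_P by simp
    moreover have "teq hsig heqs (nop Node 5 [nop Node 4 []]) (ground (num 0))"
      using Rd_teq(3)[OF w w w] by (simp add: num_0)
    ultimately show ?thesis using Rd teq_trans by blast
  next
    case False
    then have i: "i < 6" using 1(1) by (simp add: length_hsig)
    have e: "wft hsig (?e l)" "\<exists>n. teq hsig heqs (nop Node 5 [?e l]) (ground (num n))" if "l < ar ! i" for l
      using 1(3) that i by (auto simp: hsig_nth inT_args)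
    \<comment> \<open>Puts the node into the form to which the equations for \<open>Rd\<close>
      apply.\<close>
    have "teq hsig heqs (Node i a k) (nop Node i (map ?e [0..<ar ! i]))"
      unfolding nop_def a by (rule teq_nodeI[OF i]) (auto intro: teq_refl e)
    note v = Rd[OF this]
    have args: "map f [0..<1] = [f 0]" "map f [0..<2] = [f 0, f 1]" "map f [0..<3] = [f 0, f 1, f 2]"
      for f :: "nat \<Rightarrow> tree" by (simp_all add: One_nat_def numeral_eq_Suc)
    have "\<exists>n. teq hsig heqs (nop Node 5 [nop Node i (map ?e [0..<ar ! i])]) (ground (num n))"
    proof -
      consider "i = 0" | "i = 1" | "i = 2" | "i = 3" | "i = 4" | "i = 5" using i unfolding less_6 by blast
      then show ?thesis
      proof cases
        case 1
        then show ?thesis using Rd_teq(1)[OF w w w] by (intro exI[of _ 0]) (simp add: num_0 ar_simps)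
      next
        case 2
        then obtain n where n: "teq hsig heqs (nop Node 5 [?e 1]) (ground (num n))"
          using e(2)[of 1] by (auto simp: ar_simps)
        have "teq hsig heqs (nop Node 5 [nop Node 1 [?e 0, ?e 1]]) (nop Node 1 [nop Node 0 [], nop Node 5 [?e 1]])"
          using 2 by (intro Rd_teq(2)[of _ _ "?e 0"] e(1)) (auto simp: ar_simps)
        moreover have "teq hsig heqs (nop Node 1 [nop Node 0 [], nop Node 5 [?e 1]]) (ground (num (Suc n)))"
          using n wft_ground[of tZ]
          by (auto simp: num_Suc ar_simps less_Suc_eq numeral_2_eq_2 intro!: teq_nop teq_refl)
        ultimately have "teq hsig heqs (nop Node 5 [nop Node 1 [?e 0, ?e 1]]) (ground (num (Suc n)))"
          by (rule teq_trans)
        then show ?thesis using 2 by (auto simp: ar_simps args)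
      next
        case 3
        have "teq hsig heqs (nop Node 5 [nop Node 2 [?e 0, ?e 1, ?e 2]]) (nop Node 0 [])"
          using 3 by (intro Rd_teq(4) e(1)) (auto simp: ar_simps)
        then show ?thesis using 3 by (intro exI[of _ 0]) (simp add: num_0 ar_simps args)
      next
        case 4
        have "teq hsig heqs (nop Node 5 [nop Node 3 [?e 0, ?e 1]]) (nop Node 0 [])"
          using 4 by (intro Rd_teq(5)[of _ _ "?e 0"] e(1)) (auto simp: ar_simps)
        then show ?thesis using 4 by (intro exI[of _ 0]) (simp add: num_0 ar_simps args)
      next
        case 5
        then show ?thesis using Rd_teq(3)[OF w w w] by (intro exI[of _ 0]) (simp add: num_0 ar_simps)
      next
        case 6
        then obtain n where n: "teq hsig heqs (nop Node 5 [?e 0]) (ground (num n))"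
          using e(2)[of 0] by (auto simp: ar_simps)
        have "teq hsig heqs (nop Node 5 [nop Node 5 [?e 0]]) (nop Node 5 [?e 0])"
          using 6 by (intro Rd_teq(6)[of _ "?e 0" "?e 0"] e(1)) (auto simp: ar_simps)
        from teq_trans[OF this n] show ?thesis using 6 by (auto simp: ar_simps args)
      qed
    qed
    with v show ?thesis using teq_trans by blast
  qed
qed

section \<open>The model separating diverging runs from acceptance\<close>

fun num_val :: "fo \<Rightarrow> nat" where
  "num_val (FApp i [a, b]) = (if i = 1 then Suc (num_val b) else 0)"
| "num_val _ = 0"

lemma num_val_num [simp]: "num_val (num n) = n"
  by (induction n) (auto simp: num.simps)

definition outcome :: "fo \<Rightarrow> fo" where
  "outcome s = (if step\<^sup>*\<^sup>* s tAcc then tAcc else FVar 0)"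

text \<open>A model on all terms: configurations denote their outcome, so that every rule of the machine
  holds because the machine is deterministic. The value FVar 0 stands for divergence.\<close>

definition model_ops :: "nat \<Rightarrow> elem \<Rightarrow> (elem \<Rightarrow> fo) \<Rightarrow> fo" where
  "model_ops i a k = (let e = \<lambda>l. k (EInj l EUnit) in
     if i = 0 then tZ else if i = 1 then tC (e 0) (e 1)
     else if i = 2 then outcome (tEv (e 0) (e 1) (e 2)) else if i = 3 then outcome (tAp (e 0) (e 1))
     else if i = 5 then num (num_val (e 0)) else tAcc)"

lemma nop_model_ops:
  "nop model_ops 0 [] = tZ" "nop model_ops 1 [a, b] = tC a b" "nop model_ops 2 [a, b, c] = outcome (tEv a b c)"
  "nop model_ops 3 [a, b] = outcome (tAp a b)" "nop model_ops 4 [] = tAcc" "nop model_ops 5 [a] = num (num_val a)"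
  by (simp_all add: nop_def model_ops_def One_nat_def)

lemma model_ops_cong:
  "i < 6 \<Longrightarrow> (\<And>l. l < ar ! i \<Longrightarrow> k (EInj l EUnit) = k' (EInj l EUnit)) \<Longrightarrow> model_ops i a k = model_ops i a' k'"
  unfolding less_6 by (elim disjE) (simp_all add: model_ops_def ar_simps)

text \<open>The last \<open>else\<close> of \<open>model_ops\<close> covers operation 6 together
  with \<open>Acc\<close>, which validates the equation between them.\<close>

lemma model_ops_6: "model_ops 6 a k = tAcc"
  by (simp add: model_ops_def)

lemma feval_model_ops_num [simp]: "feval (nop model_ops) \<beta> (num n) = num n"
  by (induction n) (auto simp: num.simps nop_model_ops)

text \<open>Codes are built from Z and C alone, so both substitution and the model leave them
  fixed.\<close>

lemma feval_code:
  assumes "F 0 [] = tZ" "\<And>a b. F 1 [a, b] = tC a b"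
  shows "feval F \<beta> (code f) = code f"
proof -
  have num: "feval F \<beta> (num n) = num n" for n by (induction n) (auto simp: num.simps assms)
  have "feval F \<beta> (flist ts) = flist (map (feval F \<beta>) ts)" for ts
    by (induction ts) (auto simp: assms)
  then show ?thesis by (induction f) (auto simp: assms num comp_def cong: map_cong)
qed

lemma outcome_tAcc [simp]: "outcome tAcc = tAcc"
  by (simp add: outcome_def)

text \<open>From s to t this needs determinism and that \<open>tAcc\<close> has no successor; the
  converse merely prefixes a step.\<close>

lemma outcome_step:
  assumes "step s t" shows "outcome s = outcome t"
proof -
  have "step\<^sup>*\<^sup>* t tAcc" if "step\<^sup>*\<^sup>* s tAcc"
    using that
  proof (cases rule: converse_rtranclpE)
    case base
    then show ?thesis using assms not_step_tAcc by blast
  next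
    case (step u)
    then show ?thesis using step_det[OF assms] by blast
  qed
  moreover have "step\<^sup>*\<^sup>* s tAcc" if "step\<^sup>*\<^sup>* t tAcc"
    using assms that by (rule converse_rtranclp_into_rtranclp)
  ultimately show ?thesis unfolding outcome_def by auto
qed

text \<open>Z and C are interpreted freely and the arguments of configurations in the rules are pure
  data. Hence each side denotes the outcome of its substitution instance, and the two instances are
  one step apart.\<close>

lemma rules_model_ops:
  assumes "(L, R) \<in> set rules"
  shows "feval (nop model_ops) \<beta> L = feval (nop model_ops) \<beta> R"
proof -
  have "feval (nop model_ops) \<beta> L = outcome (feval FApp \<beta> L) \<and> feval (nop model_ops) \<beta> R = outcome (feval FApp \<beta> R)"
    using assms unfolding rules_def by (simp, elim disjE conjE; simp add: nop_model_ops)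
  moreover have "step (feval FApp \<beta> L) (feval FApp \<beta> R)" using assms unfolding step_def by blast
  ultimately show ?thesis using outcome_step by simp
qed

lemma num_val_outcome: "num_val (outcome s) = 0"
  by (simp add: outcome_def)

lemma rrules_model_ops:
  "(L, R) \<in> set rrules \<Longrightarrow> feval (nop model_ops) \<beta> L = feval (nop model_ops) \<beta> R"
  unfolding rrules_def by (simp, elim disjE conjE; simp add: nop_model_ops num_val_outcome num.simps)

primrec eval_model :: "tree \<Rightarrow> fo" where
  "eval_model Dummy = FVar 0"
| "eval_model (Node i a k) = model_ops i a (\<lambda>x. eval_model (k x))"

lemma eval_model_tm:
  assumes "wff n t" "\<And>j. j < n \<Longrightarrow> eval_model (b j EUnit) = \<beta> j"
  shows "eval_model (evalT Node env b (tm t)) = feval (nop model_ops) \<beta> t"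
  by (rule tm_rel[where R = "\<lambda>t d. eval_model t = d" and n = n])
    (auto simp: nop_def assms intro!: model_ops_cong)

text \<open>Soundness of the model, the only means used to refute a provable equality.\<close>

lemma teq_eval_model: "teq hsig heqs s t \<Longrightarrow> eval_model s = eval_model t"
proof (induction rule: teq.induct)
  case (teq_cong i a k k')
  show ?case
  proof (cases "i < 6")
    case True
    then show ?thesis using teq_cong by (auto intro!: model_ops_cong simp: hsig_nth inT_args)
  next
    case False
    then have "i = 6" using teq_cong(1) by (simp add: length_hsig)
    then show ?thesis by (simp add: model_ops_6)
  qed
next
  case (teq_ax \<Gamma> Z T1 T2 env b)
  then consider L R where "(L, R) \<in> set (rules @ rrules)" "T1 = tm L" "T2 = tm R"
    | "T1 = TOp 6 VUnit (TZ 0 VUnit)" "T2 = tm tAcc"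
    by (auto simp: heqs_def)
  then show ?case
  proof cases
    case 1
    then show ?thesis using wff_rules[OF 1(1)] rules_model_ops rrules_model_ops
      by (auto simp: eval_model_tm[where n = 6 and \<beta> = "\<lambda>j. eval_model (b j EUnit)"])
  next
    case 2
    then show ?thesis using eval_model_tm[of 0 tAcc b] by (simp add: model_ops_6 wff.simps(2) ar_simps nop_model_ops)
  qed
qed auto

text \<open>The program \<open>g\<close> returns 0 exactly on success, so minimisation over its
  first argument searches for \<open>z\<close>. Failure for some \<open>y\<close> is detected in the
  model; success for all \<open>y\<close> is turned into equational proofs by the
  simulation.\<close>

lemma correct_search_handler_iff:
  assumes total: "\<And>x y z. reval g [z, x, y] (if R x y z then 0 else 1)"
  shows "handler_correct hsig heqs (search_handler g x) \<longleftrightarrow> (\<forall>y. \<exists>z. R x y z)"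
proof
  let ?H = "search_handler g x"
  assume "handler_correct hsig heqs ?H"
  note c = this[unfolded handler_correct_iff[OF wf_theory_heqs wf_handler_search_handler]]
  show "\<forall>y. \<exists>z. R x y z"
  proof (rule allI, rule ccontr)
    fix y assume "\<not> (\<exists>z. R x y z)"
    then have "reval g [z, x, y] (Suc 0)" for z using total[of z x y] by (simp add: One_nat_def)
    then have div: "\<not> step\<^sup>*\<^sup>* (run g x (num y)) tAcc" using run_diverges by blast
    \<comment> \<open>The equation for operation 6 is instantiated at the numeral of the failing
      \<open>y\<close>. In the model \<open>Rd\<close> fixes numerals, so the handled left side
      denotes the outcome of the diverging run.\<close>
    let ?b = "\<lambda>_ :: nat. \<lambda>_ :: elem. ground (num y)"
    have "([], replicate 6 One, TOp 6 VUnit (TZ 0 VUnit), tm tAcc) \<in> set heqs" by (simp add: heqs_def)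
    from bspec[OF c this, unfolded prod.case, rule_format, of "[]" ?b]
    have "teq hsig heqs (evalT (hops ?H) [] ?b (TOp 6 VUnit (TZ 0 VUnit))) (evalT (hops ?H) [] ?b (tm tAcc))"
      by (simp add: wft_ground del: evalT.simps tm.simps)
    moreover have "teq hsig heqs (evalT (hops ?H) [] ?b (tm tAcc)) (ground tAcc)"
      using teq_tm_hops[of 0 tAcc heqs ?b] by (simp add: wff.simps(2) ar_simps)
    ultimately have "eval_model (evalT (hops ?H) [] ?b (TOp 6 VUnit (TZ 0 VUnit))) = eval_model (ground tAcc)"
      by (metis teq_eval_model)
    moreover have "eval_model (ground tAcc) = tAcc"
      by (simp add: nop_def model_ops_def)
    moreover have "evalT (hops ?H) [] ?b (TOp 6 VUnit (TZ 0 VUnit)) =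
        evalT Node [EUnit] ?b (tm (run g x (tRd (FVar 0))))"
      by (simp add: hops_def search_handler_nth)
    moreover have "eval_model (ground (num y)) = num y"
      by (induction y) (auto simp: num.simps nop_def model_ops_def)
    then have "eval_model (evalT Node [EUnit] ?b (tm (run g x (tRd (FVar 0))))) =
        feval (nop model_ops) (\<lambda>_. num y) (run g x (tRd (FVar 0)))"
      by (intro eval_model_tm[where n = 1] wff_run) (auto simp: wff.simps(2) ar_simps)
    ultimately have "outcome (run g x (num y)) = tAcc"
      by (simp add: run_def nop_model_ops feval_code)
    with div show False by (simp add: outcome_def)
  qed
next
  let ?H = "search_handler g x"
  assume R: "\<forall>y. \<exists>z. R x y z"
  have acc: "teq hsig heqs (ground (run g x (num y))) (ground tAcc)" for y
  proof -
    have "\<exists>z. R x y z" using R by blast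
    \<comment> \<open>The least witness: \<open>Mn\<close> requires nonzero values at all earlier
      candidates.\<close>
    define n where "n = (LEAST z. R x y z)"
    have "R x y n" unfolding n_def using \<open>\<exists>z. R x y z\<close> by (rule LeastI_ex)
    moreover have "\<not> R x y m" if "m < n" for m using that not_less_Least unfolding n_def by blast
    ultimately have "reval (Mn g) [x, y] n"
      using total[of _ x y] by (intro r_mn) (metis One_nat_def zero_neq_one)+
    then show ?thesis using run_accepts cstep_trancl_teq by blast
  qed
  show "handler_correct hsig heqs ?H"
    unfolding handler_correct_iff[OF wf_theory_heqs wf_handler_search_handler]
  proof (clarify)
    fix \<Gamma> Z T1 T2 env b
    assume e: "(\<Gamma>, Z, T1, T2) \<in> set heqs" and "list_all2 inT env \<Gamma>"
      and b: "\<forall>j<length Z. \<forall>x. inT x (Z ! j) \<longrightarrow> wft hsig (b j x)"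
    let ?\<beta> = "\<lambda>j. b j EUnit"
    have Z: "Z = replicate 6 One" using e by (auto simp: heqs_def)
    then have \<beta>: "wft hsig (?\<beta> j)" if "j < 6" for j using b that by (simp add: inT_One)
    have tm: "teq hsig heqs (evalT (hops ?H) env b (tm t)) (feval (nop Node) ?\<beta> t)" if "wff 6 t" for t
      using that \<beta> by (intro teq_tm_hops[where n = 6] teq_refl)
    consider L R where "(L, R) \<in> set (rules @ rrules)" "T1 = tm L" "T2 = tm R"
      | "T1 = TOp 6 VUnit (TZ 0 VUnit)" "T2 = tm tAcc"
      using e by (auto simp: heqs_def)
    then show "teq hsig heqs (evalT (hops ?H) env b T1) (evalT (hops ?H) env b T2)"
    proof cases
      case 1
      then show ?thesis using rule_teq[OF 1(1), of ?\<beta>] \<beta> tm wff_rules[OF 1(1)]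
        by (meson teq_sym teq_trans)
    next
      case 2
      obtain n where n: "teq hsig heqs (nop Node 5 [?\<beta> 0]) (ground (num n))"
        using Rd_numeral[OF \<beta>[of 0]] by auto
      have "teq hsig heqs (evalT Node [EUnit] (\<lambda>_ _. ?\<beta> 0) (tm (run g x (tRd (FVar 0)))))
          (feval (nop Node) (\<lambda>_. ?\<beta> 0) (run g x (tRd (FVar 0))))"
        using \<beta>[of 0] by (intro teq_tm[where n = 1] wff_run teq_refl) (auto simp: wff.simps(2) ar_simps)
      moreover have "evalT (hops ?H) env b T1 = evalT Node [EUnit] (\<lambda>_ _. ?\<beta> 0) (tm (run g x (tRd (FVar 0))))"
        by (simp add: 2 hops_def search_handler_nth)
      \<comment> \<open>Exhibits the input as the only variable part of the configuration, so that
        congruence can replace \<open>Rd\<close> of an arbitrary tree by the numeral n.\<close>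
      moreover have sub: "run g x t = feval FApp (\<lambda>_. t) (run g x (FVar 0))" for t
        by (simp add: run_def feval_code)
      have "teq hsig heqs (feval (nop Node) (\<lambda>_. ?\<beta> 0) (run g x (tRd (FVar 0)))) (ground (run g x (num n)))"
        unfolding sub[of "tRd (FVar 0)"] sub[of "num n"] feval_feval
        using n by (intro teq_feval[where n = 1] wff_run) auto
      moreover have "teq hsig heqs (evalT (hops ?H) env b T2) (ground tAcc)"
        using tm[of tAcc] 2 by (simp add: wff.simps(2) ar_simps)
      ultimately show ?thesis using acc[of n] by (metis teq_sym teq_trans)
    qed
  qed
qed


section \<open>Computability of the reduction\<close>

lemma c_le_snoc: "computable1 w \<Longrightarrow> computable1 (\<lambda>x. le (cs @ [w x]))"
  by (induction cs) (auto intro!: c_intros)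

lemma c_enc_num: "computable1 (\<lambda>x. enc_tmpl (tm (num x)))"
proof -
  let ?G = "\<lambda>r. pr 3 (pr 1 (pr (enc_val VUnit) (pr 2 (pr (enc_val (VVar 0)) (cns (enc_tmpl (tm tZ)) (cns r 0))))))"
  have "enc_tmpl (tm (num x)) = rec_nat (enc_tmpl (tm tZ)) (\<lambda>_ r. ?G r) x" for x
    by (induction x) (simp_all add: num.simps)
  moreover have "computable1 (\<lambda>x. rec_nat (enc_tmpl (tm tZ)) (\<lambda>_ r. ?G r) x)"
    by (intro c_rec c_intros)
  ultimately show ?thesis by simp
qed

text \<open>Signature, theory and the first six templates are constants; only the numeral of
  \<open>x\<close> in the last template varies.\<close>

lemma c_enc_search_handler: "computable1 (\<lambda>x. enc_instance hsig heqs (search_handler g x))"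
proof -
  have "computable1 (\<lambda>x. enc_tmpl (tm (run g x (tRd (FVar 0)))))"
    unfolding run_def tm.simps enc_tmpl.simps list.map list_encode.simps
    by (intro c_intros c_enc_num)
  then show ?thesis unfolding enc_instance_def search_handler_def map_append list.map
    by (intro c_pair c_const c_le_snoc)
qed

theorem Pi2_hard_CORRECT_HANDLER:
  assumes "Pi2 B" shows "many_one_reducible B CORRECT_HANDLER"
proof -
  obtain R where R: "decidable3 R" "\<And>x. x \<in> B \<longleftrightarrow> (\<forall>y. \<exists>z. R x y z)"
    using assms unfolding Pi2_def by blast
  obtain r where r: "\<And>x y z. reval r [x, y, z] (if R x y z then 1 else 0)"
    using R(1) unfolding decidable3_def by blast
  have "cmp 3 (\<lambda>ys. if R (ys ! 0) (ys ! 1) (ys ! 2) then 1 else 0)" unfolding cmp_def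
  proof (intro exI allI impI)
    fix ys :: "nat list" assume "length ys = 3"
    then obtain a b c where "ys = [a, b, c]" by (auto simp: numeral_3_eq_3 length_Suc_conv)
    then show "reval r ys (if R (ys ! 0) (ys ! 1) (ys ! 2) then 1 else 0)"
      using r[of a b c] by (simp add: One_nat_def numeral_2_eq_2)
  qed
  then have "cmp (length [\<lambda>ys. ys ! 1, \<lambda>ys. ys ! 2, \<lambda>ys. ys ! 0 :: nat])
      (\<lambda>ys. if R (ys ! 0) (ys ! 1) (ys ! 2) then 1 else 0)" by (simp add: numeral_3_eq_3)
  then have "cmp 3 (\<lambda>xs. (\<lambda>ys. if R (ys ! 0) (ys ! 1) (ys ! 2) then 1 else 0)
      (map (\<lambda>G. G xs) [\<lambda>ys. ys ! 1, \<lambda>ys. ys ! 2, \<lambda>ys. ys ! 0]))"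
    by (rule cmp_comp) (auto intro: cmp_proj)
  then have "cmp 3 (\<lambda>ys. if R (ys ! 1) (ys ! 2) (ys ! 0) then 1 else 0)"
    by (simp add: numeral_2_eq_2 One_nat_def)
  \<comment> \<open>Complementing the decision makes success the value 0. The arguments were rotated
    to the order z, x, y because \<open>Mn\<close> searches over the head of the list.\<close>
  from cmp_sub[OF cmp_const[of _ 1] this]
  obtain g where g: "\<And>ys. length ys = 3 \<Longrightarrow>
      reval g ys (1 - (if R (ys ! 1) (ys ! 2) (ys ! 0) then 1 else 0))"
    unfolding cmp_def by blast
  have total: "reval g [z, x, y] (if R x y z then 0 else 1)" for x y z
    using g[of "[z, x, y]"] by (auto simp: numeral_2_eq_2 One_nat_def split: if_splits)
  have "x \<in> B \<longleftrightarrow> enc_instance hsig heqs (search_handler g x) \<in> CORRECT_HANDLER" for x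
  proof -
    \<comment> \<open>Membership in \<open>CORRECT_HANDLER\<close> yields some correct instance with
      the same code. By \<open>correct_iff\<close> correctness depends on the code alone, which
      takes the place of injectivity of \<open>enc_instance\<close>.\<close>
    have "handler_correct hsig heqs (search_handler g x)"
      if "enc_instance hsig heqs (search_handler g x) = enc_instance sig eqs H" "wf_theory sig eqs"
        "wf_handler sig H" "handler_correct sig eqs H" for sig eqs H
      using that instance_code.correct_iff[OF instance_code.intro, OF that(2,3)]
        instance_code.correct_iff[OF instance_code.intro, OF wf_theory_heqs wf_handler_search_handler] by metis
    then show ?thesis unfolding R(2) correct_search_handler_iff[OF total, symmetric] CORRECT_HANDLER_def
      using wf_theory_heqs wf_handler_search_handler by blast
  qed
  then show ?thesis unfolding many_one_reducible_def using c_enc_search_handler by blast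
qed

theorem theorem6p2:
  shows "Pi2_complete CORRECT_HANDLER"
  unfolding Pi2_complete_def
  using Pi2_CORRECT_HANDLER Pi2_hard_CORRECT_HANDLER by blast

end
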